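(* For $(\theta,\beta)=(\tfrac12,1)$, the $C_0$-semigroup of contractions $S(t)=e^{t\mathbb{B}}$ on the Hilbert space $\mathcal{H}$ is analytic.
   Context: Let $\Omega\subset\mathbb{R}^n$ be a bounded open set with smooth boundary. $L^2(\Omega)$ is the complex Hilbert space with inner product $\langle\cdot,\cdot\rangle$ and norm $\|\cdot\|$. Let $A=-\Delta$ with domain $D(A)=H^2(\Omega)\cap H^1_0(\Omega)$; it is positive self-adjoint with compact inverse. For $s\in\mathbb{R}$, $A^s$ is the fractional power and $D(A^s)$ carries the norm $\|A^s u\|$ (for $s<0$, $D(A^s)$ is the completion of $L^2(\Omega)$ in this norm, and powers of $A$ are extended to this scale of spaces accordingly); $D(A^0)=L^2(\Omega)$. Fix constants $\alpha,\kappa,\gamma,\delta>0$ and parameters $0\le\theta\le1$, $0<\beta\le1$. The operator $I+\kappa A^\beta$ is extended to an isomorphism $D(A^{\beta/2})\to D(A^{-\beta/2})$ by $\langle (I+\kappa A^\beta)z_1,z_2\rangle_{D(A^{-\beta/2})\times D(A^{\beta/2})}=\langle z_1,z_2\rangle+\kappa\langle A^{\beta/2}z_1,A^{\beta/2}z_2\rangle$. The phase space is $\mathcal{H}=D(A)\times D(A^{1/2})\times D(A^{\beta/2})\times D(A^0)$, whose elements are written $U=(u,v,w,z)$, with the Hilbert norm $\|U\|_{\mathcal{H}}^2=\alpha\|Au\|^2+\alpha\|A^{1/2}v\|^2+\|w\|^2+\kappa\|A^{\beta/2}w\|^2+\|z\|^2$ (and the corresponding inner product). The operator $\mathbb{B}:D(\mathbb{B})\subset\mathcal{H}\to\mathcal{H}$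 is $\mathbb{B}U=\big(w,\ z,\ -(I+\kappa A^\beta)^{-1}(\alpha A^2u+\gamma Az),\ -\alpha Av+\gamma Aw-\delta A^\theta z\big)$ with domain $D(\mathbb{B})=\{U\in\mathcal{H}: (w,z)\in D(A)\times D(A^{1/2}),\ -\alpha A^2u-\gamma Az\in D(A^{-\beta/2}),\ -\alpha v-\delta A^{\theta-1}z\in D(A)\}$. $\mathbb{B}$ generates a $C_0$-semigroup of contractions $S(t)=e^{t\mathbb{B}}$ on $\mathcal{H}$. It is the semigroup associated, via $U=(u,v,u_t,v_t)$, with the system $u_{tt}+\kappa A^\beta u_{tt}+\alpha A^2u+\gamma Av_t=0$, $v_{tt}+\alpha Av-\gamma Au_t+\delta A^\theta v_t=0$ in $\Omega\times(0,\infty)$, with boundary conditions $u=Au=0$, $v=0$ on $\partial\Omega$ and given initial data. *)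

theory Defs
  imports "HOL-Analysis.Analysis"
begin

section \<open>Complex vector spaces\<close>

class complex_vec = real_vector +
  fixes scaleC :: "complex \<Rightarrow> 'a \<Rightarrow> 'a" (infixr "*\<^sub>C" 75)
  assumes scaleC_add_right: "c *\<^sub>C (x + y) = c *\<^sub>C x + c *\<^sub>C y"
    and scaleC_add_left: "(c + d) *\<^sub>C x = c *\<^sub>C x + d *\<^sub>C x"
    and scaleC_scaleC: "c *\<^sub>C d *\<^sub>C x = (c * d) *\<^sub>C x"
    and scaleC_of_real: "complex_of_real r *\<^sub>C x = r *\<^sub>R x"

instantiation prod :: (complex_vec, complex_vec) complex_vec
begin

definition "scaleC c x = (c *\<^sub>C fst x, c *\<^sub>C snd x)"

instance
  by standard
    (simp_all add: scaleC_prod_def scaleC_add_right scaleC_add_left scaleC_scaleC scaleC_of_real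
      scaleR_prod_def)

end


section \<open>The complex Hilbert space of square-integrable functions\<close>

definition square_int :: "('a::euclidean_space \<Rightarrow> complex) \<Rightarrow> bool" where
  "square_int f \<longleftrightarrow> f \<in> borel_measurable lborel \<and> integrable lborel (\<lambda>x. (cmod (f x))\<^sup>2)"

lemma square_int_mult:
  assumes "square_int f" "square_int g"
  shows "integrable lborel (\<lambda>x. f x * cnj (g x))"
proof (rule Bochner_Integration.integrable_bound)
  show "integrable lborel (\<lambda>x. (cmod (f x))\<^sup>2 + (cmod (g x))\<^sup>2)"
    using assms by (auto simp: square_int_def)
  show "(\<lambda>x. f x * cnj (g x)) \<in> borel_measurable lborel"
  proof -
    have "cnj \<in> borel_measurable borel"
      by (intro borel_measurable_continuous_onI continuous_intros)
    from measurable_compose[OF _ this, of g lborel] show ?thesis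
      using assms by (intro borel_measurable_times) (simp_all add: square_int_def)
  qed
  have "a * b \<le> a\<^sup>2 + b\<^sup>2" if "a \<ge> 0" "b \<ge> 0" for a b :: real
    using sum_squares_bound[of a b] mult_nonneg_nonneg[OF that] by linarith
  then show "AE x in lborel. norm (f x * cnj (g x)) \<le> norm ((cmod (f x))\<^sup>2 + (cmod (g x))\<^sup>2)"
    by (auto simp: norm_mult)
qed

lemma square_int_zero: "square_int (\<lambda>x. 0)"
  by (simp add: square_int_def)

lemma square_int_scale:
  assumes "square_int f" shows "square_int (\<lambda>x. c * f x)"
  using assms by (auto simp: square_int_def norm_mult power_mult_distrib)

lemma square_int_add:
  assumes "square_int f" "square_int g"
  shows "square_int (\<lambda>x. f x + g x)"
  unfolding square_int_def
proof
  show m: "(\<lambda>x. f x + g x) \<in> borel_measurable lborel"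
    using assms by (auto simp: square_int_def)
  show "integrable lborel (\<lambda>x. (cmod (f x + g x))\<^sup>2)"
  proof (rule Bochner_Integration.integrable_bound)
    show "integrable lborel (\<lambda>x. 2 * (cmod (f x))\<^sup>2 + 2 * (cmod (g x))\<^sup>2)"
      using assms by (auto simp: square_int_def)
    show "(\<lambda>x. (cmod (f x + g x))\<^sup>2) \<in> borel_measurable lborel"
      using m by simp
    have "(cmod (a + b))\<^sup>2 \<le> 2 * (cmod a)\<^sup>2 + 2 * (cmod b)\<^sup>2" for a b
    proof -
      have "(cmod (a + b))\<^sup>2 \<le> (cmod a + cmod b)\<^sup>2"
        by (intro power_mono norm_triangle_ineq) auto
      also have "\<dots> \<le> 2 * (cmod a)\<^sup>2 + 2 * (cmod b)\<^sup>2"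
        using sum_squares_bound[of "cmod a" "cmod b"] by (simp add: power2_sum)
      finally show ?thesis .
    qed
    then show "AE x in lborel. norm ((cmod (f x + g x))\<^sup>2)
        \<le> norm (2 * (cmod (f x))\<^sup>2 + 2 * (cmod (g x))\<^sup>2)"
      by auto
  qed
qed

definition ae_eq :: "('a::euclidean_space \<Rightarrow> complex) \<Rightarrow> ('a \<Rightarrow> complex) \<Rightarrow> bool" where
  "ae_eq f g \<longleftrightarrow> square_int f \<and> square_int g \<and> (AE x in lborel. f x = g x)"

quotient_type (overloaded) 'a L2 = "'a::euclidean_space \<Rightarrow> complex" / partial: ae_eq
proof (rule part_equivpI)
  show "\<exists>x. ae_eq x x"
    using square_int_zero by (auto simp: ae_eq_def)
  show "symp ae_eq"
    by (auto simp: symp_def ae_eq_def)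
  show "transp ae_eq"
    unfolding transp_def ae_eq_def by (auto elim: AE_mp)
qed

lift_definition cinner :: "'a::euclidean_space L2 \<Rightarrow> 'a L2 \<Rightarrow> complex"
  is "\<lambda>f g. \<integral>x. f x * cnj (g x) \<partial>lborel"
proof -
  fix f f' g g' :: "'a \<Rightarrow> complex"
  assume a: "ae_eq f f'" "ae_eq g g'"
  then have i: "integrable lborel (\<lambda>x. f x * cnj (g x))" "integrable lborel (\<lambda>x. f' x * cnj (g' x))"
    by (auto simp: ae_eq_def intro!: square_int_mult)
  have "AE x in lborel. f x = f' x" "AE x in lborel. g x = g' x"
    using a by (auto simp: ae_eq_def)
  then have "AE x in lborel. f x * cnj (g x) = f' x * cnj (g' x)"
    by eventually_elim simp
  with i show "(\<integral>x. f x * cnj (g x) \<partial>lborel) = (\<integral>x. f' x * cnj (g' x) \<partial>lborel)"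
    by (intro integral_cong_AE) (auto dest: borel_measurable_integrable)
qed

instantiation L2 :: (euclidean_space) complex_vec
begin

lift_definition zero_L2 :: "'a L2" is "\<lambda>x. 0"
  by (simp add: ae_eq_def square_int_zero)

lift_definition plus_L2 :: "'a L2 \<Rightarrow> 'a L2 \<Rightarrow> 'a L2" is "\<lambda>f g x. f x + g x"
  unfolding ae_eq_def by (auto intro: square_int_add elim: AE_mp)

lift_definition scaleC_L2 :: "complex \<Rightarrow> 'a L2 \<Rightarrow> 'a L2" is "\<lambda>c f x. c * f x"
  unfolding ae_eq_def by (auto intro: square_int_scale elim: AE_mp)

definition "scaleR r (f :: 'a L2) = complex_of_real r *\<^sub>C f"

definition "uminus (f :: 'a L2) = (- 1) *\<^sub>C f"

definition "minus (f :: 'a L2) g = f + - g"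

instance
proof
  fix f g h :: "'a L2" and c d :: complex and r s :: real
  show "f + g + h = f + (g + h)"
    by transfer (auto simp: ae_eq_def add.assoc intro!: square_int_add)
  show "f + g = g + f"
    by transfer (auto simp: ae_eq_def add.commute intro!: square_int_add)
  show "0 + f = f"
    by transfer (auto simp: ae_eq_def)
  show "- f + f = 0"
    unfolding uminus_L2_def by transfer (auto simp: ae_eq_def square_int_zero)
  show "f - g = f + - g"
    by (simp add: minus_L2_def)
  show 1: "c *\<^sub>C (f + g) = c *\<^sub>C f + c *\<^sub>C g" for c :: complex and f g :: "'a L2"
    by transfer (auto simp: ae_eq_def distrib_left intro!: square_int_add square_int_scale)
  show 2: "(c + d) *\<^sub>C f = c *\<^sub>C f + d *\<^sub>C f" for c d :: complex and f :: "'a L2"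
    by transfer (auto simp: ae_eq_def distrib_right intro!: square_int_add square_int_scale)
  show 3: "c *\<^sub>C d *\<^sub>C f = (c * d) *\<^sub>C f" for c d :: complex and f :: "'a L2"
    by transfer (auto simp: ae_eq_def mult.assoc intro!: square_int_scale)
  show "complex_of_real r *\<^sub>C f = r *\<^sub>R f"
    by (simp add: scaleR_L2_def)
  show "r *\<^sub>R (f + g) = r *\<^sub>R f + r *\<^sub>R g"
    by (simp add: scaleR_L2_def 1)
  show "(r + s) *\<^sub>R f = r *\<^sub>R f + s *\<^sub>R f"
    by (simp add: scaleR_L2_def 2)
  show "r *\<^sub>R s *\<^sub>R f = (r * s) *\<^sub>R f"
    by (simp add: scaleR_L2_def 3)
  show "1 *\<^sub>R f = f"
    unfolding scaleR_L2_def by transfer (auto simp: ae_eq_def)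
qed

end

lemma cinner_commute: "cinner f g = cnj (cinner g f)"
  by transfer (simp flip: Bochner_Integration.integral_cnj add: mult.commute)

lemma cinner_add_left: "cinner (f + g) h = cinner f h + cinner g h"
  by transfer (auto simp: ae_eq_def distrib_right square_int_mult
      intro!: Bochner_Integration.integral_add)

lemma cinner_scaleC_left: "cinner (c *\<^sub>C f) g = c * cinner f g"
  by transfer (auto simp: ae_eq_def mult.assoc)

lemma cinner_self_nonneg: "0 \<le> Re (cinner f f)"
proof (transfer, goal_cases)
  case (1 f)
  have "(\<integral>x. f x * cnj (f x) \<partial>lborel) = complex_of_real (\<integral>x. (cmod (f x))\<^sup>2 \<partial>lborel)"
    by (simp add: complex_norm_square[symmetric] flip: of_real_power)
  then show ?case
    by simp
qed

lemma cinner_self_eq_0: "Re (cinner f f) = 0 \<longleftrightarrow> f = 0"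
proof (transfer, goal_cases)
  case (1 f)
  then have f: "square_int f" by (simp add: ae_eq_def)
  have "(\<integral>x. f x * cnj (f x) \<partial>lborel) = complex_of_real (\<integral>x. (cmod (f x))\<^sup>2 \<partial>lborel)"
    by (simp add: complex_norm_square[symmetric] flip: of_real_power)
  then have "Re (\<integral>x. f x * cnj (f x) \<partial>lborel) = (\<integral>x. (cmod (f x))\<^sup>2 \<partial>lborel)"
    by simp
  also have "\<dots> = 0 \<longleftrightarrow> (AE x in lborel. (cmod (f x))\<^sup>2 = 0)"
    using f by (intro integral_nonneg_eq_0_iff_AE) (auto simp: square_int_def)
  finally show ?case
    using f by (simp add: ae_eq_def square_int_zero)
qed

instantiation L2 :: (euclidean_space) real_inner
begin

definition "inner (f :: 'a L2) g = Re (cinner f g)"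

definition "norm (f :: 'a L2) = sqrt (inner f f)"

definition "sgn (f :: 'a L2) = inverse (norm f) *\<^sub>R f"

definition "dist (f :: 'a L2) g = norm (f - g)"

definition [code del]: "(uniformity :: ('a L2 \<times> 'a L2) filter) = (INF e\<in>{0<..}. principal {(x, y). dist x y < e})"

definition [code del]: "open (U :: 'a L2 set) \<longleftrightarrow> (\<forall>x\<in>U. \<forall>\<^sub>F (x', y) in uniformity. x' = x \<longrightarrow> y \<in> U)"

instance
proof
  fix f g h :: "'a L2" and r :: real
  show "inner f g = inner g f"
    unfolding inner_L2_def by (subst cinner_commute) simp
  show "inner (f + g) h = inner f h + inner g h"
    by (simp add: inner_L2_def cinner_add_left)
  show "inner (r *\<^sub>R f) g = r * inner f g"
    by (simp add: inner_L2_def scaleR_L2_def cinner_scaleC_left)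
  show "0 \<le> inner f f"
    by (simp add: inner_L2_def cinner_self_nonneg)
  show "inner f f = 0 \<longleftrightarrow> f = 0"
    by (simp add: inner_L2_def cinner_self_eq_0)
qed (rule norm_L2_def sgn_L2_def dist_L2_def uniformity_L2_def open_L2_def)+

end

text \<open>$L^2(\Omega)$ is identified, through extension by zero, with the classes vanishing almost
  everywhere outside $\Omega$.\<close>

lift_definition vanishes_outside :: "'a::euclidean_space set \<Rightarrow> 'a L2 \<Rightarrow> bool"
  is "\<lambda>\<Omega> f. AE x in lborel. x \<notin> \<Omega> \<longrightarrow> f x = 0"
  by (auto simp: ae_eq_def elim: AE_mp)

definition L2_on :: "'a::euclidean_space set \<Rightarrow> 'a L2 set" where
  "L2_on \<Omega> = {f. vanishes_outside \<Omega> f}"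


section \<open>Smooth functions, smooth boundaries, Sobolev spaces\<close>

text \<open>These two notions are only used on open sets.\<close>

primrec Ck_on :: "nat \<Rightarrow> 'a::euclidean_space set \<Rightarrow> ('a \<Rightarrow> 'b::real_normed_vector) \<Rightarrow> bool" where
  "Ck_on 0 X f \<longleftrightarrow> continuous_on X f"
| "Ck_on (Suc k) X f \<longleftrightarrow>
     f differentiable_on X \<and> (\<forall>i\<in>Basis. Ck_on k X (\<lambda>x. frechet_derivative f (at x) i))"

definition smooth_on :: "'a::euclidean_space set \<Rightarrow> ('a \<Rightarrow> 'b::real_normed_vector) \<Rightarrow> bool" where
  "smooth_on X f \<longleftrightarrow> (\<forall>k. Ck_on k X f)"

text \<open>Near each boundary point, the set is the sublevel set of a smooth function without critical
  points; equivalently it lies on one side of a smooth hypersurface.\<close>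

definition smooth_boundary :: "'a::euclidean_space set \<Rightarrow> bool" where
  "smooth_boundary \<Omega> \<longleftrightarrow>
     (\<forall>p\<in>frontier \<Omega>. \<exists>V. \<exists>\<rho> :: 'a \<Rightarrow> real. open V \<and> p \<in> V \<and> smooth_on V \<rho> \<and>
        (\<forall>x\<in>V. \<exists>i\<in>Basis. frechet_derivative \<rho> (at x) i \<noteq> 0) \<and>
        \<Omega> \<inter> V = {x \<in> V. \<rho> x < 0})"

definition test_functions :: "'a::euclidean_space set \<Rightarrow> ('a \<Rightarrow> complex) set" where
  "test_functions \<Omega> =
     {\<phi>. smooth_on UNIV \<phi> \<and> compact (closure {x. \<phi> x \<noteq> 0}) \<and> closure {x. \<phi> x \<noteq> 0} \<subseteq> \<Omega>}"

text \<open>The bilinear pairing $\int u \phi \, dx$; \<^const>\<open>cinner\<close> is conjugate-linear in its second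
  argument.\<close>

definition pairing :: "'a::euclidean_space L2 \<Rightarrow> ('a \<Rightarrow> complex) \<Rightarrow> complex" where
  "pairing u \<phi> = cinner u (abs_L2 (\<lambda>x. cnj (\<phi> x)))"

definition weak_partial ::
    "'a::euclidean_space set \<Rightarrow> 'a \<Rightarrow> 'a L2 \<Rightarrow> 'a L2 \<Rightarrow> bool" where
  "weak_partial \<Omega> i u g \<longleftrightarrow> g \<in> L2_on \<Omega> \<and>
     (\<forall>\<phi>\<in>test_functions \<Omega>.
        pairing u (\<lambda>x. frechet_derivative \<phi> (at x) i) = - pairing g \<phi>)"

definition wderiv :: "'a::euclidean_space set \<Rightarrow> 'a \<Rightarrow> 'a L2 \<Rightarrow> 'a L2" where
  "wderiv \<Omega> i u = (THE g. weak_partial \<Omega> i u g)"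

definition H1 :: "'a::euclidean_space set \<Rightarrow> 'a L2 set" where
  "H1 \<Omega> = {u \<in> L2_on \<Omega>. \<forall>i\<in>Basis. \<exists>g. weak_partial \<Omega> i u g}"

definition H1_norm :: "'a::euclidean_space set \<Rightarrow> 'a L2 \<Rightarrow> real" where
  "H1_norm \<Omega> u = sqrt ((norm u)\<^sup>2 + (\<Sum>i\<in>Basis. (norm (wderiv \<Omega> i u))\<^sup>2))"

definition H2 :: "'a::euclidean_space set \<Rightarrow> 'a L2 set" where
  "H2 \<Omega> = {u \<in> H1 \<Omega>. \<forall>i\<in>Basis. wderiv \<Omega> i u \<in> H1 \<Omega>}"

definition H10 :: "'a::euclidean_space set \<Rightarrow> 'a L2 set" where
  "H10 \<Omega> = {u \<in> H1 \<Omega>. \<forall>\<epsilon>>0. \<exists>\<phi>\<in>test_functions \<Omega>. H1_norm \<Omega> (u - abs_L2 \<phi>) < \<epsilon>}"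


section \<open>The Dirichlet Laplacian and its fractional powers\<close>

definition dom_A :: "'a::euclidean_space set \<Rightarrow> 'a L2 set" where
  "dom_A \<Omega> = H2 \<Omega> \<inter> H10 \<Omega>"

definition op_A :: "'a::euclidean_space set \<Rightarrow> 'a L2 \<Rightarrow> 'a L2" where
  "op_A \<Omega> u = - (\<Sum>i\<in>Basis. wderiv \<Omega> i (wderiv \<Omega> i u))"

definition eigenspace :: "'a::euclidean_space set \<Rightarrow> real \<Rightarrow> 'a L2 set" where
  "eigenspace \<Omega> \<mu> = {u \<in> dom_A \<Omega>. op_A \<Omega> u = \<mu> *\<^sub>R u}"

definition eigenvalues :: "'a::euclidean_space set \<Rightarrow> real set" where
  "eigenvalues \<Omega> = {\<mu>. eigenspace \<Omega> \<mu> \<noteq> {0}}"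

text \<open>Since $A$ is positive self-adjoint with compact inverse, $L^2(\Omega)$ is the orthogonal sum of
  the eigenspaces, and $A^s$ is defined by the eigenfunction expansion. An element of the scale
  $D(A^s)$, $s \in \mathbb{R}$, is represented by the family $(x_\mu)_\mu$ of its spectral
  components, on which $A^r$ acts as multiplication by $\mu^r$; for $s < 0$ these families form the
  completion of $L^2(\Omega)$ in the norm $\|A^s u\|$. For $s \ge 0$ an element of $D(A^s)$ is the
  function $u = \sum_\mu x_\mu$; in particular $D(A^0) = L^2(\Omega)$ and
  $D(A^1) = H^2(\Omega) \cap H^1_0(\Omega)$.\<close>

definition scale_space :: "'a::euclidean_space set \<Rightarrow> real \<Rightarrow> (real \<Rightarrow> 'a L2) set" where
  "scale_space \<Omega> s =
     {x. (\<forall>\<mu>. x \<mu> \<in> eigenspace \<Omega> \<mu>) \<and>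
         (\<lambda>\<mu>. (\<mu> powr s * norm (x \<mu>))\<^sup>2) summable_on eigenvalues \<Omega>}"

definition is_expansion :: "'a::euclidean_space set \<Rightarrow> 'a L2 \<Rightarrow> (real \<Rightarrow> 'a L2) \<Rightarrow> bool" where
  "is_expansion \<Omega> u x \<longleftrightarrow> (\<forall>\<mu>. x \<mu> \<in> eigenspace \<Omega> \<mu>) \<and> (x has_sum u) (eigenvalues \<Omega>)"

definition components :: "'a::euclidean_space set \<Rightarrow> 'a L2 \<Rightarrow> real \<Rightarrow> 'a L2" where
  "components \<Omega> u = (THE x. is_expansion \<Omega> u x)"

definition synthesis :: "'a::euclidean_space set \<Rightarrow> (real \<Rightarrow> 'a L2) \<Rightarrow> 'a L2" where
  "synthesis \<Omega> x = (\<Sum>\<^sub>\<infinity>\<mu>\<in>eigenvalues \<Omega>. x \<mu>)"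

text \<open>$D(A^s)$ as a set of functions; only used for $s \ge 0$.\<close>

definition dom_pow :: "'a::euclidean_space set \<Rightarrow> real \<Rightarrow> 'a L2 set" where
  "dom_pow \<Omega> s = {u \<in> L2_on \<Omega>. \<exists>x\<in>scale_space \<Omega> s. is_expansion \<Omega> u x}"

text \<open>$A^s u$ as an element of the scale, and as a function (the latter for $u \in D(A^s)$ if
  $s \ge 0$, and for $u \in L^2(\Omega)$ if $s < 0$).\<close>

definition pow_A_scale :: "'a::euclidean_space set \<Rightarrow> real \<Rightarrow> 'a L2 \<Rightarrow> real \<Rightarrow> 'a L2" where
  "pow_A_scale \<Omega> s u = (\<lambda>\<mu>. (\<mu> powr s) *\<^sub>R components \<Omega> u \<mu>)"

definition pow_A :: "'a::euclidean_space set \<Rightarrow> real \<Rightarrow> 'a L2 \<Rightarrow> 'a L2" where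
  "pow_A \<Omega> s u = synthesis \<Omega> (pow_A_scale \<Omega> s u)"

text \<open>The duality between $D(A^{-s})$ and $D(A^s)$ extending the inner product of $L^2(\Omega)$,
  and the inverse of $I + \kappa A^\beta : D(A^{\beta/2}) \to D(A^{-\beta/2})$.\<close>

definition duality :: "'a::euclidean_space set \<Rightarrow> (real \<Rightarrow> 'a L2) \<Rightarrow> 'a L2 \<Rightarrow> complex" where
  "duality \<Omega> f z = (\<Sum>\<^sub>\<infinity>\<mu>\<in>eigenvalues \<Omega>. cinner (f \<mu>) (components \<Omega> z \<mu>))"

definition inv_I_kA ::
    "'a::euclidean_space set \<Rightarrow> real \<Rightarrow> real \<Rightarrow> (real \<Rightarrow> 'a L2) \<Rightarrow> 'a L2" where
  "inv_I_kA \<Omega> \<kappa> \<beta> f =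
     (THE w. w \<in> dom_pow \<Omega> (\<beta>/2) \<and>
        (\<forall>z\<in>dom_pow \<Omega> (\<beta>/2).
           cinner w z + complex_of_real \<kappa> * cinner (pow_A \<Omega> (\<beta>/2) w) (pow_A \<Omega> (\<beta>/2) z)
           = duality \<Omega> f z))"


section \<open>The phase space and the operator\<close>

type_synonym 'a phase = "'a L2 \<times> 'a L2 \<times> 'a L2 \<times> 'a L2"

definition phase_space :: "'a::euclidean_space set \<Rightarrow> real \<Rightarrow> 'a phase set" where
  "phase_space \<Omega> \<beta> = dom_pow \<Omega> 1 \<times> dom_pow \<Omega> (1/2) \<times> dom_pow \<Omega> (\<beta>/2) \<times> dom_pow \<Omega> 0"

definition phase_norm ::
    "'a::euclidean_space set \<Rightarrow> real \<Rightarrow> real \<Rightarrow> real \<Rightarrow> 'a phase \<Rightarrow> real" where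
  "phase_norm \<Omega> \<alpha> \<kappa> \<beta> = (\<lambda>(u, v, w, z).
     sqrt (\<alpha> * (norm (pow_A \<Omega> 1 u))\<^sup>2 + \<alpha> * (norm (pow_A \<Omega> (1/2) v))\<^sup>2
           + (norm w)\<^sup>2 + \<kappa> * (norm (pow_A \<Omega> (\<beta>/2) w))\<^sup>2 + (norm z)\<^sup>2))"

definition dom_B ::
    "'a::euclidean_space set \<Rightarrow> real \<Rightarrow> real \<Rightarrow> real \<Rightarrow> real \<Rightarrow> real \<Rightarrow> 'a phase set" where
  "dom_B \<Omega> \<alpha> \<gamma> \<delta> \<theta> \<beta> = {(u, v, w, z) \<in> phase_space \<Omega> \<beta>.
     w \<in> dom_pow \<Omega> 1 \<and> z \<in> dom_pow \<Omega> (1/2) \<and>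
     (\<lambda>\<mu>. - (\<alpha> *\<^sub>R pow_A_scale \<Omega> 2 u \<mu>) - \<gamma> *\<^sub>R pow_A_scale \<Omega> 1 z \<mu>) \<in> scale_space \<Omega> (-\<beta>/2) \<and>
     - (\<alpha> *\<^sub>R v) - \<delta> *\<^sub>R pow_A \<Omega> (\<theta> - 1) z \<in> dom_pow \<Omega> 1}"

text \<open>In the last component the individual terms lie in $D(A^{-1/2})$ only, hence the sum is formed
  in the scale before it is read as a function.\<close>

definition op_B ::
    "'a::euclidean_space set \<Rightarrow> real \<Rightarrow> real \<Rightarrow> real \<Rightarrow> real \<Rightarrow> real \<Rightarrow> real \<Rightarrow> 'a phase \<Rightarrow> 'a phase"
  where
  "op_B \<Omega> \<alpha> \<kappa> \<gamma> \<delta> \<theta> \<beta> = (\<lambda>(u, v, w, z).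
     (w,
      z,
      - inv_I_kA \<Omega> \<kappa> \<beta> (\<lambda>\<mu>. \<alpha> *\<^sub>R pow_A_scale \<Omega> 2 u \<mu> + \<gamma> *\<^sub>R pow_A_scale \<Omega> 1 z \<mu>),
      synthesis \<Omega> (\<lambda>\<mu>. - (\<alpha> *\<^sub>R pow_A_scale \<Omega> 1 v \<mu>) + \<gamma> *\<^sub>R pow_A_scale \<Omega> 1 w \<mu>
                        - \<delta> *\<^sub>R pow_A_scale \<Omega> \<theta> z \<mu>)))"


section \<open>Semigroups\<close>

text \<open>The space on which an operator acts is given by a carrier \<open>X\<close> (a complex subspace) and a
  norm \<open>N\<close> on it.\<close>

definition bounded_operator ::
    "'x::complex_vec set \<Rightarrow> ('x \<Rightarrow> real) \<Rightarrow> ('x \<Rightarrow> 'x) \<Rightarrow> bool" where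
  "bounded_operator X N T \<longleftrightarrow>
     (\<forall>U\<in>X. T U \<in> X) \<and>
     (\<forall>U\<in>X. \<forall>V\<in>X. T (U + V) = T U + T V) \<and>
     (\<forall>c. \<forall>U\<in>X. T (c *\<^sub>C U) = c *\<^sub>C T U) \<and>
     (\<exists>C. \<forall>U\<in>X. N (T U) \<le> C * N U)"

definition C0_contraction_semigroup ::
    "'x::complex_vec set \<Rightarrow> ('x \<Rightarrow> real) \<Rightarrow> (real \<Rightarrow> 'x \<Rightarrow> 'x) \<Rightarrow> bool" where
  "C0_contraction_semigroup X N S \<longleftrightarrow>
     (\<forall>t\<ge>0. bounded_operator X N (S t)) \<and>
     (\<forall>t\<ge>0. \<forall>U\<in>X. N (S t U) \<le> N U) \<and>
     (\<forall>U\<in>X. S 0 U = U) \<and>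
     (\<forall>s\<ge>0. \<forall>t\<ge>0. \<forall>U\<in>X. S (s + t) U = S s (S t U)) \<and>
     (\<forall>U\<in>X. ((\<lambda>t. N (S t U - U)) \<longlongrightarrow> 0) (at_right 0))"

definition is_generator ::
    "'x::complex_vec set \<Rightarrow> ('x \<Rightarrow> real) \<Rightarrow> (real \<Rightarrow> 'x \<Rightarrow> 'x) \<Rightarrow> 'x set \<Rightarrow> ('x \<Rightarrow> 'x) \<Rightarrow> bool" where
  "is_generator X N S D B \<longleftrightarrow>
     (\<forall>U V. U \<in> D \<and> V = B U \<longleftrightarrow>
        U \<in> X \<and> V \<in> X \<and> ((\<lambda>t. N ((1 / t) *\<^sub>R (S t U - U) - V)) \<longlongrightarrow> 0) (at_right 0))"

definition sector :: "real \<Rightarrow> complex set" where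
  "sector \<omega> = {z. z \<noteq> 0 \<and> \<bar>Arg z\<bar> < \<omega>}"

text \<open>The extension to a sector is holomorphic with respect to the operator norm.\<close>

definition analytic_semigroup ::
    "'x::complex_vec set \<Rightarrow> ('x \<Rightarrow> real) \<Rightarrow> (real \<Rightarrow> 'x \<Rightarrow> 'x) \<Rightarrow> bool" where
  "analytic_semigroup X N S \<longleftrightarrow>
     (\<exists>\<omega> T. 0 < \<omega> \<and> \<omega> \<le> pi / 2 \<and>
        (\<forall>t\<ge>0. \<forall>U\<in>X. T (complex_of_real t) U = S t U) \<and>
        (\<forall>\<zeta>\<in>sector \<omega>. bounded_operator X N (T \<zeta>)) \<and>
        (\<forall>\<zeta>\<in>sector \<omega>. \<forall>\<eta>\<in>sector \<omega>. \<forall>U\<in>X. T (\<zeta> + \<eta>) U = T \<zeta> (T \<eta> U)) \<and>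
        (\<forall>\<zeta>\<in>sector \<omega>. \<exists>T'. bounded_operator X N T' \<and>
           (\<forall>\<epsilon>>0. \<forall>\<^sub>F \<eta> in at \<zeta>. \<forall>U\<in>X.
              N (inverse (\<eta> - \<zeta>) *\<^sub>C (T \<eta> U - T \<zeta> U) - T' U) \<le> \<epsilon> * N U)) \<and>
        (\<forall>U\<in>X. ((\<lambda>\<zeta>. N (T \<zeta> U - U)) \<longlongrightarrow> 0) (at 0 within sector \<omega>)))"

end

theory Submission
  imports Defs "HOL-Complex_Analysis.Cauchy_Integral_Formula"
begin

text \<open>The eigenspaces of $A$ are mutually orthogonal and its eigenvalues are bounded below by a positive
  constant (Poincare's inequality), so the phase space is the $\ell^2$-sum of the modes, on which the
  generator acts as a $4 \times 4$ matrix. For $(\theta, \beta) = (1/2, 1)$ and in energy coordinates the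
  matrix at the eigenvalue $\mu$ is $\sqrt\mu\, M_h$ with $h = \sqrt{\mu / (1 + \kappa \mu)}$ ranging in a
  compact interval in $(0, \infty)$. A Lyapunov function uniform in $h$ bounds $e^{\zeta M_h}$, hence
  $e^{\zeta \sqrt\mu M_h}$, uniformly for $\zeta$ in a cone around the positive axis. The
  multiplier with these matrices extends the semigroup, and Cauchy's estimates, being uniform in
  $\mu$, make it holomorphic in the operator norm.\<close>

section \<open>Smooth functions\<close>

text \<open>For (1/2, 1) one time scale is enough: in energy coordinates all entries of the
  generator at the eigenvalue \<mu> are of exact order \<mu>^(1/2). A cone around the positive axis
  is invariant under positive factors, so a bound for the rescaled matrices on a cone serves every
  mode at once. The difficulty in that bound is that only one of the four coordinates is damped: the
  energy alone cannot absorb the terms created by the imaginary part of \<zeta>. The semigroup is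
  given only through its generator, so it has to be identified with the multiplier before it can be
  extended: on each mode by comparing small time steps, then by density of the finite sums of modes.
  \<open>wderiv\<close>, \<open>components\<close> and \<open>inv_I_kA\<close> are definite
  descriptions. They become computable through uniqueness of weak derivatives, which requires a
  supply of test functions, and through orthogonality of eigenspaces, which requires integration by
  parts; this is the purpose of the function-theoretic half.\<close>

abbreviation pderiv_at :: "'a::euclidean_space \<Rightarrow> ('a \<Rightarrow> 'b::real_normed_vector) \<Rightarrow> 'a \<Rightarrow> 'b" where
  "pderiv_at i f \<equiv> (\<lambda>x. frechet_derivative f (at x) i)"

lemma pderiv_at_eqI:
  assumes "\<And>x. (f has_derivative f' x) (at x)"
  shows "pderiv_at i f = (\<lambda>x. f' x i)"
  using frechet_derivative_at[OF assms] by metis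

lemma Ck_on_SucI:
  assumes "\<And>x. (f has_derivative f' x) (at x)" "\<And>i. i \<in> Basis \<Longrightarrow> Ck_on k UNIV (\<lambda>x. f' x i)"
  shows "Ck_on (Suc k) UNIV f"
  using assms pderiv_at_eqI[of f f'] by (auto simp: differentiable_on_def differentiable_def)

lemma Ck_on_SucD:
  assumes "Ck_on (Suc k) UNIV f"
  shows "(f has_derivative frechet_derivative f (at x)) (at x)"
    "i \<in> Basis \<Longrightarrow> Ck_on k UNIV (pderiv_at i f)"
  using assms by (auto simp: differentiable_on_def frechet_derivative_works)

lemma Ck_on_SucD2: "Ck_on (Suc k) UNIV f \<Longrightarrow> Ck_on k UNIV f"
proof (induction k arbitrary: f)
  case 0
  then show ?case by (auto simp: differentiable_imp_continuous_on)
next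
  case (Suc k)
  then show ?case by (metis Ck_on.simps(2))
qed

lemma Ck_on_const: "Ck_on k UNIV (\<lambda>x. c)"
  by (induction k arbitrary: c) auto

lemma Ck_on_bounded_linear:
  assumes "bounded_linear L" "Ck_on k UNIV f"
  shows "Ck_on k UNIV (\<lambda>x. L (f x))"
  using assms(2)
proof (induction k arbitrary: f)
  case 0
  then show ?case
    using assms(1) by (auto intro: linear_continuous_on_compose bounded_linear.continuous_on)
next
  case (Suc k)
  show ?case
  proof (rule Ck_on_SucI)
    show "((\<lambda>x. L (f x)) has_derivative (\<lambda>h. L (frechet_derivative f (at x) h))) (at x)" for x
      by (rule bounded_linear.has_derivative[OF assms(1) Ck_on_SucD(1)[OF Suc.prems]])
  qed (use Suc in auto)
qed

lemma Ck_on_add: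
  assumes "Ck_on k UNIV f" "Ck_on k UNIV g"
  shows "Ck_on k UNIV (\<lambda>x. f x + g x)"
  using assms
proof (induction k arbitrary: f g)
  case 0
  then show ?case by (auto intro: continuous_on_add)
next
  case (Suc k)
  show ?case
    by (rule Ck_on_SucI[OF has_derivative_add[OF Ck_on_SucD(1)[OF Suc.prems(1)] Ck_on_SucD(1)[OF Suc.prems(2)]]])
      (use Suc in auto)
qed

text \<open>The Leibniz rule pairs each derivative with an undifferentiated factor, so the induction
  also needs the factors themselves at the lower order, which is \<open>Ck_on_SucD2\<close>.\<close>

lemma Ck_on_mult:
  fixes f g :: "'a::euclidean_space \<Rightarrow> 'b::real_normed_algebra"
  assumes "Ck_on k UNIV f" "Ck_on k UNIV g"
  shows "Ck_on k UNIV (\<lambda>x. f x * g x)"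
  using assms
proof (induction k arbitrary: f g)
  case 0
  then show ?case by (auto intro: continuous_on_mult)
next
  case (Suc k)
  show ?case
    by (rule Ck_on_SucI[OF has_derivative_mult[OF Ck_on_SucD(1)[OF Suc.prems(1)] Ck_on_SucD(1)[OF Suc.prems(2)]]])
      (use Suc Ck_on_SucD2 in \<open>auto intro!: Ck_on_add Suc.IH\<close>)
qed

lemma Ck_on_prod:
  fixes f :: "'i \<Rightarrow> 'a::euclidean_space \<Rightarrow> 'b::{real_normed_algebra,comm_ring_1}"
  assumes "\<And>i. i \<in> I \<Longrightarrow> Ck_on k UNIV (f i)"
  shows "Ck_on k UNIV (\<lambda>x. \<Prod>i\<in>I. f i x)"
  using assms by (induction I rule: infinite_finite_induct) (auto intro: Ck_on_const Ck_on_mult)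

lemma Ck_on_linear:
  assumes "bounded_linear L"
  shows "Ck_on k UNIV L"
proof (cases k)
  case 0
  then show ?thesis using assms by (auto intro: linear_continuous_on)
next
  case (Suc m)
  show ?thesis unfolding Suc
    by (rule Ck_on_SucI[OF bounded_linear_imp_has_derivative[OF assms]]) (rule Ck_on_const)
qed

lemma smooth_on_linear: "bounded_linear L \<Longrightarrow> smooth_on UNIV L"
  unfolding smooth_on_def by (auto intro: Ck_on_linear)

lemma smooth_on_has_derivative:
  "smooth_on UNIV f \<Longrightarrow> (f has_derivative frechet_derivative f (at x)) (at x)"
  unfolding smooth_on_def using Ck_on_SucD(1) by blast

lemma smooth_on_pderiv: "smooth_on UNIV f \<Longrightarrow> i \<in> Basis \<Longrightarrow> smooth_on UNIV (pderiv_at i f)"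
  unfolding smooth_on_def using Ck_on_SucD(2) by blast

lemma smooth_on_continuous: "smooth_on UNIV f \<Longrightarrow> continuous_on UNIV f"
  unfolding smooth_on_def using Ck_on.simps(1) by blast

lemma smooth_on_mult:
  fixes f g :: "'a::euclidean_space \<Rightarrow> 'b::real_normed_algebra"
  shows "smooth_on UNIV f \<Longrightarrow> smooth_on UNIV g \<Longrightarrow> smooth_on UNIV (\<lambda>x. f x * g x)"
  unfolding smooth_on_def using Ck_on_mult by blast

lemma smooth_on_add:
  "smooth_on UNIV f \<Longrightarrow> smooth_on UNIV g \<Longrightarrow> smooth_on UNIV (\<lambda>x. f x + g x)"
  unfolding smooth_on_def using Ck_on_add by blast

lemma smooth_on_bounded_linear:
  "bounded_linear L \<Longrightarrow> smooth_on UNIV f \<Longrightarrow> smooth_on UNIV (\<lambda>x. L (f x))"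
  unfolding smooth_on_def using Ck_on_bounded_linear by blast

lemma pderiv_at_bounded_linear:
  assumes "bounded_linear L" "smooth_on UNIV f"
  shows "pderiv_at i (\<lambda>x. L (f x)) = (\<lambda>x. L (pderiv_at i f x))"
  by (rule pderiv_at_eqI[OF bounded_linear.has_derivative[OF assms(1) smooth_on_has_derivative[OF assms(2)]]])

lemma pderiv_at_mult:
  fixes f g :: "'a::euclidean_space \<Rightarrow> 'b::real_normed_algebra"
  assumes "smooth_on UNIV f" "smooth_on UNIV g"
  shows "pderiv_at i (\<lambda>x. f x * g x) = (\<lambda>x. f x * pderiv_at i g x + pderiv_at i f x * g x)"
  by (rule pderiv_at_eqI[OF has_derivative_mult[OF smooth_on_has_derivative[OF assms(1)] smooth_on_has_derivative[OF assms(2)]]])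

lemma pderiv_at_add:
  assumes "smooth_on UNIV f" "smooth_on UNIV g"
  shows "pderiv_at i (\<lambda>x. f x + g x) = (\<lambda>x. pderiv_at i f x + pderiv_at i g x)"
  by (rule pderiv_at_eqI[OF has_derivative_add[OF smooth_on_has_derivative[OF assms(1)] smooth_on_has_derivative[OF assms(2)]]])

text \<open>The functions $t^{-n} e^{-1/t}$, extended by $0$ to $t \le 0$: their span is closed under
  differentiation, which makes smoothness an induction on the order.\<close>

definition flat_power :: "nat \<Rightarrow> real \<Rightarrow> real" where
  "flat_power n t = (if t > 0 then inverse t ^ n * exp (- inverse t) else 0)"

text \<open>With s = 1/t the right-hand limit is that of s^n / exp s at infinity; on the left the
  function is identically zero.\<close>

lemma flat_power_tendsto: "(flat_power n \<longlongrightarrow> 0) (at 0)"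
proof -
  have "((\<lambda>s::real. s ^ n / exp s) \<longlongrightarrow> 0) at_top" by (rule tendsto_power_div_exp_0)
  then have "((\<lambda>t::real. inverse t ^ n / exp (inverse t)) \<longlongrightarrow> 0) (at_right 0)"
    by (rule filterlim_compose[OF _ filterlim_inverse_at_top_right])
  then have 1: "(flat_power n \<longlongrightarrow> 0) (at_right 0)"
    by (rule Lim_transform_eventually)
      (auto simp: flat_power_def exp_minus divide_inverse eventually_at_right_less intro: eventually_at_rightI[of _ 1])
  have 2: "(flat_power n \<longlongrightarrow> 0) (at_left 0)"
    by (rule tendsto_eventually) (auto simp: flat_power_def eventually_at_filter)
  show ?thesis using 1 2 by (simp add: filterlim_at_split)
qed

text \<open>Only t = 0 is delicate: there the difference quotient \<open>flat_power n h / h\<close>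
  equals \<open>flat_power (Suc n) h\<close>, which tends to 0. The other two cases are
  local.\<close>

lemma flat_power_has_derivative:
  "(flat_power n has_real_derivative flat_power (n + 2) t - real n * flat_power (n + 1) t) (at t)"
proof -
  consider "t > 0" | "t < 0" | "t = 0" by linarith
  then show ?thesis
  proof cases
    case 1
    have "((\<lambda>t. inverse t ^ n * exp (- inverse t)) has_real_derivative
      (inverse t ^ n * (exp (- inverse t) * (inverse t * inverse t)) +
       real n * inverse t ^ (n - 1) * (- (inverse t * inverse t)) * exp (- inverse t))) (at t)"
      using 1 by (auto intro!: derivative_eq_intros simp: power2_eq_square)
    moreover have eq: "real n * inverse t ^ (n - 1) * (- (inverse t * inverse t)) = - real n * inverse t ^ (n + 1)"
      by (cases n) (auto simp: algebra_simps)
    ultimately have "((\<lambda>t. inverse t ^ n * exp (- inverse t)) has_real_derivative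
       flat_power (n + 2) t - real n * flat_power (n + 1) t) (at t)"
      using 1 unfolding eq by (simp add: flat_power_def power2_eq_square mult_ac)
    then show ?thesis
      unfolding has_field_derivative_def
      by (rule has_derivative_transform_within[where d=t]) (use 1 in \<open>auto simp: flat_power_def dist_real_def\<close>)
  next
    case 2
    have "((\<lambda>t. 0) has_real_derivative flat_power (n + 2) t - real n * flat_power (n + 1) t) (at t)"
      using 2 by (simp add: flat_power_def)
    then show ?thesis
      unfolding has_field_derivative_def
      by (rule has_derivative_transform_within[where d="-t"]) (use 2 in \<open>auto simp: flat_power_def dist_real_def\<close>)
  next
    case 3
    have "((\<lambda>h. flat_power n h / h) \<longlongrightarrow> 0) (at 0)"
      by (rule Lim_transform_eventually[OF flat_power_tendsto[of "Suc n"]])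
        (auto simp: flat_power_def divide_inverse)
    then show ?thesis using 3 by (simp add: has_field_derivative_iff flat_power_def)
  qed
qed

text \<open>The induction generalises over n because differentiation raises the power. The affine
  argument covers multiples of the signed distance to a face of a box.\<close>

lemma smooth_on_flat_power:
  fixes L :: "'a::euclidean_space \<Rightarrow> real"
  assumes "bounded_linear L"
  shows "smooth_on UNIV (\<lambda>x. complex_of_real (flat_power n (L x + c)))"
proof -
  have "Ck_on k UNIV (\<lambda>x. flat_power n (L x + c))" for k
  proof (induction k arbitrary: n)
    case 0
    have "continuous_on UNIV (flat_power n)"
      by (meson DERIV_isCont continuous_at_imp_continuous_on flat_power_has_derivative)
    moreover have "continuous_on UNIV (\<lambda>x. L x + c)"
      by (intro continuous_on_add linear_continuous_on assms continuous_on_const)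
    ultimately show ?case
      using continuous_on_compose2[of UNIV "flat_power n" UNIV "\<lambda>x. L x + c"] by simp
  next
    case (Suc k)
    show ?case
    proof (rule Ck_on_SucI)
      show "((\<lambda>x. flat_power n (L x + c)) has_derivative
         (\<lambda>h. L h * (flat_power (n + 2) (L x + c) + (- real n) * flat_power (n + 1) (L x + c)))) (at x)" for x
        using has_derivative_compose[of "\<lambda>x. L x + c" L x UNIV "flat_power n"]
          flat_power_has_derivative[of n "L x + c"] bounded_linear_imp_has_derivative[OF assms]
        by (auto simp: has_field_derivative_def mult.commute[of _ "L _"]
            intro!: has_derivative_eq_rhs[OF has_derivative_compose[of "\<lambda>x. L x + c" L x UNIV "flat_power n"]] derivative_eq_intros)
      show "Ck_on k UNIV (\<lambda>x. L i * (flat_power (n + 2) (L x + c) + (- real n) * flat_power (n + 1) (L x + c)))" for i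
        by (intro Ck_on_mult Ck_on_const Ck_on_add Suc.IH)
    qed
  qed
  then show ?thesis
    unfolding smooth_on_def using Ck_on_bounded_linear[OF bounded_linear_of_real] by blast
qed

section \<open>Test functions\<close>

lemma ae_eq_refl: "square_int f \<Longrightarrow> ae_eq f f"
  by (simp add: ae_eq_def)

lemma L2_cases:
  obtains f where "u = abs_L2 f" "square_int f"
  using Quotient_abs_rep[OF Quotient_L2, of u] Quotient_rep_reflp[OF Quotient_L2, of u]
  by (metis ae_eq_def)

lemma abs_L2_eq_iff:
  "square_int f \<Longrightarrow> square_int g \<Longrightarrow> abs_L2 f = abs_L2 g \<longleftrightarrow> (AE x in lborel. f x = g x)"
  using Quotient_rel[OF Quotient_L2, of f g] by (auto simp: ae_eq_def)

lemma cinner_abs_L2: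
  "square_int f \<Longrightarrow> square_int g \<Longrightarrow> cinner (abs_L2 f) (abs_L2 g) = (\<integral>x. f x * cnj (g x) \<partial>lborel)"
  by (simp add: cinner.abs_eq ae_eq_refl)

lemma norm_abs_L2:
  assumes "square_int f"
  shows "(norm (abs_L2 f))\<^sup>2 = (\<integral>x. (cmod (f x))\<^sup>2 \<partial>lborel)"
proof -
  have "(norm (abs_L2 f))\<^sup>2 = Re (cinner (abs_L2 f) (abs_L2 f))"
    using cinner_self_nonneg[of "abs_L2 f"] by (simp add: norm_L2_def inner_L2_def)
  also have "\<dots> = (\<integral>x. (cmod (f x))\<^sup>2 \<partial>lborel)"
    unfolding cinner_abs_L2[OF assms assms]
    by (simp add: complex_norm_square[symmetric] flip: of_real_power)
  finally show ?thesis .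
qed

lemma test_functionsE:
  assumes "\<phi> \<in> test_functions \<Omega>"
  obtains K where "smooth_on UNIV \<phi>" "compact K" "K \<subseteq> \<Omega>" "\<And>x. x \<notin> K \<Longrightarrow> \<phi> x = 0"
proof -
  have "x \<notin> closure {x. \<phi> x \<noteq> 0} \<Longrightarrow> \<phi> x = 0" for x
    using closure_subset[of "{x. \<phi> x \<noteq> 0}"] by blast
  then show ?thesis using assms that unfolding test_functions_def by blast
qed

lemma test_functionsI:
  assumes "smooth_on UNIV \<phi>" "compact K" "K \<subseteq> \<Omega>" "\<And>x. x \<notin> K \<Longrightarrow> \<phi> x = 0"
  shows "\<phi> \<in> test_functions \<Omega>"
proof -
  have "closure {x. \<phi> x \<noteq> 0} \<subseteq> K"
    using assms by (intro closure_minimal compact_imp_closed) auto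
  moreover from this have "compact (closure {x. \<phi> x \<noteq> 0})"
    using assms(2) by (metis closed_closure compact_Int_closed inf.absorb_iff2)
  ultimately show ?thesis using assms by (auto simp: test_functions_def)
qed

lemma test_functions_mult:
  assumes "\<phi> \<in> test_functions \<Omega>" "smooth_on UNIV \<psi>"
  shows "(\<lambda>x. \<psi> x * \<phi> x) \<in> test_functions \<Omega>"
  using assms by (elim test_functionsE, intro test_functionsI) (auto intro: smooth_on_mult)

lemma test_functions_add:
  assumes "\<phi> \<in> test_functions \<Omega>" "\<psi> \<in> test_functions \<Omega>"
  shows "(\<lambda>x. \<phi> x + \<psi> x) \<in> test_functions \<Omega>"
proof -
  obtain K L where "smooth_on UNIV \<phi>" "compact K" "K \<subseteq> \<Omega>" "\<And>x. x \<notin> K \<Longrightarrow> \<phi> x = 0"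
    "smooth_on UNIV \<psi>" "compact L" "L \<subseteq> \<Omega>" "\<And>x. x \<notin> L \<Longrightarrow> \<psi> x = 0"
    using assms by (meson test_functionsE)
  then show ?thesis by (intro test_functionsI[where K="K \<union> L"]) (auto intro: smooth_on_add)
qed

lemma test_functions_bounded_linear:
  assumes "\<phi> \<in> test_functions \<Omega>" "bounded_linear L"
  shows "(\<lambda>x. L (\<phi> x)) \<in> test_functions \<Omega>"
  using assms by (elim test_functionsE, intro test_functionsI)
    (auto intro: smooth_on_bounded_linear simp: linear_simps)

lemma test_functions_scale: "\<phi> \<in> test_functions \<Omega> \<Longrightarrow> (\<lambda>x. c * \<phi> x) \<in> test_functions \<Omega>"
  by (rule test_functions_bounded_linear[OF _ bounded_linear_mult_right])

lemma test_functions_cnj: "\<phi> \<in> test_functions \<Omega> \<Longrightarrow> (\<lambda>x. cnj (\<phi> x)) \<in> test_functions \<Omega>"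
  by (rule test_functions_bounded_linear[OF _ bounded_linear_cnj])

lemma test_functions_zero: "(\<lambda>x. 0) \<in> test_functions \<Omega>"
  by (rule test_functionsI[where K="{}"]) (auto simp: smooth_on_def Ck_on_const)

lemma test_functions_pderiv:
  assumes "\<phi> \<in> test_functions \<Omega>" "i \<in> Basis"
  shows "pderiv_at i \<phi> \<in> test_functions \<Omega>"
proof -
  obtain K where K: "smooth_on UNIV \<phi>" "compact K" "K \<subseteq> \<Omega>" "\<And>x. x \<notin> K \<Longrightarrow> \<phi> x = 0"
    using assms by (meson test_functionsE)
  have "frechet_derivative \<phi> (at x) i = 0" if "x \<notin> K" for x
  proof -
    have "frechet_derivative \<phi> (at x) = frechet_derivative (\<lambda>x. 0) (at x)"
      by (rule frechet_derivative_transform_within_open[where X="- K"])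
        (use K that smooth_on_has_derivative[OF K(1)] in \<open>auto simp: compact_imp_closed differentiable_def\<close>)
    then show ?thesis by simp
  qed
  then show ?thesis using K assms(2) by (intro test_functionsI[where K=K] smooth_on_pderiv) auto
qed

lemma test_functions_integrable:
  assumes "\<phi> \<in> test_functions \<Omega>"
  shows "integrable lborel \<phi>"
proof -
  obtain K where K: "smooth_on UNIV \<phi>" "compact K" "K \<subseteq> \<Omega>" "\<And>x. x \<notin> K \<Longrightarrow> \<phi> x = 0"
    using assms by (meson test_functionsE)
  have "integrable lborel (\<lambda>x. indicator K x *\<^sub>R \<phi> x)"
    by (rule borel_integrable_compact[OF K(2) continuous_on_subset[OF smooth_on_continuous[OF K(1)]]]) auto
  also have "(\<lambda>x. indicator K x *\<^sub>R \<phi> x) = \<phi>"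
    using K(4) by (auto simp: indicator_def fun_eq_iff)
  finally show ?thesis .
qed

lemma test_functions_square_int:
  assumes "\<phi> \<in> test_functions \<Omega>"
  shows "square_int \<phi>"
proof -
  obtain K where K: "smooth_on UNIV \<phi>" "compact K" "K \<subseteq> \<Omega>" "\<And>x. x \<notin> K \<Longrightarrow> \<phi> x = 0"
    using assms by (meson test_functionsE)
  have c: "continuous_on S \<phi>" for S by (rule continuous_on_subset[OF smooth_on_continuous[OF K(1)]]) auto
  have "integrable lborel (\<lambda>x. indicator K x *\<^sub>R (cmod (\<phi> x))\<^sup>2)"
    by (rule borel_integrable_compact[OF K(2)]) (intro continuous_intros c)
  also have "(\<lambda>x. indicator K x *\<^sub>R (cmod (\<phi> x))\<^sup>2) = (\<lambda>x. (cmod (\<phi> x))\<^sup>2)"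
    using K(4) by (auto simp: indicator_def fun_eq_iff)
  finally show ?thesis
    using borel_measurable_continuous_onI[OF c] by (simp add: square_int_def)
qed

lemma abs_L2_test_function: "\<phi> \<in> test_functions \<Omega> \<Longrightarrow> abs_L2 \<phi> \<in> L2_on \<Omega>"
  using test_functions_square_int[of \<phi> \<Omega>]
  by (auto simp: L2_on_def vanishes_outside.abs_eq ae_eq_refl elim!: test_functionsE)

section \<open>Vanishing of the integral of a derivative\<close>

lemma translation_invariance:
  fixes f :: "'a::euclidean_space \<Rightarrow> complex"
  assumes "f \<in> borel_measurable borel"
  shows "(\<integral>x. f (x + c) \<partial>lborel) = (\<integral>x. f x \<partial>lborel)"
  using integral_distr[of "(+) c" lborel borel f] assms lborel_distr_plus[of c]
  by (simp add: add.commute)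

lemma integrable_translation:
  fixes f :: "'a::euclidean_space \<Rightarrow> complex"
  assumes "integrable lborel f"
  shows "integrable lborel (\<lambda>x. f (x + c))"
  using integrable_distr[of "(+) c" lborel borel f] assms lborel_distr_plus[of c]
  by (simp add: add.commute)

text \<open>Translation invariance makes the integral of every difference quotient in direction i
  vanish, and dominated convergence passes to the limit. This avoids iterated integrals over a
  product decomposition of the space.\<close>

lemma integral_pderiv_test_function:
  assumes phi: "\<phi> \<in> test_functions \<Omega>" and i: "i \<in> Basis"
  shows "(\<integral>x. pderiv_at i \<phi> x \<partial>lborel) = 0"
proof -
  obtain K where K: "smooth_on UNIV \<phi>" "compact K" "K \<subseteq> \<Omega>" "\<And>x. x \<notin> K \<Longrightarrow> \<phi> x = 0"
    using phi by (meson test_functionsE)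
  obtain K' where K': "smooth_on UNIV (pderiv_at i \<phi>)" "compact K'" "\<And>x. x \<notin> K' \<Longrightarrow> pderiv_at i \<phi> x = 0"
    using test_functions_pderiv[OF assms] by (meson test_functionsE)
  have "bounded (pderiv_at i \<phi> ` K')"
    by (intro compact_imp_bounded compact_continuous_image K' continuous_on_subset[OF smooth_on_continuous[OF K'(1)]]) auto
  then obtain M where M: "M > 0" "\<And>x. x \<in> K' \<Longrightarrow> cmod (pderiv_at i \<phi> x) \<le> M"
    by (auto simp: bounded_pos)
  then have M': "cmod (pderiv_at i \<phi> x) \<le> M" for x using K'(3)[of x] by (cases "x \<in> K'") auto
  obtain R where R: "\<And>x. x \<in> K \<Longrightarrow> norm x \<le> R" using compact_imp_bounded[OF K(2)] by (auto simp: bounded_iff)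
  have dphi: "(\<phi> has_derivative frechet_derivative \<phi> (at x)) (at x)" for x
    by (rule smooth_on_has_derivative[OF K(1)])
  have MVT: "cmod (\<phi> (x + t *\<^sub>R i) - \<phi> x) \<le> M * t" if t: "t \<ge> 0" for x t
  proof -
    have "cmod (\<phi> (x + t *\<^sub>R i) - \<phi> (x + 0 *\<^sub>R i)) \<le> M * norm (t - 0)"
    proof (rule differentiable_bound[where S="{0..t}" and f="\<lambda>s. \<phi> (x + s *\<^sub>R i)" and
          f'="\<lambda>s h. frechet_derivative \<phi> (at (x + s *\<^sub>R i)) (h *\<^sub>R i)"])
      show "((\<lambda>s. \<phi> (x + s *\<^sub>R i)) has_derivative (\<lambda>h. frechet_derivative \<phi> (at (x + s *\<^sub>R i)) (h *\<^sub>R i))) (at s within {0..t})" for s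
        by (rule has_derivative_at_withinI[OF has_derivative_compose[where f="\<lambda>s. x + s *\<^sub>R i" and s=UNIV, OF _ dphi]])
          (auto intro!: derivative_eq_intros)
      show "onorm (\<lambda>h. frechet_derivative \<phi> (at (x + s *\<^sub>R i)) (h *\<^sub>R i)) \<le> M" for s
      proof (rule onorm_le)
        fix h
        have "frechet_derivative \<phi> (at (x + s *\<^sub>R i)) (h *\<^sub>R i) = h *\<^sub>R pderiv_at i \<phi> (x + s *\<^sub>R i)"
          using has_derivative_bounded_linear[OF dphi] linear_simps(5) by blast
        then show "cmod (frechet_derivative \<phi> (at (x + s *\<^sub>R i)) (h *\<^sub>R i)) \<le> M * norm h"
          using mult_right_mono[OF M'[of "x + s *\<^sub>R i"], of "norm h"] by (simp add: mult.commute)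
      qed
    qed (use t in auto)
    then show ?thesis using t by simp
  qed
  let ?h = "\<lambda>n. 1 / real (Suc n)"
  let ?s = "\<lambda>n x. real (Suc n) *\<^sub>R (\<phi> (x + ?h n *\<^sub>R i) - \<phi> x)"
  have meas: "\<phi> \<in> borel_measurable borel"
    by (rule borel_measurable_continuous_onI[OF smooth_on_continuous[OF K(1)]])
  have "(\<lambda>n. \<integral>x. ?s n x \<partial>lborel) \<longlonglongrightarrow> (\<integral>x. pderiv_at i \<phi> x \<partial>lborel)"
  proof (rule integral_dominated_convergence)
    \<comment> \<open>The radius is R + 1 because the shifts \<open>?h n *\<^sub>R i\<close> have
      norm at most 1; M bounds the quotients by the mean value inequality.\<close>
    show "integrable lborel (\<lambda>x. indicator (cball 0 (R + 1)) x *\<^sub>R M)"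
      by (rule borel_integrable_compact) auto
    show "pderiv_at i \<phi> \<in> borel_measurable lborel"
      using borel_measurable_continuous_onI[OF smooth_on_continuous[OF K'(1)]] by simp
    show "?s n \<in> borel_measurable lborel" for n
      using measurable_compose[OF _ meas, of "\<lambda>x. x + ?h n *\<^sub>R i"] meas by simp
    show "AE x in lborel. (\<lambda>n. ?s n x) \<longlonglongrightarrow> pderiv_at i \<phi> x"
    proof (rule AE_I2)
      fix x
      have y: "filterlim (\<lambda>n. x + ?h n *\<^sub>R i) (at x) sequentially"
      proof (rule filterlim_atI)
        have "(\<lambda>n. x + ?h n *\<^sub>R i) \<longlonglongrightarrow> x + 0 *\<^sub>R i"
          by (intro tendsto_intros LIMSEQ_Suc[OF lim_1_over_n])
        then show "(\<lambda>n. x + ?h n *\<^sub>R i) \<longlonglongrightarrow> x" by simp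
        show "\<forall>\<^sub>F n in sequentially. x + ?h n *\<^sub>R i \<noteq> x" using nonzero_Basis[OF i] by simp
      qed
      have "((\<lambda>y. norm (\<phi> y - \<phi> x - frechet_derivative \<phi> (at x) (y - x)) / norm (y - x)) \<longlongrightarrow> 0) (at x)"
        using dphi[of x] unfolding has_derivative_iff_norm by simp
      from filterlim_compose[OF this y]
      have "(\<lambda>n. norm (\<phi> (x + ?h n *\<^sub>R i) - \<phi> x - frechet_derivative \<phi> (at x) (?h n *\<^sub>R i)) / norm (?h n *\<^sub>R i)) \<longlonglongrightarrow> 0"
        by simp
      also have "(\<lambda>n. norm (\<phi> (x + ?h n *\<^sub>R i) - \<phi> x - frechet_derivative \<phi> (at x) (?h n *\<^sub>R i)) / norm (?h n *\<^sub>R i))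
        = (\<lambda>n. norm (?s n x - pderiv_at i \<phi> x))"
      proof
        fix n
        have "frechet_derivative \<phi> (at x) (?h n *\<^sub>R i) = ?h n *\<^sub>R pderiv_at i \<phi> x"
          using has_derivative_bounded_linear[OF dphi] linear_simps(5) by blast
        then have "?s n x - pderiv_at i \<phi> x = real (Suc n) *\<^sub>R (\<phi> (x + ?h n *\<^sub>R i) - \<phi> x - frechet_derivative \<phi> (at x) (?h n *\<^sub>R i))"
          by (simp add: scaleR_diff_right)
        then show "norm (\<phi> (x + ?h n *\<^sub>R i) - \<phi> x - frechet_derivative \<phi> (at x) (?h n *\<^sub>R i)) / norm (?h n *\<^sub>R i) = norm (?s n x - pderiv_at i \<phi> x)"
          using i by (simp only: norm_scaleR) (simp add: field_simps)
      qed
      finally show "(\<lambda>n. ?s n x) \<longlonglongrightarrow> pderiv_at i \<phi> x"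
        by (simp add: LIM_zero_iff tendsto_norm_zero_iff)
    qed
    show "AE x in lborel. norm (?s n x) \<le> indicator (cball 0 (R + 1)) x *\<^sub>R M" for n
    proof (rule AE_I2)
      fix x
      show "norm (?s n x) \<le> indicator (cball 0 (R + 1)) x *\<^sub>R M"
      proof (cases "norm x \<le> R + 1")
        case True
        have "norm (?s n x) \<le> real (Suc n) * (M * ?h n)"
          unfolding norm_scaleR using MVT[of "?h n" x] by (intro mult_mono) auto
        then show ?thesis using True by simp
      next
        case False
        have "norm x \<le> norm (x + ?h n *\<^sub>R i) + norm (?h n *\<^sub>R i)"
          by (metis add_diff_cancel_right' norm_triangle_ineq4)
        moreover have "norm (?h n *\<^sub>R i) \<le> 1" using i by simp
        ultimately have "x \<notin> K" "x + ?h n *\<^sub>R i \<notin> K" using R[of x] R[of "x + ?h n *\<^sub>R i"] False by linarith+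
        then show ?thesis using K(4) False by simp
      qed
    qed
  qed
  moreover have "(\<integral>x. ?s n x \<partial>lborel) = 0" for n
    using translation_invariance[OF meas, of "?h n *\<^sub>R i"] test_functions_integrable[OF phi]
      integrable_translation[OF test_functions_integrable[OF phi], of "?h n *\<^sub>R i"]
    by (simp del: of_nat_Suc)
  ultimately show ?thesis by (simp add: LIMSEQ_const_iff)
qed

section \<open>Uniqueness of weak derivatives\<close>

lemma pairing_abs_L2:
  assumes "square_int f" "\<phi> \<in> test_functions \<Omega>"
  shows "pairing (abs_L2 f) \<phi> = (\<integral>x. f x * \<phi> x \<partial>lborel)"
  using assms test_functions_square_int[OF test_functions_cnj[OF assms(2)]]
  by (simp add: pairing_def cinner_abs_L2)

text \<open>Each factor is exp(-1/((n + 1) s)) with s the distance of x to one face, replaced by 0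
  on the wrong side of that face. It stays between 0 and 1 and tends to 1 at interior points as n
  grows, and the product vanishes outside the open box, boundary included.\<close>

lemma cbox_approximation:
  fixes a b :: "'a::euclidean_space"
  assumes "cbox a b \<subseteq> \<Omega>"
  obtains \<phi> where "\<And>n. \<phi> n \<in> test_functions \<Omega>" "\<And>n x. cmod (\<phi> n x) \<le> indicator (cbox a b) x"
    "\<And>x. (\<lambda>n. \<phi> n x) \<longlonglongrightarrow> indicator (box a b) x"
proof
  define F where "F n s t = flat_power 0 (real (Suc n) * (s - t))" for n s t
  let ?\<phi> = "\<lambda>n x. \<Prod>i\<in>Basis. complex_of_real (F n (x \<bullet> i) (a \<bullet> i)) * complex_of_real (F n (b \<bullet> i) (x \<bullet> i))"
  have F: "F n s t = (if s > t then exp (- inverse (real (Suc n) * (s - t))) else 0)" for n s t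
    unfolding F_def flat_power_def by (simp add: zero_less_mult_iff)
  have out: "?\<phi> n x = 0" if x: "x \<notin> box a b" for n x
  proof -
    obtain i where "i \<in> Basis" "\<not> (a \<bullet> i < x \<bullet> i \<and> x \<bullet> i < b \<bullet> i)"
      using x unfolding mem_box by blast
    then show ?thesis by (intro prod_zero) (auto simp: F)
  qed
  have out': "?\<phi> n x = 0" if "x \<notin> cbox a b" for n x
    using out[of x n] that box_subset_cbox[of a b] by blast
  have smooth: "smooth_on UNIV (?\<phi> n)" for n
  proof -
    have "smooth_on UNIV (\<lambda>x. complex_of_real (F n (x \<bullet> i) (a \<bullet> i)))" for i
      using smooth_on_flat_power[of "\<lambda>x. real (Suc n) * (x \<bullet> i)" 0 "- (real (Suc n) * (a \<bullet> i))"]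
      by (simp add: F_def right_diff_distrib bounded_linear_const_mult bounded_linear_inner_left del: of_nat_Suc)
    moreover have "smooth_on UNIV (\<lambda>x. complex_of_real (F n (b \<bullet> i) (x \<bullet> i)))" for i
      using smooth_on_flat_power[of "\<lambda>x. - (real (Suc n) * (x \<bullet> i))" 0 "real (Suc n) * (b \<bullet> i)"]
      by (simp add: F_def right_diff_distrib bounded_linear_const_mult bounded_linear_inner_left bounded_linear_minus del: of_nat_Suc)
    ultimately show ?thesis unfolding smooth_on_def by (auto intro!: Ck_on_prod Ck_on_mult)
  qed
  show "?\<phi> n \<in> test_functions \<Omega>" for n
    by (rule test_functionsI[OF smooth compact_cbox assms out'])
  have le1: "0 \<le> F n s t" "F n s t \<le> 1" for n s t by (auto simp: F)
  have "cmod (?\<phi> n x) \<le> 1" for n x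
    unfolding prod_norm[symmetric] norm_mult norm_of_real
    by (intro prod_le_1) (auto simp: le1 abs_of_nonneg intro!: mult_le_one)
  then show "cmod (?\<phi> n x) \<le> indicator (cbox a b) x" for n x
    using out'[of x n] by (cases "x \<in> cbox a b") auto
  show "(\<lambda>n. ?\<phi> n x) \<longlonglongrightarrow> indicator (box a b) x" for x
  proof (cases "x \<in> box a b")
    case False
    then show ?thesis unfolding out[OF False] by simp
  next
    case True
    have lim: "(\<lambda>n. exp (- inverse (real (Suc n) * s))) \<longlonglongrightarrow> 1" if "s > 0" for s :: real
    proof -
      have "(\<lambda>n. exp (- (inverse (real (Suc n)) * inverse s))) \<longlonglongrightarrow> exp (- (0 * inverse s))"
        by (intro tendsto_intros LIMSEQ_inverse_real_of_nat)
      then show ?thesis by simp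
    qed
    have "(\<lambda>n. ?\<phi> n x) \<longlonglongrightarrow> (\<Prod>i\<in>(Basis::'a set). complex_of_real 1 * complex_of_real 1)"
    proof (intro tendsto_prod tendsto_mult tendsto_of_real)
      fix i :: 'a assume "i \<in> Basis"
      then have "a \<bullet> i < x \<bullet> i" "x \<bullet> i < b \<bullet> i" using True by (auto simp: mem_box)
      then show "(\<lambda>n. F n (x \<bullet> i) (a \<bullet> i)) \<longlonglongrightarrow> 1" "(\<lambda>n. F n (b \<bullet> i) (x \<bullet> i)) \<longlonglongrightarrow> 1"
        using lim[of "x \<bullet> i - a \<bullet> i"] lim[of "b \<bullet> i - x \<bullet> i"] unfolding F by simp_all
    qed
    then show ?thesis using True by simp
  qed
qed

text \<open>Open boxes form an intersection-stable generator of the Borel sets, so by Dynkin's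
  argument the integral of f vanishes over every Borel set; the real and imaginary parts are then
  null as densities.\<close>

lemma integrable_AE_zero:
  fixes f :: "'a::euclidean_space \<Rightarrow> complex"
  assumes f: "integrable lborel f" and box: "\<And>a b. (\<integral>x. indicator (box a b) x *\<^sub>R f x \<partial>lborel) = 0"
  shows "AE x in lborel. f x = 0"
proof -
  have indi: "integrable lborel (\<lambda>x. indicator A x *\<^sub>R f x)" if "A \<in> sets borel" for A
    using integrable_mult_indicator[OF _ f, of A] that by simp
  \<comment> \<open>Closure under complements needs the integral over the whole space, obtained as
    the limit over growing boxes.\<close>
  have total: "(\<integral>x. f x \<partial>lborel) = 0"
  proof -
    have "(\<lambda>n. \<integral>x. indicator (box (- (real n *\<^sub>R One)) (real n *\<^sub>R One)) x *\<^sub>R f x \<partial>lborel) \<longlonglongrightarrow> (\<integral>x. f x \<partial>lborel)"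
    proof (rule integral_dominated_convergence[where w="\<lambda>x. norm (f x)"])
      show "AE x in lborel. (\<lambda>n. indicator (box (- (real n *\<^sub>R One)) (real n *\<^sub>R One)) x *\<^sub>R f x) \<longlonglongrightarrow> f x"
      proof (rule AE_I2)
        fix x :: 'a
        obtain N :: nat where N: "norm x < real N" using reals_Archimedean2 by blast
        have "x \<in> box (- (real n *\<^sub>R One)) (real n *\<^sub>R One)" if "n \<ge> N" for n
          unfolding mem_box
        proof
          fix i :: 'a assume i: "i \<in> Basis"
          have "\<bar>x \<bullet> i\<bar> \<le> norm x" using i by (rule Basis_le_norm)
          then have "\<bar>x \<bullet> i\<bar> < real n" using N that by (simp add: less_le_trans)
          then show "- (real n *\<^sub>R One) \<bullet> i < x \<bullet> i \<and> x \<bullet> i < (real n *\<^sub>R One) \<bullet> i"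
            using i by (simp add: abs_less_iff)
        qed
        then have "\<forall>\<^sub>F n in sequentially. indicator (box (- (real n *\<^sub>R One)) (real n *\<^sub>R One)) x *\<^sub>R f x = f x"
          unfolding eventually_sequentially by (intro exI[of _ N]) simp
        then show "(\<lambda>n. indicator (box (- (real n *\<^sub>R One)) (real n *\<^sub>R One)) x *\<^sub>R f x) \<longlonglongrightarrow> f x"
          by (rule tendsto_eventually)
      qed
    qed (use f in \<open>auto simp: indicator_def dest: borel_measurable_integrable\<close>)
    then show ?thesis unfolding box by (simp add: LIMSEQ_const_iff)
  qed
  have all: "(\<integral>x. indicator A x *\<^sub>R f x \<partial>lborel) = 0" if "A \<in> sets borel" for A
  proof (rule sigma_sets_induct_disjoint[where G="range (\<lambda>(a, b). box a b :: 'a set)" and \<Omega>=UNIV and A=A])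
    show "Int_stable (range (\<lambda>(a, b). box a b :: 'a set))"
      by (auto simp: Int_stable_def Int_interval box_Int_box)
    have s: "sigma_sets UNIV (range (\<lambda>(a, b). box a b :: 'a set)) = sets borel"
      by (subst borel_eq_box) simp
    then show "A \<in> sigma_sets UNIV (range (\<lambda>(a, b). box a b))" using that by simp
    show "(\<integral>x. indicator (UNIV - B) x *\<^sub>R f x \<partial>lborel) = 0"
      if "B \<in> sigma_sets UNIV (range (\<lambda>(a, b). box a b))" "(\<integral>x. indicator B x *\<^sub>R f x \<partial>lborel) = 0" for B
    proof -
      have "(\<integral>x. indicator (UNIV - B) x *\<^sub>R f x \<partial>lborel) = (\<integral>x. f x - indicator B x *\<^sub>R f x \<partial>lborel)"
        by (intro Bochner_Integration.integral_cong) (auto simp: indicator_def)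
      also have "\<dots> = (\<integral>x. f x \<partial>lborel) - (\<integral>x. indicator B x *\<^sub>R f x \<partial>lborel)"
        using that(1) unfolding s by (intro Bochner_Integration.integral_diff f indi)
      finally show ?thesis using that(2) total by simp
    qed
    show "(\<integral>x. indicator (\<Union> (range B)) x *\<^sub>R f x \<partial>lborel) = 0"
      if "disjoint_family B" "range B \<subseteq> sigma_sets UNIV (range (\<lambda>(a, b). box a b))"
        "\<And>i. (\<integral>x. indicator (B i) x *\<^sub>R f x \<partial>lborel) = 0" for B :: "nat \<Rightarrow> 'a set"
    proof -
      have m: "B i \<in> sets lborel" for i using that(2) s by auto
      have "(LINT x:(\<Union> (range B))|lborel. f x) = (\<Sum>i. (LINT x:(B i)|lborel. f x))"
        using m that(1) indi[of "\<Union> (range B)"]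
        by (intro lebesgue_integral_countable_add) (auto simp: disjoint_family_on_def set_integrable_def)
      then show ?thesis using that(3) by (simp add: set_lebesgue_integral_def)
    qed
  qed (use box in auto)
  have "AE x in lborel. Re (f x) = 0"
  proof (rule density_unique_real)
    show "(LINT x:A|lborel. Re (f x)) = (LINT x:A|lborel. 0)" if "A \<in> sets lborel" for A
      using integral_Re[OF indi[of A]] all[of A] that by (simp add: set_lebesgue_integral_def)
  qed (use f in auto)
  moreover have "AE x in lborel. Im (f x) = 0"
  proof (rule density_unique_real)
    show "(LINT x:A|lborel. Im (f x)) = (LINT x:A|lborel. 0)" if "A \<in> sets lborel" for A
      using integral_Im[OF indi[of A]] all[of A] that by (simp add: set_lebesgue_integral_def)
  qed (use f in auto)
  ultimately show ?thesis by eventually_elim (simp add: complex_eq_iff)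
qed

text \<open>The fundamental lemma of the calculus of variations. The open set is a countable union
  of closed boxes; in each of them the functions of \<open>cbox_approximation\<close> turn vanishing
  pairings into vanishing integrals over all smaller open boxes, and the boundary of a box is a null
  set.\<close>

lemma pairing_zero_imp_zero:
  assumes "open \<Omega>" "u \<in> L2_on \<Omega>" and p: "\<And>\<phi>. \<phi> \<in> test_functions \<Omega> \<Longrightarrow> pairing u \<phi> = 0"
  shows "u = 0"
proof -
  obtain f where f: "u = abs_L2 f" "square_int f" by (rule L2_cases)
  have fm: "f \<in> borel_measurable borel" using f by (simp add: square_int_def)
  obtain \<D> where D: "countable \<D>" "\<D> \<subseteq> Pow \<Omega>" "\<And>X. X \<in> \<D> \<Longrightarrow> \<exists>a b. X = cbox a b" "\<Union>\<D> = \<Omega>"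
    using open_countable_Union_open_cbox[OF assms(1)] by metis
  have "AE x in lborel. x \<in> X \<longrightarrow> f x = 0" if X: "X \<in> \<D>" for X
  proof -
    obtain a b where ab: "X = cbox a b" using D X by blast
    have sub: "cbox a b \<subseteq> \<Omega>" using D X ab by blast
    let ?g = "\<lambda>x. indicator (box a b) x *\<^sub>R f x"
    \<comment> \<open>A square-integrable function is integrable over a box because it can be paired
      with the indicator, which is itself square-integrable.\<close>
    have ind: "square_int (\<lambda>x. complex_of_real (indicator (cbox a b) x))"
    proof -
      have "integrable lborel (\<lambda>x. indicator (cbox a b) x *\<^sub>R (1::real))"
        by (rule borel_integrable_compact) auto
      also have "(\<lambda>x. indicator (cbox a b) x *\<^sub>R (1::real)) = (\<lambda>x. (cmod (complex_of_real (indicator (cbox a b) x)))\<^sup>2)"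
        by (auto simp: indicator_def)
      finally show ?thesis by (simp add: square_int_def)
    qed
    have int: "integrable lborel (\<lambda>x. indicator (cbox a b) x *\<^sub>R f x)"
      using square_int_mult[OF f(2) ind] by (simp add: scaleR_conv_of_real mult.commute)
    have boxes: "(\<integral>x. indicator (box c d) x *\<^sub>R f x \<partial>lborel) = 0" if cd: "cbox c d \<subseteq> cbox a b" for c d
    proof -
      have "cbox c d \<subseteq> \<Omega>" using cd sub by blast
      then obtain \<phi> where \<phi>: "\<And>n. \<phi> n \<in> test_functions \<Omega>" "\<And>n x. cmod (\<phi> n x) \<le> indicator (cbox c d) x"
        "\<And>x. (\<lambda>n. \<phi> n x) \<longlonglongrightarrow> indicator (box c d) x"
        by (rule cbox_approximation) blast
      have "(\<lambda>n. \<integral>x. f x * \<phi> n x \<partial>lborel) \<longlonglongrightarrow> (\<integral>x. f x * indicator (box c d) x \<partial>lborel)"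
      proof (rule integral_dominated_convergence[where w="\<lambda>x. norm (indicator (cbox a b) x *\<^sub>R f x)"])
        show "AE x in lborel. norm (f x * \<phi> n x) \<le> norm (indicator (cbox a b) x *\<^sub>R f x)" for n
        proof (rule AE_I2)
          fix x
          have "cmod (\<phi> n x) \<le> indicator (cbox a b) x"
            using \<phi>(2)[of n x] cd
            by (cases "x \<in> cbox c d") (auto intro: order_trans[OF _ indicator_pos_le])
          then show "norm (f x * \<phi> n x) \<le> norm (indicator (cbox a b) x *\<^sub>R f x)"
            using mult_left_mono[OF _ norm_ge_zero[of "f x"], of "cmod (\<phi> n x)" "indicator (cbox a b) x"]
            by (simp add: norm_mult mult.commute)
        qed
        show "(\<lambda>x. f x * \<phi> n x) \<in> borel_measurable lborel" for n
          using test_functions_square_int[OF \<phi>(1)[of n]] fm by (intro borel_measurable_times) (simp_all add: square_int_def)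
        show "integrable lborel (\<lambda>x. norm (indicator (cbox a b) x *\<^sub>R f x))"
          by (rule integrable_norm[OF int])
      qed (use fm in \<open>auto intro!: tendsto_mult \<phi>(3)\<close>)
      moreover have "(\<integral>x. f x * \<phi> n x \<partial>lborel) = 0" for n
        using p[OF \<phi>(1)] pairing_abs_L2[OF f(2) \<phi>(1)] f(1) by simp
      ultimately have "(\<integral>x. f x * indicator (box c d) x \<partial>lborel) = 0" by (simp add: LIMSEQ_const_iff)
      moreover have "(\<lambda>x. indicator (box c d) x *\<^sub>R f x) = (\<lambda>x. f x * indicator (box c d) x)"
        by (auto simp: indicator_def)
      ultimately show ?thesis by simp
    qed
    have "AE x in lborel. ?g x = 0"
    proof (rule integrable_AE_zero)
      have "integrable lborel (\<lambda>x. indicator (box a b) x *\<^sub>R (indicator (cbox a b) x *\<^sub>R f x))"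
        by (rule integrable_mult_indicator[OF _ int]) simp
      moreover have "(\<lambda>x. indicator (box a b) x *\<^sub>R (indicator (cbox a b) x *\<^sub>R f x)) = ?g"
        using box_subset_cbox[of a b] by (auto simp: indicator_def fun_eq_iff)
      ultimately show "integrable lborel ?g" by simp
      fix c d
      \<comment> \<open>An arbitrary open box is cut down to the given one: the intersection is
        again a box, and its closed version stays inside \<open>cbox a b\<close>, so that the
        approximating test functions are available.\<close>
      let ?c = "\<Sum>i\<in>Basis. max (c \<bullet> i) (a \<bullet> i) *\<^sub>R i" and ?d = "\<Sum>i\<in>Basis. min (d \<bullet> i) (b \<bullet> i) *\<^sub>R i"
      have "box c d \<inter> box a b = box ?c ?d" by (rule box_Int_box)
      moreover have "(\<lambda>x. indicator (box c d) x *\<^sub>R ?g x) = (\<lambda>x. indicator (box c d \<inter> box a b) x *\<^sub>R f x)"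
        by (auto simp: indicator_def)
      moreover have "cbox ?c ?d \<subseteq> cbox a b" by (auto simp: mem_box)
      ultimately show "(\<integral>x. indicator (box c d) x *\<^sub>R ?g x \<partial>lborel) = 0" using boxes by simp
    qed
    moreover have "AE x in lborel. x \<notin> cbox a b - box a b"
    proof (rule AE_not_in)
      have "negligible (cbox a b - box a b)" by (rule negligible_frontier_interval)
      then show "cbox a b - box a b \<in> null_sets lborel"
        by (simp add: negligible_iff_null_sets null_sets_completion_iff)
    qed
    ultimately show ?thesis by eventually_elim (auto simp: ab indicator_def)
  qed
  then have "AE x in lborel. \<forall>X\<in>\<D>. x \<in> X \<longrightarrow> f x = 0"
    by (subst AE_ball_countable[OF D(1)]) blast
  moreover have "AE x in lborel. x \<notin> \<Omega> \<longrightarrow> f x = 0"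
    using assms(2) f by (simp add: L2_on_def vanishes_outside.abs_eq ae_eq_refl)
  ultimately have "AE x in lborel. f x = 0"
    by eventually_elim (use D(4) in blast)
  then show ?thesis
    unfolding f zero_L2.abs_eq using abs_L2_eq_iff[OF f(2) square_int_zero] by simp
qed

section \<open>The Dirichlet Laplacian\<close>

lemma cinner_add_right: "cinner f (g + h) = cinner f g + cinner f h"
  by (subst (1 2 3) cinner_commute) (simp add: cinner_add_left)

lemma cinner_scaleC_right: "cinner f (c *\<^sub>C g) = cnj c * cinner f g"
  by (subst (1 2) cinner_commute) (simp add: cinner_scaleC_left)

lemma scaleC_one: "1 *\<^sub>C (x :: 'a::complex_vec) = x"
  using scaleC_of_real[of 1 x] by simp

lemma scaleC_minus_one: "(-1) *\<^sub>C (x :: 'a::complex_vec) = - x"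
  using scaleC_of_real[of "-1" x] by simp

lemma scaleC_zero_left: "0 *\<^sub>C (x :: 'a::complex_vec) = 0"
  using scaleC_of_real[of 0 x] by simp

lemma scaleC_zero_right: "c *\<^sub>C (0 :: 'a::complex_vec) = 0"
  using scaleC_add_right[of c 0 0] by simp

lemma scaleC_minus_right: "c *\<^sub>C (- x :: 'a::complex_vec) = - (c *\<^sub>C x)"
  by (simp flip: scaleC_minus_one add: scaleC_scaleC)

lemma scaleC_diff_right: "c *\<^sub>C (x - y :: 'a::complex_vec) = c *\<^sub>C x - c *\<^sub>C y"
  by (simp add: diff_conv_add_uminus scaleC_add_right scaleC_minus_right del: add_uminus_conv_diff)

lemma scaleC_minus_left: "(- c) *\<^sub>C (x :: 'a::complex_vec) = - (c *\<^sub>C x)"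
  using scaleC_scaleC[of "-1" c x] by (simp add: scaleC_minus_one)

lemma scaleC_diff_left: "(c - d) *\<^sub>C (x :: 'a::complex_vec) = c *\<^sub>C x - d *\<^sub>C x"
  by (simp add: diff_conv_add_uminus scaleC_add_left scaleC_minus_left del: add_uminus_conv_diff)

lemma cinner_minus_left: "cinner (- f) g = - cinner f g"
  using cinner_scaleC_left[of "-1" f g] by (simp add: scaleC_minus_one)

lemma cinner_minus_right: "cinner f (- g) = - cinner f g"
  using cinner_scaleC_right[of f "-1" g] by (simp add: scaleC_minus_one)

lemma cinner_diff_left: "cinner (f - g) h = cinner f h - cinner g h"
  by (simp add: diff_conv_add_uminus cinner_add_left cinner_minus_left del: add_uminus_conv_diff)

lemma cinner_diff_right: "cinner f (g - h) = cinner f g - cinner f h"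
  by (simp add: diff_conv_add_uminus cinner_add_right cinner_minus_right del: add_uminus_conv_diff)

lemma cinner_zero_left: "cinner 0 g = 0"
  using cinner_diff_left[of 0 0 g] by simp

lemma cinner_zero_right: "cinner g 0 = 0"
  using cinner_diff_right[of g 0 0] by simp

lemma cinner_scaleR_left: "cinner (r *\<^sub>R f) g = r * cinner f g"
  by (simp add: scaleR_L2_def cinner_scaleC_left)

lemma cinner_scaleR_right: "cinner f (r *\<^sub>R g) = r * cinner f g"
  by (simp add: scaleR_L2_def cinner_scaleC_right)

lemma cinner_sum_left: "cinner (\<Sum>i\<in>I. f i) g = (\<Sum>i\<in>I. cinner (f i) g)"
  by (induction I rule: infinite_finite_induct) (auto simp: cinner_zero_left cinner_add_left)

lemma power2_norm_L2: "(norm f)\<^sup>2 = Re (cinner f f)"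
  using cinner_self_nonneg[of f] by (simp add: norm_L2_def inner_L2_def)

lemma cinner_self: "cinner f f = complex_of_real ((norm f)\<^sup>2)"
proof (rule complex_eqI)
  show "Im (cinner f f) = Im (complex_of_real ((norm f)\<^sup>2))"
  proof -
    have "Im (cinner f f) = - Im (cinner f f)"
      using cinner_commute[of f f] by (metis cnj.simps(2))
    then have "Im (cinner f f) = 0" by linarith
    then show ?thesis by (simp only: Im_complex_of_real)
  qed
qed (simp add: power2_norm_L2 del: of_real_power)

lemma norm_scaleC: "norm (c *\<^sub>C (f :: 'a::euclidean_space L2)) = cmod c * norm f"
proof (rule power2_eq_imp_eq)
  have "cinner (c *\<^sub>C f) (c *\<^sub>C f) = (c * cnj c) * cinner f f"
    by (simp add: cinner_scaleC_left cinner_scaleC_right mult.commute mult.left_commute)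
  also have "\<dots> = complex_of_real ((cmod c * norm f)\<^sup>2)"
    by (simp add: complex_norm_square[symmetric] cinner_self power_mult_distrib)
  finally show "(norm (c *\<^sub>C f))\<^sup>2 = (cmod c * norm f)\<^sup>2"
    unfolding power2_norm_L2 by (simp del: of_real_power)
qed auto

text \<open>Multiplying f by a unimodular constant makes the inner product real and nonnegative,
  which reduces the claim to the real inequality for \<open>inner\<close>.\<close>

lemma cinner_Cauchy_Schwarz: "cmod (cinner f g) \<le> norm f * norm g"
proof (cases "cinner f g = 0")
  case False
  let ?c = "cnj (cinner f g) / cmod (cinner f g)"
  have "cinner (?c *\<^sub>C f) g = complex_of_real (cmod (cinner f g))"
    using False by (simp add: cinner_scaleC_left divide_simps complex_norm_square[symmetric] mult.commute power2_eq_square)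
  then have "cmod (cinner f g) = inner (?c *\<^sub>C f) g" by (simp add: inner_L2_def)
  also have "\<dots> \<le> norm (?c *\<^sub>C f) * norm g" by (rule norm_cauchy_schwarz)
  also have "norm (?c *\<^sub>C f) = norm f" using False by (simp add: norm_scaleC norm_divide)
  finally show ?thesis .
qed auto

lemma bounded_linear_cinner_left: "bounded_linear (\<lambda>f. cinner f g)"
  by (rule bounded_linear_intro[of _ "norm g"])
    (simp_all add: cinner_add_left cinner_scaleR_left scaleR_conv_of_real cinner_Cauchy_Schwarz)

lemma L2_on_scaleC: "u \<in> L2_on \<Omega> \<Longrightarrow> c *\<^sub>C u \<in> L2_on \<Omega>"
  unfolding L2_on_def mem_Collect_eq
  by transfer (auto simp: ae_eq_def elim: AE_mp)

lemma L2_on_add: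
  assumes "u \<in> L2_on \<Omega>" "v \<in> L2_on \<Omega>"
  shows "u + v \<in> L2_on \<Omega>"
proof -
  obtain f g where u: "u = abs_L2 f" "square_int f" and v: "v = abs_L2 g" "square_int g" by (metis L2_cases)
  have "AE x in lborel. x \<notin> \<Omega> \<longrightarrow> f x = 0" "AE x in lborel. x \<notin> \<Omega> \<longrightarrow> g x = 0"
    using assms u v by (auto simp: L2_on_def vanishes_outside.abs_eq ae_eq_refl)
  then have "AE x in lborel. x \<notin> \<Omega> \<longrightarrow> f x + g x = 0" by eventually_elim auto
  then show ?thesis using u v
    by (simp add: L2_on_def plus_L2.abs_eq vanishes_outside.abs_eq ae_eq_refl square_int_add)
qed

lemma L2_on_zero: "0 \<in> L2_on \<Omega>"
  unfolding L2_on_def mem_Collect_eq by transfer simp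

lemma L2_on_diff: "u \<in> L2_on \<Omega> \<Longrightarrow> v \<in> L2_on \<Omega> \<Longrightarrow> u - v \<in> L2_on \<Omega>"
  using L2_on_add[of u \<Omega> "(-1) *\<^sub>C v"] L2_on_scaleC[of v \<Omega> "-1"] by (simp add: scaleC_minus_one)

lemma L2_on_sum: "(\<And>i. i \<in> I \<Longrightarrow> f i \<in> L2_on \<Omega>) \<Longrightarrow> (\<Sum>i\<in>I. f i) \<in> L2_on \<Omega>"
  by (induction I rule: infinite_finite_induct) (auto intro: L2_on_zero L2_on_add)

text \<open>This is what gives the definite description in \<open>wderiv\<close> a computable
  value.\<close>

lemma weak_partial_unique:
  assumes "open \<Omega>" "weak_partial \<Omega> i u g" "weak_partial \<Omega> i u h"
  shows "g = h"
proof -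
  have "g - h = 0"
  proof (rule pairing_zero_imp_zero[OF assms(1)])
    show "g - h \<in> L2_on \<Omega>" using assms by (auto simp: weak_partial_def intro: L2_on_diff)
    show "pairing (g - h) \<phi> = 0" if "\<phi> \<in> test_functions \<Omega>" for \<phi>
      using assms that by (force simp: weak_partial_def pairing_def cinner_diff_left)
  qed
  then show ?thesis by simp
qed

lemma weak_partial_add:
  "weak_partial \<Omega> i u g \<Longrightarrow> weak_partial \<Omega> i v h \<Longrightarrow> weak_partial \<Omega> i (u + v) (g + h)"
  by (auto simp: weak_partial_def pairing_def cinner_add_left intro: L2_on_add)

lemma weak_partial_scaleC:
  "weak_partial \<Omega> i u g \<Longrightarrow> weak_partial \<Omega> i (c *\<^sub>C u) (c *\<^sub>C g)"
  by (auto simp: weak_partial_def pairing_def cinner_scaleC_left intro: L2_on_scaleC)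

text \<open>The derivative of the product with a second test function integrates to zero; the
  product rule turns this into integration by parts.\<close>

lemma weak_partial_test_function:
  assumes "\<phi> \<in> test_functions \<Omega>" "i \<in> Basis"
  shows "weak_partial \<Omega> i (abs_L2 \<phi>) (abs_L2 (pderiv_at i \<phi>))"
  unfolding weak_partial_def
proof (intro conjI ballI)
  show "abs_L2 (pderiv_at i \<phi>) \<in> L2_on \<Omega>"
    by (intro abs_L2_test_function test_functions_pderiv assms)
  fix \<psi> assume chi: "\<psi> \<in> test_functions \<Omega>"
  have s: "smooth_on UNIV \<phi>" "smooth_on UNIV \<psi>" using assms chi by (auto elim: test_functionsE)
  have i1: "integrable lborel (\<lambda>x. \<phi> x * pderiv_at i \<psi> x)" "integrable lborel (\<lambda>x. pderiv_at i \<phi> x * \<psi> x)"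
    using test_functions_mult[OF test_functions_pderiv[OF chi assms(2)] s(1)]
      test_functions_mult[OF chi smooth_on_pderiv[OF s(1) assms(2)]] test_functions_integrable by blast+
  have "0 = (\<integral>x. pderiv_at i (\<lambda>x. \<phi> x * \<psi> x) x \<partial>lborel)"
    using integral_pderiv_test_function[OF test_functions_mult[OF chi s(1)] assms(2)] by simp
  also have "\<dots> = (\<integral>x. \<phi> x * pderiv_at i \<psi> x \<partial>lborel) + (\<integral>x. pderiv_at i \<phi> x * \<psi> x \<partial>lborel)"
    unfolding pderiv_at_mult[OF s] using i1 by (rule Bochner_Integration.integral_add)
  finally show "pairing (abs_L2 \<phi>) (pderiv_at i \<psi>) = - pairing (abs_L2 (pderiv_at i \<phi>)) \<psi>"
    using pairing_abs_L2[OF test_functions_square_int[OF assms(1)] test_functions_pderiv[OF chi assms(2)]]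
      pairing_abs_L2[OF test_functions_square_int[OF test_functions_pderiv[OF assms]] chi]
    by (simp add: eq_neg_iff_add_eq_0)
qed

lemma scaleC_sum_right: "c *\<^sub>C (\<Sum>i\<in>I. f i :: 'b::complex_vec) = (\<Sum>i\<in>I. c *\<^sub>C f i)"
  by (induction I rule: infinite_finite_induct) (auto simp: scaleC_zero_right scaleC_add_right)

section \<open>Sobolev spaces and the Dirichlet form\<close>

locale dirichlet_domain =
  fixes \<Omega> :: "'a::euclidean_space set"
  assumes open_Omega: "open \<Omega>" and bounded_Omega: "bounded \<Omega>"
begin

lemma wderiv_eqI: "weak_partial \<Omega> i u g \<Longrightarrow> wderiv \<Omega> i u = g"
  unfolding wderiv_def using weak_partial_unique[OF open_Omega] by blast

lemma H1_weak_partial: "u \<in> H1 \<Omega> \<Longrightarrow> i \<in> Basis \<Longrightarrow> weak_partial \<Omega> i u (wderiv \<Omega> i u)"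
  unfolding H1_def using wderiv_eqI by auto

lemma H1_add: "u \<in> H1 \<Omega> \<Longrightarrow> v \<in> H1 \<Omega> \<Longrightarrow> u + v \<in> H1 \<Omega>"
  unfolding H1_def by (blast intro: L2_on_add weak_partial_add)

lemma H1_scaleC: "u \<in> H1 \<Omega> \<Longrightarrow> c *\<^sub>C u \<in> H1 \<Omega>"
  unfolding H1_def by (blast intro: L2_on_scaleC weak_partial_scaleC)

lemma wderiv_add: "u \<in> H1 \<Omega> \<Longrightarrow> v \<in> H1 \<Omega> \<Longrightarrow> i \<in> Basis \<Longrightarrow> wderiv \<Omega> i (u + v) = wderiv \<Omega> i u + wderiv \<Omega> i v"
  by (intro wderiv_eqI weak_partial_add H1_weak_partial)

lemma wderiv_scaleC: "u \<in> H1 \<Omega> \<Longrightarrow> i \<in> Basis \<Longrightarrow> wderiv \<Omega> i (c *\<^sub>C u) = c *\<^sub>C wderiv \<Omega> i u"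
  by (intro wderiv_eqI weak_partial_scaleC H1_weak_partial)

lemma wderiv_diff: "u \<in> H1 \<Omega> \<Longrightarrow> v \<in> H1 \<Omega> \<Longrightarrow> i \<in> Basis \<Longrightarrow> wderiv \<Omega> i (u - v) = wderiv \<Omega> i u - wderiv \<Omega> i v"
  using wderiv_add[of u "(-1) *\<^sub>C v" i] H1_scaleC[of v "-1"] wderiv_scaleC[of v i "-1"] by (simp add: scaleC_minus_one)

lemma H2_add: "u \<in> H2 \<Omega> \<Longrightarrow> v \<in> H2 \<Omega> \<Longrightarrow> u + v \<in> H2 \<Omega>"
  unfolding H2_def by (auto simp: wderiv_add intro: H1_add)

lemma H2_scaleC: "u \<in> H2 \<Omega> \<Longrightarrow> c *\<^sub>C u \<in> H2 \<Omega>"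
  unfolding H2_def by (auto simp: wderiv_scaleC intro: H1_scaleC)

lemma test_function_H1: "\<phi> \<in> test_functions \<Omega> \<Longrightarrow> abs_L2 \<phi> \<in> H1 \<Omega>"
  unfolding H1_def using abs_L2_test_function weak_partial_test_function by blast

lemma wderiv_test_function: "\<phi> \<in> test_functions \<Omega> \<Longrightarrow> i \<in> Basis \<Longrightarrow> wderiv \<Omega> i (abs_L2 \<phi>) = abs_L2 (pderiv_at i \<phi>)"
  by (intro wderiv_eqI weak_partial_test_function)

text \<open>Closeness in the H1 norm, stated for the function and for each derivative separately. In
  this form it passes through sums, multiples and the identity defining weak derivatives without
  square roots.\<close>

definition close_test where
  "close_test u \<phi> \<epsilon> \<longleftrightarrow> \<phi> \<in> test_functions \<Omega> \<and> norm (u - abs_L2 \<phi>) < \<epsilon> \<and>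
     (\<forall>i\<in>Basis. norm (wderiv \<Omega> i u - abs_L2 (pderiv_at i \<phi>)) < \<epsilon>)"

lemma H10_iff: "u \<in> H10 \<Omega> \<longleftrightarrow> u \<in> H1 \<Omega> \<and> (\<forall>\<epsilon>>0. \<exists>\<phi>. close_test u \<phi> \<epsilon>)"
proof (cases "u \<in> H1 \<Omega>")
  case u: True
  have wd: "wderiv \<Omega> i (u - abs_L2 \<phi>) = wderiv \<Omega> i u - abs_L2 (pderiv_at i \<phi>)" if "\<phi> \<in> test_functions \<Omega>" "i \<in> Basis" for \<phi> i
    using that u by (simp add: wderiv_diff wderiv_test_function test_function_H1)
  have 1: "close_test u \<phi> \<epsilon>" if "\<phi> \<in> test_functions \<Omega>" "H1_norm \<Omega> (u - abs_L2 \<phi>) < \<epsilon>" for \<phi> \<epsilon>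
    unfolding close_test_def
  proof (intro conjI ballI)
    show "norm (u - abs_L2 \<phi>) < \<epsilon>"
      by (rule le_less_trans[OF _ that(2)]) (auto simp: H1_norm_def intro!: real_le_rsqrt sum_nonneg)
    fix i :: 'a assume i: "i \<in> Basis"
    have "(norm (wderiv \<Omega> i (u - abs_L2 \<phi>)))\<^sup>2 \<le> (\<Sum>i\<in>Basis. (norm (wderiv \<Omega> i (u - abs_L2 \<phi>)))\<^sup>2)"
      using i by (intro member_le_sum) auto
    then have "norm (wderiv \<Omega> i (u - abs_L2 \<phi>)) \<le> H1_norm \<Omega> (u - abs_L2 \<phi>)"
      unfolding H1_norm_def by (intro real_le_rsqrt) (simp add: add_increasing)
    then show "norm (wderiv \<Omega> i u - abs_L2 (pderiv_at i \<phi>)) < \<epsilon>"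
      using that i wd by simp
  qed fact
  \<comment> \<open>The norm collects DIM('a) + 1 squares, each below the square of \<epsilon>; the
    square root of this count is estimated by the count itself.\<close>
  have 2: "H1_norm \<Omega> (u - abs_L2 \<phi>) \<le> (1 + DIM('a)) * \<epsilon>" if "close_test u \<phi> \<epsilon>" for \<phi> and \<epsilon> :: real
  proof -
    have e: "\<epsilon> > 0" using that by (auto simp: close_test_def intro: le_less_trans[OF norm_ge_zero])
    have "(norm (u - abs_L2 \<phi>))\<^sup>2 + (\<Sum>i\<in>Basis. (norm (wderiv \<Omega> i (u - abs_L2 \<phi>)))\<^sup>2) \<le> \<epsilon>\<^sup>2 + (\<Sum>i\<in>(Basis::'a set). \<epsilon>\<^sup>2)"
      using that by (intro add_mono sum_mono power_mono) (auto simp: close_test_def wd)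
    also have "\<dots> = (1 + DIM('a)) * \<epsilon>\<^sup>2" by (simp add: algebra_simps)
    also have "\<dots> \<le> ((1 + DIM('a)) * \<epsilon>)\<^sup>2"
      unfolding power_mult_distrib by (intro mult_right_mono) (auto simp: power2_eq_square algebra_simps)
    finally show ?thesis unfolding H1_norm_def using e by (intro real_le_lsqrt) auto
  qed
  have "(\<forall>\<epsilon>>0. \<exists>\<phi>\<in>test_functions \<Omega>. H1_norm \<Omega> (u - abs_L2 \<phi>) < \<epsilon>) \<longleftrightarrow> (\<forall>\<epsilon>>0. \<exists>\<phi>. close_test u \<phi> \<epsilon>)"
  proof (intro iffI allI impI)
    fix \<epsilon> :: real assume "\<epsilon> > 0" "\<forall>\<epsilon>>0. \<exists>\<phi>. close_test u \<phi> \<epsilon>"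
    \<comment> \<open>One more than the count 1 + DIM('a) makes the final inequality strict.\<close>
    then have "\<epsilon> / (2 + DIM('a)) > 0" and "\<exists>\<phi>. close_test u \<phi> (\<epsilon> / (2 + DIM('a)))" by (auto simp: divide_pos_pos)
    then obtain \<phi> where p: "close_test u \<phi> (\<epsilon> / (2 + DIM('a)))" by blast
    have "(1 + DIM('a)) * (\<epsilon> / (2 + DIM('a))) < \<epsilon>" using \<open>\<epsilon> > 0\<close> by (simp add: field_simps)
    with 2[OF p] p show "\<exists>\<phi>\<in>test_functions \<Omega>. H1_norm \<Omega> (u - abs_L2 \<phi>) < \<epsilon>"
      by (auto simp: close_test_def intro!: bexI[of _ \<phi>])
  qed (use 1 in blast)
  then show ?thesis using u by (simp add: H10_def)
qed (simp add: H10_def)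

lemma abs_L2_add: "\<phi> \<in> test_functions \<Omega> \<Longrightarrow> \<psi> \<in> test_functions \<Omega> \<Longrightarrow> abs_L2 (\<lambda>x. \<phi> x + \<psi> x) = abs_L2 \<phi> + abs_L2 \<psi>"
  by (simp add: plus_L2.abs_eq ae_eq_refl test_functions_square_int)

lemma abs_L2_scale: "\<phi> \<in> test_functions \<Omega> \<Longrightarrow> abs_L2 (\<lambda>x. c * \<phi> x) = c *\<^sub>C abs_L2 \<phi>"
  by (simp add: scaleC_L2.abs_eq ae_eq_refl test_functions_square_int)

lemma H10_add:
  assumes "u \<in> H10 \<Omega>" "v \<in> H10 \<Omega>"
  shows "u + v \<in> H10 \<Omega>"
  unfolding H10_iff
proof (intro conjI allI impI)
  have h: "u \<in> H1 \<Omega>" "v \<in> H1 \<Omega>" using assms by (auto simp: H10_def)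
  then show "u + v \<in> H1 \<Omega>" by (rule H1_add)
  fix \<epsilon> :: real assume "\<epsilon> > 0"
  then obtain \<phi> \<psi> where p: "close_test u \<phi> (\<epsilon>/2)" "close_test v \<psi> (\<epsilon>/2)"
    using assms unfolding H10_iff by (meson half_gt_zero)
  have t: "norm (a + b - (c + d)) < \<epsilon>" if "norm (a - c) < \<epsilon>/2" "norm (b - d) < \<epsilon>/2" for a b c d :: "'a L2"
    using norm_triangle_ineq[of "a - c" "b - d"] that by (simp add: algebra_simps)
  have tf: "\<phi> \<in> test_functions \<Omega>" "\<psi> \<in> test_functions \<Omega>" using p by (auto simp: close_test_def)
  then have "smooth_on UNIV \<phi>" "smooth_on UNIV \<psi>" by (auto elim: test_functionsE)
  then have "close_test (u + v) (\<lambda>x. \<phi> x + \<psi> x) \<epsilon>"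
    using p tf h by (auto simp: close_test_def test_functions_add abs_L2_add wderiv_add pderiv_at_add test_functions_pderiv intro!: t)
  then show "\<exists>\<phi>. close_test (u + v) \<phi> \<epsilon>" by blast
qed

lemma H10_scaleC:
  assumes "u \<in> H10 \<Omega>"
  shows "c *\<^sub>C u \<in> H10 \<Omega>"
  unfolding H10_iff
proof (intro conjI allI impI)
  have h: "u \<in> H1 \<Omega>" using assms by (auto simp: H10_def)
  then show "c *\<^sub>C u \<in> H1 \<Omega>" by (rule H1_scaleC)
  fix \<epsilon> :: real assume e: "\<epsilon> > 0"
  then have "\<epsilon> / (1 + cmod c) > 0" by (intro divide_pos_pos) (auto simp: add_pos_nonneg)
  then obtain \<phi> where p: "close_test u \<phi> (\<epsilon> / (1 + cmod c))" using assms unfolding H10_iff by blast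
  have t: "norm (c *\<^sub>C a - c *\<^sub>C b) < \<epsilon>" if "norm (a - b) < \<epsilon> / (1 + cmod c)" for a b :: "'a L2"
  proof -
    have "norm (c *\<^sub>C a - c *\<^sub>C b) = cmod c * norm (a - b)"
      by (simp add: scaleC_diff_right[symmetric] norm_scaleC)
    also have "\<dots> \<le> (1 + cmod c) * norm (a - b)" by (intro mult_right_mono) auto
    also have "\<dots> < \<epsilon>" using that by (simp add: pos_less_divide_eq add_pos_nonneg mult.commute)
    finally show ?thesis .
  qed
  have tf: "\<phi> \<in> test_functions \<Omega>" using p by (auto simp: close_test_def)
  then have s: "smooth_on UNIV \<phi>" by (auto elim: test_functionsE)
  have "close_test (c *\<^sub>C u) (\<lambda>x. c * \<phi> x) \<epsilon>"
    using p tf h by (auto simp: close_test_def test_functions_scale abs_L2_scale wderiv_scaleC test_functions_pderiv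
        pderiv_at_bounded_linear[OF bounded_linear_mult_right s] intro!: t)
  then show "\<exists>\<phi>. close_test (c *\<^sub>C u) \<phi> \<epsilon>" by blast
qed

text \<open>The identity defining the weak derivative of w is tested with the conjugate of \<phi>,
  because \<open>cinner\<close> is conjugate-linear on the right, and then extended to v by density.
  Membership of v in \<open>H10\<close> is what suppresses a boundary term.\<close>

lemma green:
  assumes w: "w \<in> H1 \<Omega>" and v: "v \<in> H10 \<Omega>" and i: "i \<in> Basis"
  shows "cinner (wderiv \<Omega> i w) v = - cinner w (wderiv \<Omega> i v)"
proof -
  let ?D = "cinner (wderiv \<Omega> i w) v + cinner w (wderiv \<Omega> i v)"
  have "cmod ?D \<le> 0 + \<epsilon>" if e: "\<epsilon> > 0" for \<epsilon>
  proof -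
    let ?m = "norm (wderiv \<Omega> i w) + norm w + 1"
    have m: "?m > 0" by (intro add_nonneg_pos) auto
    then have "\<epsilon> / ?m > 0" using e by simp
    then obtain \<phi> where p: "close_test v \<phi> (\<epsilon> / ?m)" using v unfolding H10_iff by blast
    then have tf: "\<phi> \<in> test_functions \<Omega>" by (auto simp: close_test_def)
    then have s: "smooth_on UNIV \<phi>" by (auto elim: test_functionsE)
    have "pairing w (pderiv_at i (\<lambda>x. cnj (\<phi> x))) = - pairing (wderiv \<Omega> i w) (\<lambda>x. cnj (\<phi> x))"
      using H1_weak_partial[OF w i] test_functions_cnj[OF tf] by (auto simp: weak_partial_def)
    then have "cinner w (abs_L2 (pderiv_at i \<phi>)) = - cinner (wderiv \<Omega> i w) (abs_L2 \<phi>)"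
      unfolding pderiv_at_bounded_linear[OF bounded_linear_cnj s] by (simp add: pairing_def)
    then have "?D = cinner (wderiv \<Omega> i w) (v - abs_L2 \<phi>) + cinner w (wderiv \<Omega> i v - abs_L2 (pderiv_at i \<phi>))"
      by (simp add: cinner_diff_right)
    also have "cmod \<dots> \<le> norm (wderiv \<Omega> i w) * norm (v - abs_L2 \<phi>) + norm w * norm (wderiv \<Omega> i v - abs_L2 (pderiv_at i \<phi>))"
      by (intro order_trans[OF norm_triangle_ineq] add_mono cinner_Cauchy_Schwarz)
    also have "\<dots> \<le> norm (wderiv \<Omega> i w) * (\<epsilon> / ?m) + norm w * (\<epsilon> / ?m)"
      using p i by (intro add_mono mult_left_mono) (auto simp: close_test_def less_imp_le)
    also have "\<dots> = (norm (wderiv \<Omega> i w) + norm w) * (\<epsilon> / ?m)" by (rule distrib_right[symmetric])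
    also have "\<dots> \<le> ?m * (\<epsilon> / ?m)" using e m by (intro mult_right_mono) auto
    also have "\<dots> = \<epsilon>" using m by simp
    finally show ?thesis by simp
  qed
  then have "cmod ?D \<le> 0" by (rule field_le_epsilon)
  then show ?thesis by (simp add: eq_neg_iff_add_eq_0)
qed

lemma dom_A_add: "u \<in> dom_A \<Omega> \<Longrightarrow> v \<in> dom_A \<Omega> \<Longrightarrow> u + v \<in> dom_A \<Omega>"
  by (simp add: dom_A_def H2_add H10_add)

lemma dom_A_scaleC: "u \<in> dom_A \<Omega> \<Longrightarrow> c *\<^sub>C u \<in> dom_A \<Omega>"
  by (simp add: dom_A_def H2_scaleC H10_scaleC)

lemma op_A_add: "u \<in> dom_A \<Omega> \<Longrightarrow> v \<in> dom_A \<Omega> \<Longrightarrow> op_A \<Omega> (u + v) = op_A \<Omega> u + op_A \<Omega> v"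
  by (simp add: op_A_def dom_A_def H2_def wderiv_add sum.distrib)

lemma op_A_scaleC: "u \<in> dom_A \<Omega> \<Longrightarrow> op_A \<Omega> (c *\<^sub>C u) = c *\<^sub>C op_A \<Omega> u"
  by (simp add: op_A_def dom_A_def H2_def wderiv_scaleC scaleC_minus_right scaleC_sum_right)

text \<open>Green's formula applied to each first derivative of u. The resulting Dirichlet form
  yields the symmetry of A and, on the diagonal, its Rayleigh quotient.\<close>

lemma cinner_op_A:
  assumes "u \<in> dom_A \<Omega>" "v \<in> dom_A \<Omega>"
  shows "cinner (op_A \<Omega> u) v = (\<Sum>i\<in>Basis. cinner (wderiv \<Omega> i u) (wderiv \<Omega> i v))"
  using assms by (simp add: op_A_def dom_A_def H2_def cinner_minus_left cinner_sum_left green sum_negf)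

lemma eigenspace_add: "u \<in> eigenspace \<Omega> \<mu> \<Longrightarrow> v \<in> eigenspace \<Omega> \<mu> \<Longrightarrow> u + v \<in> eigenspace \<Omega> \<mu>"
  by (simp add: eigenspace_def dom_A_add op_A_add scaleR_add_right)

lemma eigenspace_scaleC: "u \<in> eigenspace \<Omega> \<mu> \<Longrightarrow> c *\<^sub>C u \<in> eigenspace \<Omega> \<mu>"
  by (simp add: eigenspace_def dom_A_scaleC op_A_scaleC scaleC_of_real[symmetric] scaleC_scaleC mult.commute)

lemma dom_A_zero: "0 \<in> dom_A \<Omega>"
proof -
  have z: "weak_partial \<Omega> i 0 0" for i by (simp add: weak_partial_def L2_on_zero pairing_def cinner_zero_left)
  then have w: "wderiv \<Omega> i 0 = 0" for i by (rule wderiv_eqI)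
  have h: "0 \<in> H1 \<Omega>" using z by (auto simp: H1_def L2_on_zero)
  have "abs_L2 (\<lambda>x::'a. 0) = 0" by (simp add: zero_L2.abs_eq)
  then have "close_test 0 (\<lambda>x. 0) \<epsilon>" if "\<epsilon> > 0" for \<epsilon>
    using that by (simp add: close_test_def test_functions_zero w)
  then show ?thesis using h w by (auto simp: dom_A_def H2_def H10_iff)
qed

lemma eigenspace_zero: "0 \<in> eigenspace \<Omega> \<mu>"
  using dom_A_zero op_A_scaleC[OF dom_A_zero, of 0] by (simp add: eigenspace_def scaleC_zero_left)

lemma eigenspace_L2_on: "u \<in> eigenspace \<Omega> \<mu> \<Longrightarrow> u \<in> L2_on \<Omega>"
  by (simp add: eigenspace_def dom_A_def H10_def H1_def)

text \<open>Symmetry of the Dirichlet form lets either eigenvalue be pulled out of the same number;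
  both are real, so conjugation does not affect them.\<close>

lemma eigenspace_orthogonal:
  assumes "u \<in> eigenspace \<Omega> \<mu>" "v \<in> eigenspace \<Omega> \<nu>" "\<mu> \<noteq> \<nu>"
  shows "cinner u v = 0"
proof -
  have d: "u \<in> dom_A \<Omega>" "v \<in> dom_A \<Omega>" using assms by (auto simp: eigenspace_def)
  have "\<mu> * cinner u v = cinner (op_A \<Omega> u) v"
    using assms by (simp add: eigenspace_def cinner_scaleR_left)
  also have "\<dots> = cnj (cinner (op_A \<Omega> v) u)"
    unfolding cinner_op_A[OF d] cinner_op_A[OF d(2,1)] by (simp flip: cinner_commute)
  also have "\<dots> = \<nu> * cinner u v"
    using assms by (simp add: eigenspace_def cinner_scaleR_left flip: cinner_commute)
  finally show ?thesis using assms(3) by simp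
qed

text \<open>The derivative of x_i |\<phi>|^2 in direction i integrates to zero, which expresses the
  squared norm of \<phi> through x_i \<phi> and the derivative of \<phi>. Since |x_i| \<le> R on the
  domain, Cauchy-Schwarz gives the constant 2 R.\<close>

lemma poincare_test_function:
  assumes phi: "\<phi> \<in> test_functions \<Omega>" and i: "i \<in> Basis" and R: "\<And>x. x \<in> \<Omega> \<Longrightarrow> norm x \<le> R"
  shows "norm (abs_L2 \<phi>) \<le> 2 * R * norm (abs_L2 (pderiv_at i \<phi>))"
proof (cases "norm (abs_L2 \<phi>) = 0")
  case True
  show ?thesis
  \<comment> \<open>Over the empty set R is unconstrained and may be negative; then the derivative
    is zero and so is the right-hand side.\<close>
  proof (cases "\<Omega> = {}")
    case True
    then have "pderiv_at i \<phi> = (\<lambda>x. 0)"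
      using test_functions_pderiv[OF phi i] by (auto elim!: test_functionsE)
    then show ?thesis using \<open>norm (abs_L2 \<phi>) = 0\<close> by (simp flip: zero_L2.abs_eq)
  next
    case False
    then have "R \<ge> 0" using R by (metis equals0I norm_ge_zero order_trans)
    then show ?thesis using True by simp
  qed
next
  case nz: False
  let ?X = "\<lambda>x. complex_of_real (x \<bullet> i)"
  let ?d = "pderiv_at i \<phi>"
  let ?\<psi> = "\<lambda>x. ?X x * \<phi> x"
  obtain K where K: "smooth_on UNIV \<phi>" "K \<subseteq> \<Omega>" "\<And>x. x \<notin> K \<Longrightarrow> \<phi> x = 0" using phi by (auto elim: test_functionsE)
  have X: "bounded_linear ?X" by (rule bounded_linear_compose[OF bounded_linear_of_real bounded_linear_inner_left])
  have chi: "?\<psi> \<in> test_functions \<Omega>" by (rule test_functions_mult[OF phi smooth_on_linear[OF X]])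
  have d: "?d \<in> test_functions \<Omega>" by (rule test_functions_pderiv[OF phi i])
  note sq = test_functions_square_int
  have sc: "smooth_on UNIV (\<lambda>x. cnj (\<phi> x))" by (rule smooth_on_bounded_linear[OF bounded_linear_cnj K(1)])
  have sX: "smooth_on UNIV ?\<psi>" by (rule smooth_on_mult[OF smooth_on_linear[OF X] K(1)])
  have dX: "pderiv_at i ?\<psi> = (\<lambda>x. ?X x * ?d x + \<phi> x)"
    unfolding pderiv_at_mult[OF smooth_on_linear[OF X] K(1)]
    using i pderiv_at_eqI[OF bounded_linear_imp_has_derivative[OF X], of i] by (simp add: fun_eq_iff inner_same_Basis)
  have g1: "0 = a + (b + c) \<Longrightarrow> c = - (a + b)" for a b c :: complex by algebra
  have g2: "Re (- (a + b)) \<le> cmod a + cmod b" for a b :: complex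
    by (rule order_trans[OF complex_Re_le_cmod]) (metis norm_minus_cancel norm_triangle_ineq)
  have "0 = (\<integral>x. pderiv_at i (\<lambda>x. ?\<psi> x * cnj (\<phi> x)) x \<partial>lborel)"
    using integral_pderiv_test_function[OF test_functions_mult[OF test_functions_cnj[OF phi] sX] i] by simp
  also have "\<dots> = (\<integral>x. ?\<psi> x * cnj (?d x) + (?d x * cnj (?\<psi> x) + \<phi> x * cnj (\<phi> x)) \<partial>lborel)"
    unfolding pderiv_at_mult[OF sX sc]
    unfolding fun_cong[OF pderiv_at_bounded_linear[OF bounded_linear_cnj K(1)]] fun_cong[OF dX]
    by (rule Bochner_Integration.integral_cong) (simp_all add: algebra_simps)
  also have "\<dots> = cinner (abs_L2 ?\<psi>) (abs_L2 ?d) + (cinner (abs_L2 ?d) (abs_L2 ?\<psi>) + cinner (abs_L2 \<phi>) (abs_L2 \<phi>))"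
    unfolding cinner_abs_L2[OF sq[OF chi] sq[OF d]] cinner_abs_L2[OF sq[OF d] sq[OF chi]] cinner_abs_L2[OF sq[OF phi] sq[OF phi]]
    by (simp only: Bochner_Integration.integral_add Bochner_Integration.integrable_add square_int_mult sq[OF chi] sq[OF d] sq[OF phi])
  finally have eq: "cinner (abs_L2 \<phi>) (abs_L2 \<phi>) = - (cinner (abs_L2 ?\<psi>) (abs_L2 ?d) + cinner (abs_L2 ?d) (abs_L2 ?\<psi>))"
    by (rule g1)
  have "(norm (abs_L2 \<phi>))\<^sup>2 \<le> cmod (cinner (abs_L2 ?\<psi>) (abs_L2 ?d)) + cmod (cinner (abs_L2 ?d) (abs_L2 ?\<psi>))"
    unfolding power2_norm_L2 eq by (rule g2)
  also have "\<dots> \<le> 2 * (norm (abs_L2 ?\<psi>) * norm (abs_L2 ?d))"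
    using cinner_Cauchy_Schwarz[of "abs_L2 ?\<psi>" "abs_L2 ?d"] cinner_Cauchy_Schwarz[of "abs_L2 ?d" "abs_L2 ?\<psi>"]
    by (simp add: mult.commute)
  finally have le: "(norm (abs_L2 \<phi>))\<^sup>2 \<le> 2 * (norm (abs_L2 ?\<psi>) * norm (abs_L2 ?d))" .
  have "norm (abs_L2 ?\<psi>) \<le> R * norm (abs_L2 \<phi>)"
  proof (rule power2_le_imp_le)
    have "\<Omega> \<noteq> {}"
    proof
      assume "\<Omega> = {}"
      then have "\<phi> = (\<lambda>x. 0)" using K(2,3) by auto
      then show False using nz by (simp flip: zero_L2.abs_eq)
    qed
    then have "R \<ge> 0" using R by (metis equals0I norm_ge_zero order_trans)
    then show "0 \<le> R * norm (abs_L2 \<phi>)" by simp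
    have "(\<integral>x. (cmod (?\<psi> x))\<^sup>2 \<partial>lborel) \<le> (\<integral>x. R\<^sup>2 * (cmod (\<phi> x))\<^sup>2 \<partial>lborel)"
    proof (rule integral_mono)
      show "integrable lborel (\<lambda>x. (cmod (?\<psi> x))\<^sup>2)" using sq[OF chi] by (simp add: square_int_def)
      show "integrable lborel (\<lambda>x. R\<^sup>2 * (cmod (\<phi> x))\<^sup>2)" using sq[OF phi] by (simp add: square_int_def)
      show "(cmod (?\<psi> x))\<^sup>2 \<le> R\<^sup>2 * (cmod (\<phi> x))\<^sup>2" for x
      proof (cases "x \<in> K")
        case True
        have "\<bar>x \<bullet> i\<bar> \<le> R" using Basis_le_norm[OF i, of x] R[of x] K(2) True by auto
        then have "(x \<bullet> i)\<^sup>2 \<le> R\<^sup>2" by (rule abs_le_square_iff[THEN iffD1, OF order_trans[OF _ abs_ge_self]])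
        then show ?thesis by (simp add: norm_mult power_mult_distrib mult_right_mono)
      qed (simp add: K)
    qed
    then show "(norm (abs_L2 ?\<psi>))\<^sup>2 \<le> (R * norm (abs_L2 \<phi>))\<^sup>2"
      unfolding norm_abs_L2[OF sq[OF chi]] power_mult_distrib norm_abs_L2[OF sq[OF phi]] by simp
  qed
  then have "norm (abs_L2 ?\<psi>) * norm (abs_L2 ?d) \<le> R * norm (abs_L2 \<phi>) * norm (abs_L2 ?d)"
    by (rule mult_right_mono) simp
  with le have "(norm (abs_L2 \<phi>))\<^sup>2 \<le> 2 * (R * norm (abs_L2 \<phi>) * norm (abs_L2 ?d))"
    by linarith
  then have "norm (abs_L2 \<phi>) * norm (abs_L2 \<phi>) \<le> (2 * R * norm (abs_L2 ?d)) * norm (abs_L2 \<phi>)"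
    by (simp add: power2_eq_square mult_ac)
  then show ?thesis using nz by (simp add: mult_le_cancel_right)
qed

lemma poincare:
  assumes u: "u \<in> H10 \<Omega>" and i: "i \<in> Basis" and R: "R \<ge> 0" "\<And>x. x \<in> \<Omega> \<Longrightarrow> norm x \<le> R"
  shows "norm u \<le> 2 * R * norm (wderiv \<Omega> i u)"
proof (rule field_le_epsilon)
  fix \<epsilon> :: real assume e: "\<epsilon> > 0"
  \<comment> \<open>The approximation error enters once through the function and with factor 2 R
    through the derivative.\<close>
  define \<eta> where "\<eta> = \<epsilon> / (1 + 2 * R)"
  have eta: "\<eta> > 0" "(1 + 2 * R) * \<eta> = \<epsilon>" using e R by (auto simp: \<eta>_def)
  obtain \<phi> where p: "close_test u \<phi> \<eta>" using u eta(1) unfolding H10_iff by blast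
  then have tf: "\<phi> \<in> test_functions \<Omega>" by (simp add: close_test_def)
  let ?d = "abs_L2 (pderiv_at i \<phi>)"
  have 1: "norm u \<le> norm (u - abs_L2 \<phi>) + norm (abs_L2 \<phi>)"
    using norm_triangle_ineq[of "u - abs_L2 \<phi>" "abs_L2 \<phi>"] by simp
  have 2: "norm (u - abs_L2 \<phi>) < \<eta>" "norm (wderiv \<Omega> i u - ?d) < \<eta>"
    using p i by (auto simp: close_test_def)
  have "norm ?d \<le> norm (wderiv \<Omega> i u) + norm (wderiv \<Omega> i u - ?d)"
    using norm_triangle_ineq4[of "wderiv \<Omega> i u" "wderiv \<Omega> i u - ?d"] by simp
  then have "norm ?d \<le> norm (wderiv \<Omega> i u) + \<eta>" using 2 by linarith
  then have 3: "2 * R * norm ?d \<le> 2 * R * (norm (wderiv \<Omega> i u) + \<eta>)"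
    using R(1) by (intro mult_left_mono) auto
  have 4: "norm (abs_L2 \<phi>) \<le> 2 * R * norm ?d" by (rule poincare_test_function[OF tf i R(2)])
  have "norm u \<le> \<eta> + 2 * R * (norm (wderiv \<Omega> i u) + \<eta>)" using 1 2(1) 3 4 by linarith
  also have "\<dots> = 2 * R * norm (wderiv \<Omega> i u) + (1 + 2 * R) * \<eta>" by (simp add: algebra_simps)
  finally show "norm u \<le> 2 * R * norm (wderiv \<Omega> i u) + \<epsilon>" using eta(2) by simp
qed

text \<open>The Rayleigh quotient of an eigenvector controls one partial derivative, so the Poincare
  inequality in a single direction gives the bound 1 / (2 R)^2.\<close>

lemma eigenvalues_bounded_below:
  obtains c where "c > 0" "\<And>\<mu>. \<mu> \<in> eigenvalues \<Omega> \<Longrightarrow> c \<le> \<mu>"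
proof -
  obtain R where R: "R > 0" "\<And>x. x \<in> \<Omega> \<Longrightarrow> norm x \<le> R" using bounded_Omega by (auto simp: bounded_pos)
  have "1 / (2 * R)\<^sup>2 \<le> \<mu>" if "\<mu> \<in> eigenvalues \<Omega>" for \<mu>
  proof -
    have "eigenspace \<Omega> \<mu> \<noteq> {0}" using that by (simp add: eigenvalues_def)
    with eigenspace_zero[of \<mu>] have "\<exists>u\<in>eigenspace \<Omega> \<mu>. u \<noteq> 0" by auto
    then obtain u where u: "u \<in> eigenspace \<Omega> \<mu>" "u \<noteq> 0" by auto
    obtain i :: 'a where i: "i \<in> Basis" using SOME_Basis by metis
    have d: "u \<in> dom_A \<Omega>" "op_A \<Omega> u = \<mu> *\<^sub>R u" using u by (auto simp: eigenspace_def)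
    have "\<mu> * (norm u)\<^sup>2 = Re (cinner (op_A \<Omega> u) u)" by (simp add: d(2) cinner_scaleR_left power2_norm_L2)
    also have "\<dots> = (\<Sum>i\<in>Basis. (norm (wderiv \<Omega> i u))\<^sup>2)"
      unfolding cinner_op_A[OF d(1) d(1)] by (simp add: power2_norm_L2)
    finally have "\<mu> * (norm u)\<^sup>2 = (\<Sum>i\<in>Basis. (norm (wderiv \<Omega> i u))\<^sup>2)" .
    moreover have "(norm (wderiv \<Omega> i u))\<^sup>2 \<le> (\<Sum>i\<in>Basis. (norm (wderiv \<Omega> i u))\<^sup>2)"
      using i by (intro member_le_sum) auto
    ultimately have 1: "(norm (wderiv \<Omega> i u))\<^sup>2 \<le> \<mu> * (norm u)\<^sup>2" by simp
    have "u \<in> H10 \<Omega>" using d by (simp add: dom_A_def)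
    then have "norm u \<le> 2 * R * norm (wderiv \<Omega> i u)" using R(1) by (intro poincare[OF _ i _ R(2)]) auto
    then have "(norm u)\<^sup>2 \<le> (2 * R)\<^sup>2 * (norm (wderiv \<Omega> i u))\<^sup>2"
      unfolding power_mult_distrib[symmetric] by (rule power_mono) simp
    also have "\<dots> \<le> (2 * R)\<^sup>2 * (\<mu> * (norm u)\<^sup>2)" using 1 by (intro mult_left_mono) auto
    finally have "1 * (norm u)\<^sup>2 \<le> ((2 * R)\<^sup>2 * \<mu>) * (norm u)\<^sup>2" by (simp add: mult.assoc)
    then have "1 \<le> (2 * R)\<^sup>2 * \<mu>" using u(2) by (subst (asm) mult_le_cancel_right) auto
    then show ?thesis using R by (simp add: divide_le_eq mult.commute)
  qed
  with R(1) show ?thesis by (intro that[of "1 / (2 * R)\<^sup>2"]) auto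
qed

end

section \<open>Completeness of the space of square-integrable functions\<close>

lemma square_int_norm_integral:
  assumes "square_int f"
  shows "(\<integral>\<^sup>+x. ennreal ((cmod (f x))\<^sup>2) \<partial>lborel) = ennreal ((norm (abs_L2 f))\<^sup>2)"
  unfolding norm_abs_L2[OF assms] using assms
  by (intro nn_integral_eq_integral) (auto simp: square_int_def)

lemma abs_L2_diff:
  assumes "square_int f" "square_int g"
  shows "square_int (\<lambda>x. f x - g x)" "abs_L2 (\<lambda>x. f x - g x) = abs_L2 f - abs_L2 g"
proof -
  have e: "(\<lambda>x. f x - g x) = (\<lambda>x. f x + (-1) * g x)" by simp
  show "square_int (\<lambda>x. f x - g x)"
    unfolding e by (intro square_int_add square_int_scale assms)
  show "abs_L2 (\<lambda>x. f x - g x) = abs_L2 f - abs_L2 g"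
    unfolding e minus_L2_def uminus_L2_def using assms
    by (simp only: plus_L2.abs_eq scaleC_L2.abs_eq ae_eq_refl square_int_scale)
qed

lemma Cauchy_fast_subseq:
  fixes X :: "nat \<Rightarrow> 'a::metric_space"
  assumes "Cauchy X" and e: "\<And>k. e k > (0::real)"
  obtains r where "strict_mono (r::nat \<Rightarrow> nat)" "\<And>k. dist (X (r (Suc k))) (X (r k)) < e k"
proof -
  have "\<exists>N. \<forall>m\<ge>N. \<forall>n\<ge>N. dist (X m) (X n) < e k" for k
    using assms unfolding Cauchy_def by blast
  then obtain N where N: "\<And>k m n. m \<ge> N k \<Longrightarrow> n \<ge> N k \<Longrightarrow> dist (X m) (X n) < e k" by metis
  \<comment> \<open>Adding k and all thresholds up to \<open>N k\<close> makes the sequence strictly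
    increasing and large enough at once.\<close>
  define r where "r k = k + (\<Sum>j\<le>k. N j)" for k
  have "N k \<le> r k" "r k < r (Suc k)" for k by (auto simp: r_def intro: le_add2 order_trans[OF member_le_sum[of k "{..k}" N]])
  then show ?thesis using N
    by (intro that[of r]) (auto simp: strict_mono_Suc_iff intro!: N intro: order_trans[OF _ less_imp_le])
qed

text \<open>The weight $2^k$ allows Riesz--Fischer to be run with Tonelli instead of Minkowski.\<close>

lemma summable_of_weighted_squares:
  fixes a :: "nat \<Rightarrow> complex"
  assumes "summable (\<lambda>k. 2 ^ k * (cmod (a k))\<^sup>2)"
  shows "summable a"
proof (rule summable_norm_cancel, rule summable_comparison_test)
  show "summable (\<lambda>k. 2 ^ k * (cmod (a k))\<^sup>2 + (1/2) ^ k)"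
    by (intro summable_add assms) auto
  have "cmod (a k) \<le> 2 ^ k * (cmod (a k))\<^sup>2 + (1/2) ^ k" for k
  proof -
    have "0 \<le> (2 ^ k * cmod (a k) - 1)\<^sup>2" by simp
    also have "\<dots> = 2 ^ k * (2 ^ k * (cmod (a k))\<^sup>2 + (1/2) ^ k - 2 * cmod (a k))"
      by (simp add: power2_eq_square algebra_simps power_one_over)
    finally have "(2::real) ^ k * 0 \<le> 2 ^ k * (2 ^ k * (cmod (a k))\<^sup>2 + (1/2) ^ k - 2 * cmod (a k))"
      by (simp only: mult_zero_right)
    then have "0 \<le> 2 ^ k * (cmod (a k))\<^sup>2 + (1/2) ^ k - 2 * cmod (a k)"
      by (rule mult_left_le_imp_le) simp
    then show ?thesis using norm_ge_zero[of "a k"] by linarith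
  qed
  then show "\<exists>N. \<forall>n\<ge>N. norm (norm (a n)) \<le> 2 ^ n * (cmod (a n))\<^sup>2 + (1/2) ^ n" by auto
qed

text \<open>Riesz-Fischer: a fast subsequence of representatives converges almost everywhere, and
  Fatou's lemma shows that the pointwise limit is the limit in norm. Completeness is what lets
  spectral families with square-summable norms define functions.\<close>

instance L2 :: (euclidean_space) complete_space
proof
  fix X :: "nat \<Rightarrow> 'a L2"
  assume X: "Cauchy X"
  have "(1/2) ^ k > (0::real)" for k by simp
  then obtain r :: "nat \<Rightarrow> nat" where r: "strict_mono r" "\<And>k. dist (X (r (Suc k))) (X (r k)) < (1/2) ^ k"
    using Cauchy_fast_subseq[OF X, of "\<lambda>k. (1/2) ^ k"] by blast
  have "\<forall>k. \<exists>f. X (r k) = abs_L2 f \<and> square_int f" by (metis L2_cases)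
  then obtain f where f: "\<And>k. X (r k) = abs_L2 (f k)" "\<And>k. square_int (f k)" by metis
  have fm[measurable]: "f k \<in> borel_measurable lborel" for k using f(2) by (simp add: square_int_def)
  let ?d = "\<lambda>k x. f (Suc k) x - f k x"
  let ?h = "\<lambda>k x. ennreal (2 ^ k * (cmod (?d k x))\<^sup>2)"
  \<comment> \<open>The increments have norm below 2^(-k), so the weighted squares have integral at
    most 2^k 4^(-k), which is summable.\<close>
  have hint: "(\<integral>\<^sup>+x. ?h k x \<partial>lborel) \<le> ennreal ((1/2) ^ k)" for k
  proof -
    have "(\<integral>\<^sup>+x. ?h k x \<partial>lborel) = ennreal (2 ^ k) * (\<integral>\<^sup>+x. ennreal ((cmod (?d k x))\<^sup>2) \<partial>lborel)"
      by (simp add: ennreal_mult nn_integral_cmult)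
    also have "\<dots> = ennreal (2 ^ k * (norm (X (r (Suc k)) - X (r k)))\<^sup>2)"
      by (simp add: square_int_norm_integral abs_L2_diff f ennreal_mult)
    also have "\<dots> \<le> ennreal (2 ^ k * ((1/2) ^ k)\<^sup>2)"
      using r(2)[of k] by (intro ennreal_leI mult_left_mono power_mono) (auto simp: dist_norm)
    also have "2 ^ k * ((1/2) ^ k)\<^sup>2 = (1/2 :: real) ^ k"
      by (simp add: power2_eq_square power_one_over)
    finally show ?thesis .
  qed
  have "(\<integral>\<^sup>+x. (\<Sum>k. ?h k x) \<partial>lborel) = (\<Sum>k. \<integral>\<^sup>+x. ?h k x \<partial>lborel)"
    by (intro nn_integral_suminf) measurable
  also have "\<dots> \<le> (\<Sum>k. ennreal ((1/2) ^ k))" by (intro suminf_le hint) auto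
  also have "\<dots> = ennreal (\<Sum>k. (1/2) ^ k)" by (intro suminf_ennreal2) auto
  also have "\<dots> < \<infinity>" by simp
  finally have fin: "(\<integral>\<^sup>+x. (\<Sum>k. ?h k x) \<partial>lborel) \<noteq> \<infinity>" by simp
  have ae: "AE x in lborel. (\<Sum>k. ?h k x) \<noteq> \<infinity>"
    by (rule nn_integral_PInf_AE[OF _ fin]) measurable
  \<comment> \<open>On the null set where the sequence diverges \<open>lim\<close> is an unspecified
    value; g is measurable all the same.\<close>
  define g where "g x = lim (\<lambda>n. f n x)" for x
  have gm[measurable]: "g \<in> borel_measurable lborel"
    unfolding g_def by (rule borel_measurable_lim_metric) measurable
  have lim: "AE x in lborel. (\<lambda>n. f n x) \<longlonglongrightarrow> g x"
    using ae
  proof eventually_elim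
    case (elim x)
    then have "summable (\<lambda>k. ?d k x)"
      by (intro summable_of_weighted_squares summable_suminf_not_top) auto
    then have "(\<lambda>n. f 0 x + (\<Sum>k<n. ?d k x)) \<longlonglongrightarrow> f 0 x + (\<Sum>k. ?d k x)"
      by (intro tendsto_add tendsto_const summable_LIMSEQ)
    also have "(\<lambda>n. f 0 x + (\<Sum>k<n. ?d k x)) = (\<lambda>n. f n x)"
      unfolding sum_lessThan_telescope[of "\<lambda>n. f n x"] by simp
    finally have "convergent (\<lambda>n. f n x)" by (auto simp: convergent_def)
    then show ?case by (simp add: g_def convergent_LIMSEQ_iff)
  qed
  \<comment> \<open>Fatou's lemma with m fixed and n tending to infinity, used once for the
    square-integrability of g and once for the convergence.\<close>
  have key: "square_int (\<lambda>x. g x - f m x) \<and> norm (abs_L2 (\<lambda>x. g x - f m x)) \<le> \<epsilon>"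
    if e: "\<epsilon> > 0" and N: "\<And>n. n \<ge> N \<Longrightarrow> norm (X (r n) - X (r m)) \<le> \<epsilon>" for m N \<epsilon>
  proof -
    have "(\<integral>\<^sup>+x. ennreal ((cmod (g x - f m x))\<^sup>2) \<partial>lborel)
      \<le> (\<integral>\<^sup>+x. liminf (\<lambda>n. ennreal ((cmod (f n x - f m x))\<^sup>2)) \<partial>lborel)"
    proof (rule nn_integral_mono_AE)
      show "AE x in lborel. ennreal ((cmod (g x - f m x))\<^sup>2) \<le> liminf (\<lambda>n. ennreal ((cmod (f n x - f m x))\<^sup>2))"
        using lim
      proof eventually_elim
        case (elim x)
        then have "(\<lambda>n. ennreal ((cmod (f n x - f m x))\<^sup>2)) \<longlonglongrightarrow> ennreal ((cmod (g x - f m x))\<^sup>2)"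
          by (intro tendsto_intros)
        from lim_imp_Liminf[OF sequentially_bot this] show ?case by simp
      qed
    qed
    also have "\<dots> \<le> liminf (\<lambda>n. \<integral>\<^sup>+x. ennreal ((cmod (f n x - f m x))\<^sup>2) \<partial>lborel)"
      by (rule nn_integral_liminf) measurable
    also have "\<dots> = liminf (\<lambda>n. ennreal ((norm (X (r n) - X (r m)))\<^sup>2))"
      by (simp add: square_int_norm_integral abs_L2_diff f)
    also have "\<dots> \<le> liminf (\<lambda>n. ennreal (\<epsilon>\<^sup>2))"
      using N by (intro Liminf_mono) (auto simp: eventually_sequentially intro!: exI[of _ N] ennreal_leI power_mono)
    also have "\<dots> = ennreal (\<epsilon>\<^sup>2)" by (simp add: Liminf_const)
    finally have le: "(\<integral>\<^sup>+x. ennreal ((cmod (g x - f m x))\<^sup>2) \<partial>lborel) \<le> ennreal (\<epsilon>\<^sup>2)" .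
    have "integrable lborel (\<lambda>x. (cmod (g x - f m x))\<^sup>2)"
    proof (rule integrableI_bounded)
      show "(\<integral>\<^sup>+x. ennreal (norm ((cmod (g x - f m x))\<^sup>2)) \<partial>lborel) < \<infinity>"
        using le by (simp add: le_less_trans)
    qed measurable
    then have sq: "square_int (\<lambda>x. g x - f m x)" by (simp add: square_int_def)
    have "(norm (abs_L2 (\<lambda>x. g x - f m x)))\<^sup>2 \<le> \<epsilon>\<^sup>2"
      using le e unfolding square_int_norm_integral[OF sq] by (simp add: ennreal_le_iff)
    then show ?thesis using sq e by (simp add: power2_le_iff_abs_le abs_le_square_iff[symmetric])
  qed
  have Cr: "\<exists>N. \<forall>m\<ge>N. \<forall>n\<ge>N. norm (X (r n) - X (r m)) \<le> \<epsilon>" if "\<epsilon> > 0" for \<epsilon>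
    using Cauchy_subseq_Cauchy[OF X r(1)] that unfolding Cauchy_def dist_norm o_def by (meson less_imp_le)
  have g: "square_int g"
  proof -
    obtain N where "\<forall>m\<ge>N. \<forall>n\<ge>N. norm (X (r n) - X (r m)) \<le> 1" using Cr[of 1] by auto
    then have "square_int (\<lambda>x. g x - f N x)" using key[of 1 N N] by auto
    from square_int_add[OF this f(2)[of N]] show ?thesis by simp
  qed
  have "(X \<circ> r) \<longlonglongrightarrow> abs_L2 g"
  proof (rule LIMSEQ_I)
    fix \<epsilon> :: real assume "\<epsilon> > 0"
    then obtain N where N: "\<forall>m\<ge>N. \<forall>n\<ge>N. norm (X (r n) - X (r m)) \<le> \<epsilon>/2" using Cr[of "\<epsilon>/2"] by auto
    have "norm ((X \<circ> r) m - abs_L2 g) < \<epsilon>" if "m \<ge> N" for m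
    proof -
      have "norm (abs_L2 (\<lambda>x. g x - f m x)) \<le> \<epsilon>/2" using key[of "\<epsilon>/2" N m] N that \<open>\<epsilon> > 0\<close> by auto
      then show ?thesis using \<open>\<epsilon> > 0\<close> by (simp add: abs_L2_diff g f norm_minus_commute)
    qed
    then show "\<exists>N. \<forall>n\<ge>N. norm ((X \<circ> r) n - abs_L2 g) < \<epsilon>" by blast
  qed
  then show "convergent X"
    using Cauchy_converges_subseq[OF X r(1)] by (auto simp: convergent_def)
qed

text \<open>By Pythagoras the squared distance between nested finite sums is a difference of sums of
  squares, so convergence of the squares makes the net of finite sums a Cauchy filter.\<close>

lemma orthogonal_summable_on:
  fixes x :: "'i \<Rightarrow> 'v::{real_inner,complete_space}"
  assumes orth: "pairwise (\<lambda>i j. orthogonal (x i) (x j)) I" and sq: "(\<lambda>i. (norm (x i))\<^sup>2) summable_on I"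
  shows "x summable_on I"
proof -
  let ?F = "finite_subsets_at_top I"
  have pyth: "(norm (sum x X))\<^sup>2 = (\<Sum>i\<in>X. (norm (x i))\<^sup>2)" if "finite X" "X \<subseteq> I" for X
    using that orth by (intro norm_sum_Pythagorean) (auto intro: pairwise_subset)
  obtain S where "((\<lambda>i. (norm (x i))\<^sup>2) has_sum S) I" using sq by (auto simp: summable_on_def)
  then have S: "(sum (\<lambda>i. (norm (x i))\<^sup>2) \<longlongrightarrow> S) ?F" by (simp add: has_sum_def)
  have "\<exists>P. eventually P ?F \<and> (\<forall>X Y. P X \<and> P Y \<longrightarrow> dist (sum x X) (sum x Y) < e)" if e: "e > 0" for e
  proof -
    \<comment> \<open>Two sums of squares within e^2/8 of S differ by less than e^2/4 = (e/2)^2, and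
      the comparison through the common set F doubles e/2.\<close>
    have "eventually (\<lambda>X. dist (\<Sum>i\<in>X. (norm (x i))\<^sup>2) S < e\<^sup>2 / 8) ?F"
      using S e by (intro tendstoD) auto
    then obtain F where F: "finite F" "F \<subseteq> I"
      and F2: "\<And>X. finite X \<Longrightarrow> F \<subseteq> X \<Longrightarrow> X \<subseteq> I \<Longrightarrow> dist (\<Sum>i\<in>X. (norm (x i))\<^sup>2) S < e\<^sup>2 / 8"
      unfolding eventually_finite_subsets_at_top by metis
    have near: "dist (sum x X) (sum x F) < e / 2" if X: "finite X" "F \<subseteq> X" "X \<subseteq> I" for X
    proof -
      have "sum x X - sum x F = sum x (X - F)" using X by (simp add: sum_diff)
      then have "(dist (sum x X) (sum x F))\<^sup>2 = (\<Sum>i\<in>X - F. (norm (x i))\<^sup>2)"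
        using pyth[of "X - F"] X by (simp add: dist_norm subset_iff)
      also have "\<dots> = (\<Sum>i\<in>X. (norm (x i))\<^sup>2) - (\<Sum>i\<in>F. (norm (x i))\<^sup>2)" using X by (simp add: sum_diff)
      also have "\<dots> < e\<^sup>2 / 4"
      proof -
        have *: "a - b < d / 4" if "dist a S < d / 8" "dist b S < d / 8" for a b d :: real
          using that unfolding dist_real_def by arith
        show ?thesis by (rule *[OF F2[OF X] F2[OF F(1) subset_refl F(2)]])
      qed
      also have "e\<^sup>2 / 4 = (e / 2)\<^sup>2" by (simp add: power_divide)
      finally show ?thesis by (rule power_less_imp_less_base) (use e in simp)
    qed
    show ?thesis
    proof (intro exI conjI allI impI)
      show "eventually (\<lambda>X. finite X \<and> F \<subseteq> X \<and> X \<subseteq> I) ?F"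
        using F unfolding eventually_finite_subsets_at_top by (intro exI[of _ F]) auto
      fix X Y assume "(finite X \<and> F \<subseteq> X \<and> X \<subseteq> I) \<and> (finite Y \<and> F \<subseteq> Y \<and> Y \<subseteq> I)"
      then have "dist (sum x X) (sum x F) < e / 2" "dist (sum x Y) (sum x F) < e / 2" using near by auto
      then show "dist (sum x X) (sum x Y) < e" by (rule dist_triangle_half_l)
    qed
  qed
  then have "cauchy_filter (filtermap (sum x) ?F)" by (simp add: cauchy_filter_metric_filtermap)
  moreover have "complete (UNIV::'v set)" by (meson Cauchy_convergent UNIV_I complete_def convergent_def)
  ultimately obtain L where "filtermap (sum x) ?F \<le> nhds L"
    using cauchy_filter_complete_converges[of "filtermap (sum x) ?F" UNIV] by (auto simp: filtermap_bot_iff)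
  then have "(sum x \<longlongrightarrow> L) ?F" by (simp add: filterlim_def)
  then show ?thesis using summable_on_def has_sum_def by blast
qed

lemma orthogonal_has_sum_norm:
  fixes x :: "'i \<Rightarrow> 'v::real_inner"
  assumes orth: "pairwise (\<lambda>i j. orthogonal (x i) (x j)) I" and "(x has_sum u) I"
  shows "((\<lambda>i. (norm (x i))\<^sup>2) has_sum (norm u)\<^sup>2) I"
proof -
  have "((\<lambda>X. (norm (sum x X))\<^sup>2) \<longlongrightarrow> (norm u)\<^sup>2) (finite_subsets_at_top I)"
    using assms(2) unfolding has_sum_def by (intro tendsto_intros)
  moreover have "\<forall>\<^sub>F X in finite_subsets_at_top I. (norm (sum x X))\<^sup>2 = (\<Sum>i\<in>X. (norm (x i))\<^sup>2)"
    using orth by (intro eventually_finite_subsets_at_top_weakI norm_sum_Pythagorean) (auto intro: pairwise_subset)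
  ultimately show ?thesis unfolding has_sum_def by (rule Lim_transform_eventually)
qed

section \<open>Eigenfunction expansions\<close>

lemma integral_outside_le:
  assumes f: "square_int f" and v: "v \<in> L2_on \<Omega>"
  shows "(\<integral>x. (cmod (f x))\<^sup>2 * indicator (-\<Omega>) x \<partial>lborel) \<le> (norm (abs_L2 f - v))\<^sup>2"
proof -
  obtain g where g: "v = abs_L2 g" "square_int g" by (rule L2_cases)
  note d = abs_L2_diff[OF f g(2)]
  have ae: "AE x in lborel. x \<notin> \<Omega> \<longrightarrow> g x = 0"
    using v g by (simp add: L2_on_def vanishes_outside.abs_eq ae_eq_refl)
  have "(\<integral>x. (cmod (f x))\<^sup>2 * indicator (-\<Omega>) x \<partial>lborel) \<le> (\<integral>x. (cmod (f x - g x))\<^sup>2 \<partial>lborel)"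
  proof (rule integral_mono_AE')
    show "integrable lborel (\<lambda>x. (cmod (f x - g x))\<^sup>2)" using d(1) by (simp add: square_int_def)
    show "AE x in lborel. (cmod (f x))\<^sup>2 * indicator (-\<Omega>) x \<le> (cmod (f x - g x))\<^sup>2"
      using ae by eventually_elim (auto simp: indicator_def)
  qed auto
  then show ?thesis unfolding g norm_abs_L2[OF d(1), unfolded d(2)] .
qed

text \<open>The mass of the limit outside the set is at most its squared distance to any finite
  partial sum, which is arbitrarily small; the subspace is closed.\<close>

lemma L2_on_has_sum:
  fixes x :: "'i \<Rightarrow> 'a::euclidean_space L2"
  assumes "open \<Omega>" "(x has_sum u) I" "\<And>i. i \<in> I \<Longrightarrow> x i \<in> L2_on \<Omega>"
  shows "u \<in> L2_on \<Omega>"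
proof -
  obtain f where f: "u = abs_L2 f" "square_int f" by (rule L2_cases)
  let ?J = "\<integral>x. (cmod (f x))\<^sup>2 * indicator (-\<Omega>) x \<partial>lborel"
  have meas: "-\<Omega> \<in> sets lborel" using assms(1) by auto
  have int: "integrable lborel (\<lambda>x. (cmod (f x))\<^sup>2 * indicator (-\<Omega>) x)"
    by (rule integrable_real_mult_indicator[OF meas]) (use f in \<open>simp add: square_int_def\<close>)
  have "?J \<le> 0 + e" if e: "e > 0" for e
  proof -
    from e have "sqrt e > 0" by simp
    then obtain F where F: "finite F" "F \<subseteq> I" "dist (sum x F) u \<le> sqrt e"
      using has_sum_finite_approximation[OF assms(2)] by metis
    have "?J \<le> (norm (u - sum x F))\<^sup>2"
      unfolding f(1) using F assms(3) by (intro integral_outside_le f(2) L2_on_sum) auto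
    also have "\<dots> \<le> (sqrt e)\<^sup>2"
      using F(3) by (intro power_mono) (auto simp: dist_norm norm_minus_commute)
    finally show ?thesis using e by simp
  qed
  then have "?J \<le> 0" by (rule field_le_epsilon)
  moreover have "?J \<ge> 0" by (intro Bochner_Integration.integral_nonneg) auto
  ultimately have "?J = 0" by simp
  then have "AE x in lborel. (cmod (f x))\<^sup>2 * indicator (-\<Omega>) x = 0"
    by (subst (asm) integral_nonneg_eq_0_iff_AE[OF int]) auto
  then have "AE x in lborel. x \<notin> \<Omega> \<longrightarrow> f x = 0" by eventually_elim (auto simp: indicator_def)
  then show ?thesis using f by (simp add: L2_on_def vanishes_outside.abs_eq ae_eq_refl)
qed

context dirichlet_domain
begin

abbreviation eigenfamily :: "(real \<Rightarrow> 'a L2) \<Rightarrow> bool" where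
  "eigenfamily x \<equiv> \<forall>\<mu>. x \<mu> \<in> eigenspace \<Omega> \<mu>"

lemma eigenspace_scaleR: "u \<in> eigenspace \<Omega> \<mu> \<Longrightarrow> r *\<^sub>R u \<in> eigenspace \<Omega> \<mu>"
  using eigenspace_scaleC[of u \<mu> "complex_of_real r"] by (simp add: scaleC_of_real)

lemma eigenspace_diff: "u \<in> eigenspace \<Omega> \<mu> \<Longrightarrow> v \<in> eigenspace \<Omega> \<mu> \<Longrightarrow> u - v \<in> eigenspace \<Omega> \<mu>"
  using eigenspace_add[of u \<mu> "(-1) *\<^sub>R v"] eigenspace_scaleR[of v \<mu> "-1"] by simp

lemma eigenspace_uminus: "v \<in> eigenspace \<Omega> \<mu> \<Longrightarrow> - v \<in> eigenspace \<Omega> \<mu>"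
  using eigenspace_scaleR[of v \<mu> "-1"] by simp

lemma eigenspace_sum: "(\<And>i. i \<in> I \<Longrightarrow> f i \<in> eigenspace \<Omega> \<mu>) \<Longrightarrow> (\<Sum>i\<in>I. f i) \<in> eigenspace \<Omega> \<mu>"
  by (induction I rule: infinite_finite_induct) (auto intro: eigenspace_zero eigenspace_add)

lemma eigenspace_trivial: "\<mu> \<notin> eigenvalues \<Omega> \<Longrightarrow> x \<in> eigenspace \<Omega> \<mu> \<Longrightarrow> x = 0"
  by (simp add: eigenvalues_def)

lemma eigenvalue_pos: "\<mu> \<in> eigenvalues \<Omega> \<Longrightarrow> \<mu> > 0"
  by (rule eigenvalues_bounded_below) (metis less_le_trans)

lemma eigenfamily_orthogonal:
  "eigenfamily x \<Longrightarrow> pairwise (\<lambda>\<mu> \<nu>. orthogonal (x \<mu>) (x \<nu>)) (eigenvalues \<Omega>)"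
  unfolding pairwise_def orthogonal_def inner_L2_def using eigenspace_orthogonal by fastforce

text \<open>Pairing with e is continuous, and orthogonality of the eigenspaces leaves the single
  term at \<mu>.\<close>

lemma expansion_cinner:
  assumes "is_expansion \<Omega> u x" "e \<in> eigenspace \<Omega> \<mu>"
  shows "cinner u e = cinner (x \<mu>) e"
proof (cases "\<mu> \<in> eigenvalues \<Omega>")
  case False
  then have "e = 0" using assms(2) eigenspace_trivial by blast
  then show ?thesis by (simp add: cinner_zero_right)
next
  case True
  have x: "eigenfamily x" "(x has_sum u) (eigenvalues \<Omega>)" using assms(1) by (auto simp: is_expansion_def)
  have 1: "((\<lambda>\<nu>. cinner (x \<nu>) e) has_sum cinner u e) (eigenvalues \<Omega>)"
    using has_sum_bounded_linear[OF bounded_linear_cinner_left x(2)] by (simp add: o_def)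
  have 2: "((\<lambda>\<nu>. cinner (x \<nu>) e) has_sum (\<Sum>\<nu>\<in>{\<mu>}. cinner (x \<nu>) e)) (eigenvalues \<Omega>)"
    by (rule has_sum_finite_neutralI[where B="{\<mu>}"]) (use True x(1) assms(2) in \<open>auto intro: eigenspace_orthogonal[of _ _ e \<mu>]\<close>)
  show ?thesis using has_sum_unique[OF 1 2] by simp
qed

lemma eigenspace_eqI:
  assumes "x \<in> eigenspace \<Omega> \<mu>" "y \<in> eigenspace \<Omega> \<mu>" "\<And>e. e \<in> eigenspace \<Omega> \<mu> \<Longrightarrow> cinner x e = cinner y e"
  shows "x = y"
proof -
  have "cinner (x - y) (x - y) = 0"
    using assms(3)[OF eigenspace_diff[OF assms(1,2)]] by (simp add: cinner_diff_left)
  then have "x - y = 0" using cinner_self_eq_0[of "x - y"] by simp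
  then show ?thesis by simp
qed

text \<open>Two expansions of u have the same inner products with all eigenvectors, hence the same
  components. The definite description in \<open>components\<close> is thus evaluated by exhibiting
  any expansion.\<close>

lemma components_eqI:
  assumes "is_expansion \<Omega> u x"
  shows "components \<Omega> u = x"
  unfolding components_def
proof (rule the_equality)
  fix y assume y: "is_expansion \<Omega> u y"
  show "y = x"
  proof
    show "y \<mu> = x \<mu>" for \<mu>
      using expansion_cinner[OF y] expansion_cinner[OF assms] y assms
      by (intro eigenspace_eqI[of _ \<mu>]) (auto simp: is_expansion_def)
  qed
qed fact

lemma expansion_eq: "is_expansion \<Omega> u x \<Longrightarrow> is_expansion \<Omega> v x \<Longrightarrow> u = v"
  by (auto simp: is_expansion_def intro: has_sum_unique)

lemma expansion_synthesis:
  assumes "eigenfamily x" "(\<lambda>\<mu>. (norm (x \<mu>))\<^sup>2) summable_on eigenvalues \<Omega>"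
  shows "is_expansion \<Omega> (synthesis \<Omega> x) x"
  using orthogonal_summable_on[OF eigenfamily_orthogonal] assms
  by (simp add: is_expansion_def synthesis_def)

lemma synthesis_eqI: "is_expansion \<Omega> u x \<Longrightarrow> synthesis \<Omega> x = u"
  unfolding is_expansion_def synthesis_def by (auto intro: infsumI)

lemma expansion_norm:
  "is_expansion \<Omega> u x \<Longrightarrow> ((\<lambda>\<mu>. (norm (x \<mu>))\<^sup>2) has_sum (norm u)\<^sup>2) (eigenvalues \<Omega>)"
  by (rule orthogonal_has_sum_norm) (auto simp: is_expansion_def intro!: eigenfamily_orthogonal)

lemma expansion_L2_on: "is_expansion \<Omega> u x \<Longrightarrow> u \<in> L2_on \<Omega>"
  by (rule L2_on_has_sum[OF open_Omega, of x]) (auto simp: is_expansion_def intro: eigenspace_L2_on)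

lemma expansion_add: "is_expansion \<Omega> u x \<Longrightarrow> is_expansion \<Omega> v y \<Longrightarrow> is_expansion \<Omega> (u + v) (\<lambda>\<mu>. x \<mu> + y \<mu>)"
  by (auto simp: is_expansion_def intro: eigenspace_add has_sum_add)

lemma bounded_linear_scaleC: "bounded_linear (\<lambda>x :: 'b::euclidean_space L2. c *\<^sub>C x)"
  by (rule bounded_linear_intro[of _ "cmod c"])
    (simp_all add: scaleC_add_right scaleC_of_real[symmetric] scaleC_scaleC norm_scaleC mult.commute)

lemma expansion_scaleC: "is_expansion \<Omega> u x \<Longrightarrow> is_expansion \<Omega> (c *\<^sub>C u) (\<lambda>\<mu>. c *\<^sub>C x \<mu>)"
  using has_sum_bounded_linear[OF bounded_linear_scaleC]
  by (auto simp: is_expansion_def o_def intro: eigenspace_scaleC)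

text \<open>Uniqueness of expansions turns the existential witness in \<open>dom_pow\<close> into
  the canonical family \<open>components \<Omega> u\<close>.\<close>

lemma dom_pow_iff:
  "u \<in> dom_pow \<Omega> s \<longleftrightarrow> is_expansion \<Omega> u (components \<Omega> u) \<and>
     (\<lambda>\<mu>. (\<mu> powr s * norm (components \<Omega> u \<mu>))\<^sup>2) summable_on eigenvalues \<Omega>"
proof
  assume "u \<in> dom_pow \<Omega> s"
  then obtain x where x: "x \<in> scale_space \<Omega> s" "is_expansion \<Omega> u x" by (auto simp: dom_pow_def)
  then show "is_expansion \<Omega> u (components \<Omega> u) \<and>
     (\<lambda>\<mu>. (\<mu> powr s * norm (components \<Omega> u \<mu>))\<^sup>2) summable_on eigenvalues \<Omega>"
    using components_eqI[OF x(2)] by (simp add: scale_space_def)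
next
  assume "is_expansion \<Omega> u (components \<Omega> u) \<and>
     (\<lambda>\<mu>. (\<mu> powr s * norm (components \<Omega> u \<mu>))\<^sup>2) summable_on eigenvalues \<Omega>"
  then show "u \<in> dom_pow \<Omega> s"
    using expansion_L2_on by (auto simp: dom_pow_def scale_space_def is_expansion_def intro!: bexI[of _ "components \<Omega> u"])
qed

text \<open>The eigenvalues stay above some c > 0, so for s \<ge> 0 the weight \<mu>^s is at least
  c^s: a family in the domain of a nonnegative power sums to a function.\<close>

lemma summable_norm_of_weighted:
  assumes "s \<ge> 0" "(\<lambda>\<mu>. (\<mu> powr s * norm (x \<mu> :: 'b::real_normed_vector))\<^sup>2) summable_on eigenvalues \<Omega>"
  shows "(\<lambda>\<mu>. (norm (x \<mu>))\<^sup>2) summable_on eigenvalues \<Omega>"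
proof -
  obtain c where c: "c > 0" "\<And>\<mu>. \<mu> \<in> eigenvalues \<Omega> \<Longrightarrow> c \<le> \<mu>"
    by (rule eigenvalues_bounded_below) blast
  have "(\<lambda>\<mu>. (\<mu> powr s * norm (x \<mu>))\<^sup>2 * inverse ((c powr s)\<^sup>2)) summable_on eigenvalues \<Omega>"
    by (rule summable_on_cmult_left[OF assms(2)])
  then show ?thesis
  proof (rule summable_on_comparison_test)
    fix \<mu> assume "\<mu> \<in> eigenvalues \<Omega>"
    then have "c powr s \<le> \<mu> powr s" using c assms(1) by (intro powr_mono2) auto
    then have "c powr s * norm (x \<mu>) \<le> \<mu> powr s * norm (x \<mu>)" by (rule mult_right_mono) simp
    then have "(c powr s * norm (x \<mu>))\<^sup>2 \<le> (\<mu> powr s * norm (x \<mu>))\<^sup>2" by (rule power_mono) simp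
    then show "(norm (x \<mu>))\<^sup>2 \<le> (\<mu> powr s * norm (x \<mu>))\<^sup>2 * inverse ((c powr s)\<^sup>2)"
      using c(1) by (simp add: power_mult_distrib field_simps)
  qed auto
qed

lemma dom_pow_synthesis:
  assumes "eigenfamily x" "s \<ge> 0" "(\<lambda>\<mu>. (\<mu> powr s * norm (x \<mu>))\<^sup>2) summable_on eigenvalues \<Omega>"
  shows "synthesis \<Omega> x \<in> dom_pow \<Omega> s" "components \<Omega> (synthesis \<Omega> x) = x"
proof -
  have e: "is_expansion \<Omega> (synthesis \<Omega> x) x"
    by (rule expansion_synthesis[OF assms(1) summable_norm_of_weighted[OF assms(2,3)]])
  show c: "components \<Omega> (synthesis \<Omega> x) = x" by (rule components_eqI[OF e])
  show "synthesis \<Omega> x \<in> dom_pow \<Omega> s" unfolding dom_pow_iff c using e assms(3) by simp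
qed

lemma dom_pow_expansion: "u \<in> dom_pow \<Omega> s \<Longrightarrow> is_expansion \<Omega> u (components \<Omega> u)"
  by (simp add: dom_pow_iff)

lemma components_eigenspace: "u \<in> dom_pow \<Omega> s \<Longrightarrow> components \<Omega> u \<mu> \<in> eigenspace \<Omega> \<mu>"
  by (simp add: dom_pow_iff is_expansion_def)

lemma components_add: "u \<in> dom_pow \<Omega> s \<Longrightarrow> v \<in> dom_pow \<Omega> s \<Longrightarrow>
    components \<Omega> (u + v) = (\<lambda>\<mu>. components \<Omega> u \<mu> + components \<Omega> v \<mu>)"
  by (intro components_eqI expansion_add dom_pow_expansion)

lemma components_scaleC: "u \<in> dom_pow \<Omega> s \<Longrightarrow> components \<Omega> (c *\<^sub>C u) = (\<lambda>\<mu>. c *\<^sub>C components \<Omega> u \<mu>)"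
  by (intro components_eqI expansion_scaleC dom_pow_expansion)

lemma pow_A_expansion:
  assumes "u \<in> dom_pow \<Omega> s"
  shows "is_expansion \<Omega> (pow_A \<Omega> s u) (\<lambda>\<mu>. \<mu> powr s *\<^sub>R components \<Omega> u \<mu>)"
  unfolding pow_A_def pow_A_scale_def using assms
  by (intro expansion_synthesis) (auto simp: dom_pow_iff is_expansion_def intro: eigenspace_scaleR)

lemma pow_A_norm:
  assumes "u \<in> dom_pow \<Omega> s"
  shows "((\<lambda>\<mu>. (\<mu> powr s * norm (components \<Omega> u \<mu>))\<^sup>2) has_sum (norm (pow_A \<Omega> s u))\<^sup>2) (eigenvalues \<Omega>)"
  using expansion_norm[OF pow_A_expansion[OF assms]] by simp

lemma dom_pow_norm:
  assumes "u \<in> dom_pow \<Omega> s"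
  shows "((\<lambda>\<mu>. (norm (components \<Omega> u \<mu>))\<^sup>2) has_sum (norm u)\<^sup>2) (eigenvalues \<Omega>)"
  using expansion_norm[OF dom_pow_expansion[OF assms]] .

lemma dom_pow_add:
  assumes "u \<in> dom_pow \<Omega> s" "v \<in> dom_pow \<Omega> s"
  shows "u + v \<in> dom_pow \<Omega> s"
proof -
  let ?x = "components \<Omega> u" and ?y = "components \<Omega> v"
  have s: "(\<lambda>\<mu>. 2 * (\<mu> powr s * norm (?x \<mu>))\<^sup>2 + 2 * (\<mu> powr s * norm (?y \<mu>))\<^sup>2) summable_on eigenvalues \<Omega>"
    using assms by (intro summable_on_add summable_on_cmult_right) (auto simp: dom_pow_iff)
  have "(\<lambda>\<mu>. (\<mu> powr s * norm (?x \<mu> + ?y \<mu>))\<^sup>2) summable_on eigenvalues \<Omega>"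
  proof (rule summable_on_comparison_test[OF s])
    fix \<mu> assume "\<mu> \<in> eigenvalues \<Omega>"
    have "(\<mu> powr s * norm (?x \<mu> + ?y \<mu>))\<^sup>2 \<le> (\<mu> powr s * norm (?x \<mu>) + \<mu> powr s * norm (?y \<mu>))\<^sup>2"
      by (intro power_mono) (auto simp flip: distrib_left intro!: mult_left_mono norm_triangle_ineq)
    also have "\<dots> \<le> 2 * (\<mu> powr s * norm (?x \<mu>))\<^sup>2 + 2 * (\<mu> powr s * norm (?y \<mu>))\<^sup>2"
      using sum_squares_bound[of "\<mu> powr s * norm (?x \<mu>)" "\<mu> powr s * norm (?y \<mu>)"] by (simp add: power2_sum)
    finally show "(\<mu> powr s * norm (?x \<mu> + ?y \<mu>))\<^sup>2 \<le> 2 * (\<mu> powr s * norm (?x \<mu>))\<^sup>2 + 2 * (\<mu> powr s * norm (?y \<mu>))\<^sup>2" .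
  qed auto
  then show ?thesis
    unfolding dom_pow_iff components_add[OF assms]
    using expansion_add[OF dom_pow_expansion[OF assms(1)] dom_pow_expansion[OF assms(2)]] by simp
qed

lemma dom_pow_scaleC:
  assumes "u \<in> dom_pow \<Omega> s"
  shows "c *\<^sub>C u \<in> dom_pow \<Omega> s"
proof -
  have "(\<lambda>\<mu>. (cmod c)\<^sup>2 * (\<mu> powr s * norm (components \<Omega> u \<mu>))\<^sup>2) summable_on eigenvalues \<Omega>"
    using assms by (intro summable_on_cmult_right) (auto simp: dom_pow_iff)
  then have "(\<lambda>\<mu>. (\<mu> powr s * norm (c *\<^sub>C components \<Omega> u \<mu>))\<^sup>2) summable_on eigenvalues \<Omega>"
    by (simp add: norm_scaleC power_mult_distrib mult_ac)
  then show ?thesis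
    unfolding dom_pow_iff components_scaleC[OF assms]
    using expansion_scaleC[OF dom_pow_expansion[OF assms]] by simp
qed

lemma eigenvector_expansion:
  assumes "x \<in> eigenspace \<Omega> \<mu>"
  shows "is_expansion \<Omega> x (\<lambda>\<nu>. if \<nu> = \<mu> then x else 0)"
proof -
  have "((\<lambda>\<nu>. if \<nu> = \<mu> then x else 0) has_sum (\<Sum>\<nu>\<in>{\<mu>}. if \<nu> = \<mu> then x else 0)) (eigenvalues \<Omega>)" if "\<mu> \<in> eigenvalues \<Omega>"
    by (rule has_sum_finite_neutralI[where B="{\<mu>}"]) (use that in auto)
  moreover have "x = 0" if "\<mu> \<notin> eigenvalues \<Omega>" using that assms eigenspace_trivial by blast
  ultimately show ?thesis
    using assms by (cases "\<mu> \<in> eigenvalues \<Omega>") (auto simp: is_expansion_def eigenspace_zero intro!: has_sum_0)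
qed

lemma eigenvector_components: "x \<in> eigenspace \<Omega> \<mu> \<Longrightarrow> components \<Omega> x = (\<lambda>\<nu>. if \<nu> = \<mu> then x else 0)"
  by (rule components_eqI[OF eigenvector_expansion])

lemma supported_summable:
  fixes f :: "real \<Rightarrow> real"
  assumes "\<And>\<nu>. \<nu> \<noteq> \<mu> \<Longrightarrow> f \<nu> = 0"
  shows "f summable_on A"
proof -
  have "f summable_on (A \<inter> {\<mu>})" by (rule summable_on_finite) simp
  then show ?thesis using assms
    by (subst summable_on_cong_neutral[where T="A \<inter> {\<mu>}" and g=f]) auto
qed

lemma eigenvector_dom_pow: "x \<in> eigenspace \<Omega> \<mu> \<Longrightarrow> x \<in> dom_pow \<Omega> s"
  unfolding dom_pow_iff
  by (auto simp: eigenvector_components intro!: eigenvector_expansion supported_summable[of \<mu>])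

lemma pow_A_eigenvector: "x \<in> eigenspace \<Omega> \<mu> \<Longrightarrow> pow_A \<Omega> s x = \<mu> powr s *\<^sub>R x"
proof -
  assume x: "x \<in> eigenspace \<Omega> \<mu>"
  have e: "(\<lambda>\<nu>. \<nu> powr s *\<^sub>R (if \<nu> = \<mu> then x else 0)) = (\<lambda>\<nu>. if \<nu> = \<mu> then \<mu> powr s *\<^sub>R x else 0)"
    by auto
  show ?thesis
    unfolding pow_A_def pow_A_scale_def eigenvector_components[OF x] e
    by (rule synthesis_eqI[OF eigenvector_expansion[OF eigenspace_scaleR[OF x]]])
qed

end

section \<open>A uniform Lyapunov function for the modes\<close>

text \<open>In energy coordinates a mode of the plate evolves, up to the time scale $\sqrt\mu$, by
  $a' = P c$, $b' = Q d$, $c' = - P a - R d$, $d' = - Q b + R c - D d$. Only $d$ is damped. With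
  $e = Q b - R c$, the damping reaches $e$ through $d' = - e - D d$, then $a$ through
  $e' = (Q^2 + R^2) d + R P a$, then $c$ through $a' = P c$. The weights $\tau^8$, $\tau^{14}$,
  $\tau^{16}$ of the three corresponding correction terms are chosen such that, relative to the
  dissipation $|d|^2 + \tau^8 |e|^2 + \tau^{14} |a|^2 + \tau^{16} |c|^2$, every cross term carries a
  factor $\tau$.\<close>

locale coupled_modes =
  fixes k K P Q R D :: real
  assumes k: "0 < k" and K: "1 \<le> K"
    and P: "k \<le> P" "P \<le> K" and Q: "k \<le> Q" "Q \<le> K"
    and R: "k \<le> R" "R \<le> K" and D: "k \<le> D" "D \<le> K"
begin

definition energy :: "complex \<Rightarrow> complex \<Rightarrow> complex \<Rightarrow> complex \<Rightarrow> real" where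
  "energy a b c d = (cmod a)\<^sup>2 + (cmod b)\<^sup>2 + (cmod c)\<^sup>2 + (cmod d)\<^sup>2"

text \<open>With e = Q b - R c, the signs are those for which differentiation along the modes turns
  the three corrections into -|e|^2, -R P |a|^2 and -P |c|^2, up to their weights and cross
  terms.\<close>

definition lyap :: "real \<Rightarrow> complex \<Rightarrow> complex \<Rightarrow> complex \<Rightarrow> complex \<Rightarrow> real" where
  "lyap \<tau> a b c d = (inner a a + inner b b + inner c c + inner d d) / 2
     + \<tau> ^ 8 * inner d (Q *\<^sub>R b - R *\<^sub>R c) - \<tau> ^ 14 * inner a (Q *\<^sub>R b - R *\<^sub>R c) - \<tau> ^ 16 * inner a c"

text \<open>The velocities are free arguments, in which the form is real-linear; this allows the
  vector field multiplied by \<zeta> to be split into a real and a rotated part.\<close>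

definition dlyap :: "real \<Rightarrow> complex \<Rightarrow> complex \<Rightarrow> complex \<Rightarrow> complex \<Rightarrow> complex \<Rightarrow> complex \<Rightarrow> complex \<Rightarrow> complex \<Rightarrow> real" where
  "dlyap \<tau> a b c d a' b' c' d' = inner a a' + inner b b' + inner c c' + inner d d'
     + \<tau> ^ 8 * (inner d (Q *\<^sub>R b' - R *\<^sub>R c') + inner d' (Q *\<^sub>R b - R *\<^sub>R c))
     - \<tau> ^ 14 * (inner a (Q *\<^sub>R b' - R *\<^sub>R c') + inner a' (Q *\<^sub>R b - R *\<^sub>R c))
     - \<tau> ^ 16 * (inner a c' + inner a' c)"

lemma lyap_derivative:
  assumes "(a has_vector_derivative a') (at t)" "(b has_vector_derivative b') (at t)"
    "(c has_vector_derivative c') (at t)" "(d has_vector_derivative d') (at t)"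
  shows "((\<lambda>t. lyap \<tau> (a t) (b t) (c t) (d t)) has_real_derivative dlyap \<tau> (a t) (b t) (c t) (d t) a' b' c' d') (at t)"
proof -
  note ip = bounded_bilinear.has_vector_derivative[OF bounded_bilinear_inner]
  have e: "((\<lambda>t. Q *\<^sub>R b t - R *\<^sub>R c t) has_vector_derivative (Q *\<^sub>R b' - R *\<^sub>R c')) (at t)"
    by (intro has_vector_derivative_diff bounded_linear.has_vector_derivative[OF bounded_linear_scaleR_right] assms)
  note i = ip[OF assms(1) assms(1)] ip[OF assms(2) assms(2)] ip[OF assms(3) assms(3)] ip[OF assms(4) assms(4)]
    ip[OF assms(4) e] ip[OF assms(1) e] ip[OF assms(1) assms(3)]
  note i' = i[folded has_real_derivative_iff_has_vector_derivative]
  show ?thesis unfolding lyap_def dlyap_def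
    by (rule DERIV_cong[OF DERIV_diff[OF DERIV_diff[OF DERIV_add[OF DERIV_cdivide[OF DERIV_add[OF DERIV_add[OF DERIV_add[OF
        i'(1,2)] i'(3)] i'(4)]] DERIV_cmult[OF i'(5)]] DERIV_cmult[OF i'(6)]] DERIV_cmult[OF i'(7)]]])
      (simp add: inner_commute algebra_simps)
qed

text \<open>Here s and r are the factors that x and y carry inside the squares of the dissipation,
  and w = q s r; what is left over, q \<le> \<tau>, is the small factor.\<close>

lemma inner_scaled_bound:
  fixes x y :: complex
  assumes "0 \<le> p" "p \<le> L" "0 \<le> q" "q \<le> \<tau>" "q * s * r = w"
    "(s * cmod x)\<^sup>2 \<le> N" "(r * cmod y)\<^sup>2 \<le> N" "0 \<le> s" "0 \<le> r" "w \<ge> 0"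
  shows "\<bar>w * (p * inner x y)\<bar> \<le> L * \<tau> * N"
proof -
  have "\<bar>w * (p * inner x y)\<bar> = p * (w * \<bar>inner x y\<bar>)" using assms by (simp add: abs_mult)
  also have "\<dots> \<le> p * (w * (cmod x * cmod y))"
    using assms Cauchy_Schwarz_ineq2[of x y] by (intro mult_left_mono) auto
  also have "\<dots> = p * q * ((s * cmod x) * (r * cmod y))" unfolding assms(5)[symmetric] by (simp add: mult_ac)
  also have "\<dots> \<le> L * \<tau> * N"
  proof (intro mult_mono)
    show "(s * cmod x) * (r * cmod y) \<le> N"
      using sum_squares_bound[of "s * cmod x" "r * cmod y"] assms(6,7) by linarith
  qed (use assms in auto)
  finally show ?thesis .
qed

definition dissip :: "real \<Rightarrow> complex \<Rightarrow> complex \<Rightarrow> complex \<Rightarrow> complex \<Rightarrow> real" where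
  "dissip \<tau> a b c d = (cmod d)\<^sup>2 + (\<tau> ^ 4 * cmod (Q *\<^sub>R b - R *\<^sub>R c))\<^sup>2 + (\<tau> ^ 7 * cmod a)\<^sup>2 + (\<tau> ^ 8 * cmod c)\<^sup>2"

text \<open>For correction weights with exponents p, q, r the critical cross terms require p > q/2
  (d with a), q > (p + r)/2 (c with e) and r > q (a with a); 8, 14, 16 satisfy all three. Seven
  cross terms, each at most 2 K^2 \<tau> times the dissipation, may consume half of the diagonal
  terms, which is the origin of 28.\<close>

lemma dlyap_real_direction:
  assumes tau: "0 < \<tau>" "\<tau> \<le> 1" "28 * K\<^sup>2 * \<tau> \<le> min 1 (min k (k\<^sup>2))"
  shows "dlyap \<tau> a b c d (P *\<^sub>R c) (Q *\<^sub>R d) (- (P *\<^sub>R a) - R *\<^sub>R d) (- (Q *\<^sub>R b) + R *\<^sub>R c - D *\<^sub>R d)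
    \<le> - (min 1 (min k (k\<^sup>2)) / 2) * dissip \<tau> a b c d"
proof -
  let ?m = "min 1 (min k (k\<^sup>2))"
  define e where "e = Q *\<^sub>R b - R *\<^sub>R c"
  let ?N = "dissip \<tau> a b c d"
  \<comment> \<open>The largest coefficient of a cross term is Q^2 + R^2, at most 2 K^2.\<close>
  define L where "L = 2 * K\<^sup>2"
  define S where "S = Q\<^sup>2 + R\<^sup>2"
  have N: "?N = (cmod d)\<^sup>2 + (\<tau> ^ 4 * cmod e)\<^sup>2 + (\<tau> ^ 7 * cmod a)\<^sup>2 + (\<tau> ^ 8 * cmod c)\<^sup>2"
    by (simp add: dissip_def e_def)
  have N1: "(1 * cmod d)\<^sup>2 \<le> ?N" "(\<tau> ^ 4 * cmod e)\<^sup>2 \<le> ?N" "(\<tau> ^ 7 * cmod a)\<^sup>2 \<le> ?N" "(\<tau> ^ 8 * cmod c)\<^sup>2 \<le> ?N"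
    unfolding N by simp_all
  have pos: "P > 0" "Q > 0" "R > 0" "D > 0" using k P Q R D by linarith+
  have KK: "K \<le> K\<^sup>2" using K by (simp add: power2_eq_square)
  have L: "P \<le> L" "R \<le> L" "D \<le> L" "S \<le> L" "R * P \<le> L"
  proof -
    show "P \<le> L" "R \<le> L" "D \<le> L" using P R D KK zero_le_power2[of K] unfolding L_def by linarith+
    have "Q\<^sup>2 \<le> K\<^sup>2" "R\<^sup>2 \<le> K\<^sup>2" using Q R pos by (auto intro!: power_mono)
    then show "S \<le> L" by (simp add: S_def L_def)
    have "R * P \<le> K * K" using R P pos by (intro mult_mono) auto
    then show "R * P \<le> L" using zero_le_square[of K] unfolding L_def power2_eq_square by linarith
  qed
  have tp: "\<tau> ^ Suc n \<le> \<tau>" for n using tau power_le_one[of \<tau> n] by (simp add: mult_left_le)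
  have eq: "dlyap \<tau> a b c d (P *\<^sub>R c) (Q *\<^sub>R d) (- (P *\<^sub>R a) - R *\<^sub>R d) (- (Q *\<^sub>R b) + R *\<^sub>R c - D *\<^sub>R d)
    = - (D * inner d d) - \<tau> ^ 8 * inner e e - \<tau> ^ 14 * (R * P * inner a a) - \<tau> ^ 16 * (P * inner c c)
      - \<tau> ^ 8 * (D * inner d e) + \<tau> ^ 8 * (S * inner d d) + \<tau> ^ 8 * (R * P * inner d a)
      - \<tau> ^ 14 * (P * inner c e) - \<tau> ^ 14 * (S * inner a d) + \<tau> ^ 16 * (P * inner a a) + \<tau> ^ 16 * (R * inner a d)"
    unfolding dlyap_def e_def S_def
    by (simp add: inner_diff_left inner_diff_right inner_add_left inner_add_right inner_commute power2_eq_square algebra_simps)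
  have tau_pw: "\<tau> ^ 4 \<le> \<tau>" "\<tau> ^ 8 \<le> \<tau>" "\<tau> ^ 2 \<le> \<tau>" "\<tau> ^ 7 \<le> \<tau>" "\<tau> ^ 9 \<le> \<tau>"
    using tp[of 3] tp[of 7] tp[of 1] tp[of 6] tp[of 8] by (simp_all add: numeral_eq_Suc)
  have t8: "\<tau> * \<tau> ^ 7 = \<tau> ^ 8" by (simp add: numeral_eq_Suc)
  have c1: "\<bar>\<tau> ^ 8 * (D * inner d e)\<bar> \<le> L * \<tau> * ?N"
    by (rule inner_scaled_bound[where q="\<tau> ^ 4" and s=1 and r="\<tau> ^ 4"])
      (use L pos tau tau_pw N1 in \<open>simp_all add: S_def flip: power_add\<close>)
  have c2: "\<bar>\<tau> ^ 8 * (S * inner d d)\<bar> \<le> L * \<tau> * ?N"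
    by (rule inner_scaled_bound[where q="\<tau> ^ 8" and s=1 and r=1])
      (use L pos tau tau_pw N1 in \<open>simp_all add: S_def flip: power_add\<close>)
  \<comment> \<open>The tightest of the seven: 8 = 1 + 7 leaves exactly one power of \<tau>.\<close>
  have c3: "\<bar>\<tau> ^ 8 * (R * P * inner d a)\<bar> \<le> L * \<tau> * ?N"
    by (rule inner_scaled_bound[where q="\<tau> ^ 1" and s=1 and r="\<tau> ^ 7"])
      (use L pos tau tau_pw N1 t8 in \<open>simp_all add: S_def flip: power_add\<close>)
  have c4: "\<bar>\<tau> ^ 14 * (P * inner c e)\<bar> \<le> L * \<tau> * ?N"
    by (rule inner_scaled_bound[where q="\<tau> ^ 2" and s="\<tau> ^ 8" and r="\<tau> ^ 4"])
      (use L pos tau tau_pw N1 in \<open>simp_all add: S_def flip: power_add\<close>)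
  have c5: "\<bar>\<tau> ^ 14 * (S * inner a d)\<bar> \<le> L * \<tau> * ?N"
    by (rule inner_scaled_bound[where q="\<tau> ^ 7" and s="\<tau> ^ 7" and r=1])
      (use L pos tau tau_pw N1 in \<open>simp_all add: S_def flip: power_add\<close>)
  have c6: "\<bar>\<tau> ^ 16 * (P * inner a a)\<bar> \<le> L * \<tau> * ?N"
    by (rule inner_scaled_bound[where q="\<tau> ^ 2" and s="\<tau> ^ 7" and r="\<tau> ^ 7"])
      (use L pos tau tau_pw N1 in \<open>simp_all add: S_def flip: power_add\<close>)
  have c7: "\<bar>\<tau> ^ 16 * (R * inner a d)\<bar> \<le> L * \<tau> * ?N"
    by (rule inner_scaled_bound[where q="\<tau> ^ 9" and s="\<tau> ^ 7" and r=1])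
      (use L pos tau tau_pw N1 in \<open>simp_all add: S_def flip: power_add\<close>)
  \<comment> \<open>The diagonal coefficients are D, 1, R P and P; the minimum of 1, k and k^2 is
    below all of them.\<close>
  have m: "?m \<le> 1" "?m \<le> D" "?m \<le> P" "?m \<le> R * P"
  proof -
    have "k\<^sup>2 \<le> R * P" unfolding power2_eq_square using R P k by (intro mult_mono) auto
    moreover have "?m \<le> 1" "?m \<le> k" "?m \<le> k\<^sup>2" by simp_all
    ultimately show "?m \<le> 1" "?m \<le> D" "?m \<le> P" "?m \<le> R * P" using D(1) P(1) by linarith+
  qed
  have "m * ?N = m * inner d d + \<tau> ^ 8 * (m * inner e e) + \<tau> ^ 14 * (m * inner a a) + \<tau> ^ 16 * (m * inner c c)" for m
    unfolding N by (simp add: power_mult_distrib power2_norm_eq_inner distrib_left mult.left_commute flip: power_mult)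
  from this[of ?m] have "?m * ?N = ?m * inner d d + \<tau> ^ 8 * (?m * inner e e) + \<tau> ^ 14 * (?m * inner a a) + \<tau> ^ 16 * (?m * inner c c)" .
  also have "\<dots> \<le> D * inner d d + \<tau> ^ 8 * (1 * inner e e) + \<tau> ^ 14 * (R * P * inner a a) + \<tau> ^ 16 * (P * inner c c)"
    using tau m by (intro add_mono mult_left_mono mult_right_mono) auto
  finally have main: "?m * ?N \<le> D * inner d d + \<tau> ^ 8 * inner e e + \<tau> ^ 14 * (R * P * inner a a) + \<tau> ^ 16 * (P * inner c c)"
    by simp
  have "7 * (L * \<tau> * ?N) = (28 * K\<^sup>2 * \<tau>) * ?N / 2" by (simp add: L_def)
  also have "\<dots> \<le> ?m * ?N / 2" using tau(3) by (intro divide_right_mono mult_right_mono) (auto simp: dissip_def)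
  finally have "7 * (L * \<tau> * ?N) \<le> ?m * ?N / 2" .
  moreover define m where "m = ?m"
  ultimately show ?thesis
    using main abs_le_D2[OF c1] abs_le_D1[OF c2] abs_le_D1[OF c3] abs_le_D2[OF c4] abs_le_D2[OF c5] abs_le_D1[OF c6] abs_le_D1[OF c7]
    unfolding eq m_def[symmetric] by linarith
qed

lemma energy_norm_le:
  "cmod a \<le> sqrt (energy a b c d)" "cmod b \<le> sqrt (energy a b c d)"
  "cmod c \<le> sqrt (energy a b c d)" "cmod d \<le> sqrt (energy a b c d)"
  by (auto simp: energy_def intro!: real_le_rsqrt)

lemma energy_nonneg: "energy a b c d \<ge> 0"
  by (simp add: energy_def)

lemma coupling_norm_le: "cmod (Q *\<^sub>R b - R *\<^sub>R c) \<le> K * cmod b + K * cmod c"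
  using k Q R by (intro order_trans[OF norm_triangle_ineq4] add_mono) (auto intro!: mult_right_mono)

lemma inner_le: "\<bar>inner x y\<bar> \<le> p * q" if "cmod x \<le> p" "cmod y \<le> q" for x y :: complex
  using Cauchy_Schwarz_ineq2[of x y] mult_mono[OF that] that norm_ge_zero[of x] by (auto intro: order_trans)

text \<open>Each of the three corrections is at most 2 K \<tau> times the energy, so 24 K \<tau>
  \<le> 1 bounds their sum by a quarter of the energy.\<close>

lemma lyap_bounds:
  assumes tau: "0 < \<tau>" "\<tau> \<le> 1" "24 * K * \<tau> \<le> 1"
  shows "energy a b c d / 4 \<le> lyap \<tau> a b c d" "lyap \<tau> a b c d \<le> energy a b c d"
proof -
  let ?n = "sqrt (energy a b c d)"
  note nn = energy_norm_le[where a=a and b=b and c=c and d=d]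
  have n2: "?n * ?n = energy a b c d" by (simp add: energy_nonneg)
  have K0: "0 \<le> K" using K by simp
  have e: "cmod (Q *\<^sub>R b - R *\<^sub>R c) \<le> 2 * K * ?n"
    using coupling_norm_le[of b c] mult_left_mono[OF nn(2) K0] mult_left_mono[OF nn(3) K0] by linarith
  have t: "\<tau> ^ Suc n \<le> \<tau>" for n using tau power_le_one[of \<tau> n] by (simp add: mult_left_le)
  then have t': "\<tau> ^ 8 \<le> \<tau>" "\<tau> ^ 14 \<le> \<tau>" "\<tau> ^ 16 \<le> \<tau>" using t[of 7] t[of 13] t[of 15] by (simp_all add: numeral_eq_Suc)
  have b: "\<bar>w * r\<bar> \<le> \<tau> * (2 * K * energy a b c d)" if "0 \<le> w" "w \<le> \<tau>" "\<bar>r\<bar> \<le> 2 * K * energy a b c d" for w r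
    using that mult_mono[of w \<tau> "\<bar>r\<bar>" "2 * K * energy a b c d"] by (simp add: abs_mult)
  have "\<bar>inner d (Q *\<^sub>R b - R *\<^sub>R c)\<bar> \<le> 2 * K * energy a b c d" "\<bar>inner a (Q *\<^sub>R b - R *\<^sub>R c)\<bar> \<le> 2 * K * energy a b c d"
    using inner_le[OF nn(4) e] inner_le[OF nn(1) e] n2 by (simp_all add: algebra_simps)
  moreover have "\<bar>inner a c\<bar> \<le> 2 * K * energy a b c d"
  proof -
    have "\<bar>inner a c\<bar> \<le> 1 * energy a b c d" using inner_le[OF nn(1) nn(3)] n2 by simp
    also have "\<dots> \<le> 2 * K * energy a b c d" using K energy_nonneg by (intro mult_right_mono) auto
    finally show ?thesis .
  qed
  ultimately have 1: "\<bar>\<tau> ^ 8 * inner d (Q *\<^sub>R b - R *\<^sub>R c)\<bar> \<le> \<tau> * (2 * K * energy a b c d)"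
    "\<bar>\<tau> ^ 14 * inner a (Q *\<^sub>R b - R *\<^sub>R c)\<bar> \<le> \<tau> * (2 * K * energy a b c d)"
    "\<bar>\<tau> ^ 16 * inner a c\<bar> \<le> \<tau> * (2 * K * energy a b c d)"
    using tau t' by (intro b; simp)+
  have "12 * (\<tau> * (2 * K * energy a b c d)) = (24 * K * \<tau>) * energy a b c d" by simp
  also have "\<dots> \<le> 1 * energy a b c d" using tau energy_nonneg by (intro mult_right_mono) auto
  finally have 2: "12 * (\<tau> * (2 * K * energy a b c d)) \<le> energy a b c d" by simp
  have 3: "energy a b c d = inner a a + inner b b + inner c c + inner d d" by (simp add: energy_def power2_norm_eq_inner)
  have V: "lyap \<tau> a b c d = energy a b c d / 2
     + \<tau> ^ 8 * inner d (Q *\<^sub>R b - R *\<^sub>R c) - \<tau> ^ 14 * inner a (Q *\<^sub>R b - R *\<^sub>R c) - \<tau> ^ 16 * inner a c"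
    by (simp add: lyap_def 3)
  have ab: "- B \<le> x" "x \<le> B" if "\<bar>x\<bar> \<le> B" for x B :: real using that by linarith+
  show "energy a b c d / 4 \<le> lyap \<tau> a b c d" "lyap \<tau> a b c d \<le> energy a b c d"
    using ab[OF 1(1)] ab[OF 1(2)] ab[OF 1(3)] 2 energy_nonneg[of a b c d] unfolding V by linarith+
qed

text \<open>The hypothesis 3 K n on the velocities fits the vector field, whose components have at
  most three terms with coefficients at most K.\<close>

lemma dlyap_bound:
  assumes tau: "0 < \<tau>" "\<tau> \<le> 1" and n: "cmod a' \<le> 3 * K * n" "cmod b' \<le> 3 * K * n" "cmod c' \<le> 3 * K * n" "cmod d' \<le> 3 * K * n"
    "n = sqrt (energy a b c d)"
  shows "\<bar>dlyap \<tau> a b c d a' b' c' d'\<bar> \<le> 60 * K\<^sup>2 * energy a b c d"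
proof -
  note nn = energy_norm_le[where a=a and b=b and c=c and d=d, folded n(5)]
  have n2: "n * n = energy a b c d" by (simp add: n(5) energy_nonneg)
  have KK: "K * (n * n) \<le> K\<^sup>2 * (n * n)" using K by (intro mult_right_mono) (auto simp: power2_eq_square)
  have K0: "0 \<le> K" using K by simp
  have e: "cmod (Q *\<^sub>R b - R *\<^sub>R c) \<le> 2 * K * n"
    using coupling_norm_le[of b c] mult_left_mono[OF nn(2) K0] mult_left_mono[OF nn(3) K0] by linarith
  have e': "cmod (Q *\<^sub>R b' - R *\<^sub>R c') \<le> 6 * K\<^sup>2 * n"
    using coupling_norm_le[of b' c'] mult_left_mono[OF n(2) K0] mult_left_mono[OF n(3) K0]
    unfolding power2_eq_square by linarith
  have 1: "\<bar>inner a a'\<bar> \<le> 3 * (K\<^sup>2 * (n * n))" "\<bar>inner b b'\<bar> \<le> 3 * (K\<^sup>2 * (n * n))" "\<bar>inner c c'\<bar> \<le> 3 * (K\<^sup>2 * (n * n))" "\<bar>inner d d'\<bar> \<le> 3 * (K\<^sup>2 * (n * n))"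
    "\<bar>inner a c'\<bar> \<le> 3 * (K\<^sup>2 * (n * n))" "\<bar>inner a' c\<bar> \<le> 3 * (K\<^sup>2 * (n * n))"
    using inner_le[OF nn(1) n(1)] inner_le[OF nn(2) n(2)] inner_le[OF nn(3) n(3)] inner_le[OF nn(4) n(4)]
      inner_le[OF nn(1) n(3)] inner_le[OF n(1) nn(3)] KK by (simp_all add: mult_ac)
  have 2: "\<bar>inner d (Q *\<^sub>R b' - R *\<^sub>R c')\<bar> \<le> 6 * (K\<^sup>2 * (n * n))" "\<bar>inner a (Q *\<^sub>R b' - R *\<^sub>R c')\<bar> \<le> 6 * (K\<^sup>2 * (n * n))"
    "\<bar>inner d' (Q *\<^sub>R b - R *\<^sub>R c)\<bar> \<le> 6 * (K\<^sup>2 * (n * n))" "\<bar>inner a' (Q *\<^sub>R b - R *\<^sub>R c)\<bar> \<le> 6 * (K\<^sup>2 * (n * n))"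
    using inner_le[OF nn(4) e'] inner_le[OF nn(1) e'] inner_le[OF n(4) e] inner_le[OF n(1) e]
    by (simp_all add: mult_ac power2_eq_square)
  have b: "\<bar>\<tau> ^ j * r\<bar> \<le> \<bar>r\<bar>" for r j
    using tau power_le_one[of \<tau> j] by (simp add: abs_mult mult_left_le_one_le)
  have add: "\<bar>x + y\<bar> \<le> X + Y" "\<bar>x - y\<bar> \<le> X + Y" if "\<bar>x\<bar> \<le> X" "\<bar>y\<bar> \<le> Y" for x y X Y :: real
    using that by linarith+
  note bs = order_trans[OF b]
  \<comment> \<open>In units of K^2 n^2 the terms add up to 4 * 3 + (6 + 6) + (6 + 6) + (3 + 3) =
    42, afterwards rounded up to 60.\<close>
  have "\<bar>dlyap \<tau> a b c d a' b' c' d'\<bar> \<le> 42 * (K\<^sup>2 * (n * n))"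
    unfolding dlyap_def
    by (rule order_trans[OF add(2)[OF add(2)[OF add(1)[OF add(1)[OF add(1)[OF add(1)[OF 1(1,2)] 1(3)] 1(4)]
      bs[OF add(1)[OF 2(1,3)]]] bs[OF add(1)[OF 2(2,4)]]] bs[OF add(1)[OF 1(5,6)]]]]) simp
  also have "\<dots> \<le> 60 * K\<^sup>2 * energy a b c d" unfolding n2 using energy_nonneg[of a b c d] by simp
  finally show ?thesis .
qed

text \<open>The coordinate b is absent from the dissipation and is recovered from Q b = e + R c with
  Q \<ge> k; this gives the second summand of the constant, the other three coordinates give
  3.\<close>

lemma energy_le_dissip:
  assumes tau: "0 < \<tau>" "\<tau> \<le> 1"
  shows "\<tau> ^ 16 * energy a b c d \<le> (3 + 2 * (1 + K\<^sup>2) / k\<^sup>2) * dissip \<tau> a b c d"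
proof -
  let ?e = "Q *\<^sub>R b - R *\<^sub>R c"
  have t: "\<tau> ^ 16 \<le> \<tau> ^ j" if "j \<le> 16" for j using tau that by (intro power_decreasing) auto
  have m: "\<tau> ^ 16 * x \<le> \<tau> ^ j * x" if "j \<le> 16" "x \<ge> 0" for x j using t that by (intro mult_right_mono) auto
  have d: "dissip \<tau> a b c d = (cmod d)\<^sup>2 + \<tau> ^ 8 * (cmod ?e)\<^sup>2 + \<tau> ^ 14 * (cmod a)\<^sup>2 + \<tau> ^ 16 * (cmod c)\<^sup>2"
    by (simp add: dissip_def power_mult_distrib flip: power_mult)
  have p: "0 \<le> (cmod d)\<^sup>2" "0 \<le> \<tau> ^ 8 * (cmod ?e)\<^sup>2" "0 \<le> \<tau> ^ 14 * (cmod a)\<^sup>2" "0 \<le> \<tau> ^ 16 * (cmod c)\<^sup>2" using tau by auto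
  have 1: "\<tau> ^ 16 * (cmod a)\<^sup>2 \<le> dissip \<tau> a b c d" "\<tau> ^ 16 * (cmod c)\<^sup>2 \<le> dissip \<tau> a b c d"
    "\<tau> ^ 16 * (cmod d)\<^sup>2 \<le> dissip \<tau> a b c d" "\<tau> ^ 16 * (cmod ?e)\<^sup>2 \<le> dissip \<tau> a b c d"
    using m[of 14 "(cmod a)\<^sup>2", simplified] m[of 8 "(cmod ?e)\<^sup>2", simplified]
      m[of 0 "(cmod d)\<^sup>2", simplified] p unfolding d by linarith+
  have "k * cmod b \<le> Q * cmod b" using Q by (intro mult_right_mono) auto
  also have "\<dots> = cmod (?e + R *\<^sub>R c)" using k Q by simp
  also have "\<dots> \<le> cmod ?e + R * cmod c" using norm_triangle_ineq[of ?e "R *\<^sub>R c"] k R by simp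
  also have "\<dots> \<le> cmod ?e + K * cmod c" using R by (intro add_left_mono mult_right_mono) auto
  finally have "(k * cmod b)\<^sup>2 \<le> (cmod ?e + K * cmod c)\<^sup>2" using k by (intro power_mono) auto
  also have "\<dots> \<le> 2 * (cmod ?e)\<^sup>2 + 2 * (K * cmod c)\<^sup>2"
    using sum_squares_bound[of "cmod ?e" "K * cmod c"] by (simp add: power2_sum)
  finally have "k\<^sup>2 * (cmod b)\<^sup>2 \<le> 2 * (cmod ?e)\<^sup>2 + 2 * K\<^sup>2 * (cmod c)\<^sup>2" by (simp add: power_mult_distrib)
  then have "\<tau> ^ 16 * (k\<^sup>2 * (cmod b)\<^sup>2) \<le> \<tau> ^ 16 * (2 * (cmod ?e)\<^sup>2 + 2 * K\<^sup>2 * (cmod c)\<^sup>2)"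
    using tau by (intro mult_left_mono) auto
  also have "\<dots> = 2 * (\<tau> ^ 16 * (cmod ?e)\<^sup>2) + 2 * K\<^sup>2 * (\<tau> ^ 16 * (cmod c)\<^sup>2)" by (simp add: algebra_simps)
  also have "\<dots> \<le> 2 * dissip \<tau> a b c d + 2 * K\<^sup>2 * dissip \<tau> a b c d"
    using 1 by (intro add_mono mult_left_mono) auto
  finally have "k\<^sup>2 * (\<tau> ^ 16 * (cmod b)\<^sup>2) \<le> 2 * (1 + K\<^sup>2) * dissip \<tau> a b c d" by (simp add: algebra_simps)
  then have "\<tau> ^ 16 * (cmod b)\<^sup>2 \<le> 2 * (1 + K\<^sup>2) / k\<^sup>2 * dissip \<tau> a b c d" using k by (simp add: field_simps)
  then show ?thesis using 1 by (simp add: energy_def distrib_left distrib_right)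
qed

end

text \<open>The largest \<tau> allowed by both \<open>lyap_bounds\<close> and
  \<open>dlyap_real_direction\<close>.\<close>

definition tau_const :: "real \<Rightarrow> real \<Rightarrow> real" where
  "tau_const k K = min (1 / (24 * K)) (min 1 (min k (k\<^sup>2)) / (28 * K\<^sup>2))"

text \<open>Multiplying the vector field by $\zeta$ costs $|\mathrm{Im}\,\zeta|$ times a bounded form, which the
  dissipation absorbs in a cone around the positive axis.\<close>

definition cone_const :: "real \<Rightarrow> real \<Rightarrow> real" where
  "cone_const k K = min 1 (min k (k\<^sup>2)) / 2 * tau_const k K ^ 16 / (3 + 2 * (1 + K\<^sup>2) / k\<^sup>2) / (60 * K\<^sup>2)"

definition cone :: "real \<Rightarrow> real \<Rightarrow> complex set" where
  "cone k K = {\<zeta>. \<bar>Im \<zeta>\<bar> \<le> cone_const k K * Re \<zeta>}"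

context coupled_modes
begin

lemma tau_const:
  "0 < tau_const k K" "tau_const k K \<le> 1" "24 * K * tau_const k K \<le> 1"
  "28 * K\<^sup>2 * tau_const k K \<le> min 1 (min k (k\<^sup>2))"
proof -
  show "0 < tau_const k K" using k K by (auto simp: tau_const_def)
  have "tau_const k K \<le> 1 / (24 * K)" "tau_const k K \<le> min 1 (min k (k\<^sup>2)) / (28 * K\<^sup>2)" by (simp_all add: tau_const_def)
  then show *: "24 * K * tau_const k K \<le> 1" "28 * K\<^sup>2 * tau_const k K \<le> min 1 (min k (k\<^sup>2))"
    using k K by (simp_all add: field_simps)
  have "tau_const k K \<le> 1 / (24 * K)" by (simp add: tau_const_def)
  also have "\<dots> \<le> 1" using K by simp
  finally show "tau_const k K \<le> 1" .
qed

lemma cone_const_pos: "cone_const k K > 0"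
  unfolding cone_const_def using tau_const(1) k K by (auto intro!: divide_pos_pos mult_pos_pos add_pos_nonneg)

text \<open>Since \<zeta> scales the field, unit time runs along the segment from 0 to \<zeta>. The
  Lyapunov function does not increase there, and its two-sided comparison with the energy produces
  the factor 4.\<close>

lemma energy_along_solution:
  assumes zeta: "\<zeta> \<in> cone k K"
    and a: "\<And>t. (a has_vector_derivative \<zeta> * (P *\<^sub>R c t)) (at t)"
    and b: "\<And>t. (b has_vector_derivative \<zeta> * (Q *\<^sub>R d t)) (at t)"
    and c: "\<And>t. (c has_vector_derivative \<zeta> * (- (P *\<^sub>R a t) - R *\<^sub>R d t)) (at t)"
    and d: "\<And>t. (d has_vector_derivative \<zeta> * (- (Q *\<^sub>R b t) + R *\<^sub>R c t - D *\<^sub>R d t)) (at t)"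
  shows "energy (a 1) (b 1) (c 1) (d 1) \<le> 4 * energy (a 0) (b 0) (c 0) (d 0)"
proof -
  define \<tau> where "\<tau> = tau_const k K"
  let ?m = "min 1 (min k (k\<^sup>2))"
  let ?H = "3 + 2 * (1 + K\<^sup>2) / k\<^sup>2"
  note tau = tau_const[folded \<tau>_def]
  have H: "?H > 0" using k by (intro add_pos_nonneg) auto
  let ?V = "\<lambda>t. lyap \<tau> (a t) (b t) (c t) (d t)"
  let ?\<epsilon> = "cone_const k K"
  have "?V 1 \<le> ?V 0"
  proof (rule DERIV_nonpos_imp_nonincreasing[where f="?V" and a=0 and b=1])
    fix t :: real
    let ?a' = "P *\<^sub>R c t" and ?b' = "Q *\<^sub>R d t" and ?c' = "- (P *\<^sub>R a t) - R *\<^sub>R d t" and ?d' = "- (Q *\<^sub>R b t) + R *\<^sub>R c t - D *\<^sub>R d t"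
    let ?W = "dlyap \<tau> (a t) (b t) (c t) (d t)"
    let ?E = "energy (a t) (b t) (c t) (d t)"
    let ?N = "dissip \<tau> (a t) (b t) (c t) (d t)"
    have "(?V has_real_derivative ?W (\<zeta> * ?a') (\<zeta> * ?b') (\<zeta> * ?c') (\<zeta> * ?d')) (at t)"
      by (rule lyap_derivative[OF a b c d])
    moreover have "?W (\<zeta> * ?a') (\<zeta> * ?b') (\<zeta> * ?c') (\<zeta> * ?d') \<le> 0"
    proof -
      \<comment> \<open>\<open>inner\<close> is only real-bilinear; multiplication by \<zeta> is
        therefore split into the real part and the imaginary part times a rotation by i.\<close>
      have z: "\<zeta> * x = Re \<zeta> *\<^sub>R x + Im \<zeta> *\<^sub>R (\<i> * x)" for x
        by (subst (1) complex_eq[of \<zeta>]) (simp add: scaleR_conv_of_real algebra_simps)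
      have "?W (\<zeta> * ?a') (\<zeta> * ?b') (\<zeta> * ?c') (\<zeta> * ?d')
        = Re \<zeta> * ?W ?a' ?b' ?c' ?d' + Im \<zeta> * ?W (\<i> * ?a') (\<i> * ?b') (\<i> * ?c') (\<i> * ?d')"
        unfolding z[of ?a'] z[of ?b'] z[of ?c'] z[of ?d'] dlyap_def
        by (simp only: inner_add_left inner_add_right inner_diff_left inner_diff_right inner_scaleR_left inner_scaleR_right
            scaleR_add_right) (simp only: algebra_simps)
      also have "\<dots> \<le> Re \<zeta> * (- (?m / 2) * ?N) + (?\<epsilon> * Re \<zeta>) * (60 * K\<^sup>2 * ?E)"
      proof (rule add_mono)
        have "0 \<le> ?\<epsilon> * Re \<zeta>" using zeta by (auto simp: cone_def intro: order_trans[OF abs_ge_zero])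
        then have re: "Re \<zeta> \<ge> 0" using cone_const_pos by (simp add: zero_le_mult_iff)
        show "Re \<zeta> * ?W ?a' ?b' ?c' ?d' \<le> Re \<zeta> * (- (?m / 2) * ?N)"
          by (intro mult_left_mono re dlyap_real_direction tau)
        let ?n = "sqrt ?E"
        note nn = energy_norm_le[where a="a t" and b="b t" and c="c t" and d="d t"]
        have r: "r * cmod x \<le> K * ?n" if "k \<le> r" "r \<le> K" "cmod x \<le> ?n" for r x
          using that k by (intro mult_mono) auto
        have n0: "0 \<le> K * ?n" using K energy_nonneg by simp
        note rs = r[OF P nn(1)] r[OF P nn(3)] r[OF Q nn(2)] r[OF Q nn(4)] r[OF R nn(3)] r[OF R nn(4)] r[OF D nn(4)]
        have pos: "\<bar>P\<bar> = P" "\<bar>Q\<bar> = Q" "\<bar>R\<bar> = R" "\<bar>D\<bar> = D" using k P Q R D by auto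
        have x1: "cmod (\<i> * ?a') \<le> 3 * K * ?n" "cmod (\<i> * ?b') \<le> 3 * K * ?n"
          using rs n0 by (simp_all add: norm_mult pos)
        have x2: "cmod (\<i> * ?c') \<le> 3 * K * ?n"
          using norm_triangle_ineq4[of "- (P *\<^sub>R a t)" "R *\<^sub>R d t"] rs n0 by (simp add: norm_mult pos)
        have x3: "cmod (\<i> * ?d') \<le> 3 * K * ?n"
          using norm_triangle_ineq4[of "- (Q *\<^sub>R b t) + R *\<^sub>R c t" "D *\<^sub>R d t"] norm_triangle_ineq[of "- (Q *\<^sub>R b t)" "R *\<^sub>R c t"] rs n0
          by (simp add: norm_mult pos)
        have "\<bar>?W (\<i> * ?a') (\<i> * ?b') (\<i> * ?c') (\<i> * ?d')\<bar> \<le> 60 * K\<^sup>2 * ?E"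
          by (rule dlyap_bound[OF tau(1,2) x1 x2 x3 refl])
        moreover have "\<bar>Im \<zeta>\<bar> \<le> ?\<epsilon> * Re \<zeta>" using zeta by (simp add: cone_def)
        ultimately have "\<bar>Im \<zeta> * ?W (\<i> * ?a') (\<i> * ?b') (\<i> * ?c') (\<i> * ?d')\<bar> \<le> (?\<epsilon> * Re \<zeta>) * (60 * K\<^sup>2 * ?E)"
          unfolding abs_mult by (intro mult_mono) auto
        then show "Im \<zeta> * ?W (\<i> * ?a') (\<i> * ?b') (\<i> * ?c') (\<i> * ?d') \<le> (?\<epsilon> * Re \<zeta>) * (60 * K\<^sup>2 * ?E)" by linarith
      qed
      also have "\<dots> \<le> 0"
      proof -
        have "0 \<le> ?\<epsilon> * Re \<zeta>" using zeta by (auto simp: cone_def intro: order_trans[OF abs_ge_zero])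
        then have re: "Re \<zeta> \<ge> 0" using cone_const_pos by (simp add: zero_le_mult_iff)
        \<comment> \<open>The cone constant is chosen so that the bound for the rotated part equals
          the dissipation guaranteed by \<open>energy_le_dissip\<close>.\<close>
        have "?\<epsilon> * (60 * K\<^sup>2 * ?E) = ?m / 2 * (\<tau> ^ 16 * ?E / ?H)"
          using K by (simp add: cone_const_def \<tau>_def)
        also have "\<dots> \<le> ?m / 2 * ?N"
          using energy_le_dissip[OF tau(1,2), of "a t" "b t" "c t" "d t"] H k by (intro mult_left_mono) (auto simp: pos_divide_le_eq mult.commute)
        finally have "Re \<zeta> * (?\<epsilon> * (60 * K\<^sup>2 * ?E)) \<le> Re \<zeta> * (?m / 2 * ?N)" by (intro mult_left_mono re)
        then show ?thesis by (simp add: algebra_simps)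
      qed
      finally show ?thesis .
    qed
    ultimately show "\<exists>y. DERIV ?V t :> y \<and> y \<le> 0" by blast
  qed simp
  then show ?thesis
    using lyap_bounds[OF tau(1-3), of "a 1" "b 1" "c 1" "d 1"] lyap_bounds[OF tau(1-3), of "a 0" "b 0" "c 0" "d 0"] by linarith
qed

end

section \<open>The matrix exponential\<close>

primrec matpow :: "complex ^ 'n ^ 'n \<Rightarrow> nat \<Rightarrow> complex ^ 'n ^ 'n" where
  "matpow A 0 = mat 1"
| "matpow A (Suc m) = A ** matpow A m"

text \<open>The exponential of \<zeta> A as an entrywise power series, so that each entry is a
  scalar entire function of \<zeta>.\<close>

definition mexp :: "complex ^ 'n ^ 'n \<Rightarrow> complex \<Rightarrow> complex ^ 'n ^ 'n" where
  "mexp A \<zeta> = (\<chi> i j. \<Sum>m. matpow A m $ i $ j / fact m * \<zeta> ^ m)"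

lemma matpow_bound:
  fixes A :: "complex ^ 'n ^ 'n" and b :: real
  assumes "\<And>i j. cmod (A $ i $ j) \<le> b"
  shows "cmod (matpow A m $ i $ j) \<le> (CARD('n) * b) ^ m"
proof (induction m arbitrary: i j)
  case 0
  then show ?case by (simp add: mat_def)
next
  case (Suc m)
  have "cmod (matpow A (Suc m) $ i $ j) \<le> (\<Sum>k\<in>UNIV. cmod (A $ i $ k) * cmod (matpow A m $ k $ j))"
    by (auto simp: matrix_matrix_mult_def norm_mult intro!: order_trans[OF norm_sum])
  also have "\<dots> \<le> (\<Sum>k\<in>(UNIV::'n set). b * (CARD('n) * b) ^ m)"
    by (intro sum_mono mult_mono assms Suc.IH norm_ge_zero order_trans[OF norm_ge_zero assms])
  finally show ?case by simp
qed

lemma matpow_summable: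
  fixes A :: "complex ^ 'n ^ 'n"
  shows "summable (\<lambda>m. matpow A m $ i $ j / fact m * \<zeta> ^ m)"
proof -
  obtain b :: real where b: "\<And>i j. cmod (A $ i $ j) \<le> b"
  proof
    show "cmod (A $ i $ j) \<le> (\<Sum>i\<in>UNIV. \<Sum>j\<in>UNIV. cmod (A $ i $ j))" for i j
      using member_le_sum[of i UNIV "\<lambda>i. \<Sum>j\<in>UNIV. cmod (A $ i $ j)"] member_le_sum[of j UNIV "\<lambda>j. cmod (A $ i $ j)"]
      by (auto simp: sum_nonneg)
  qed
  show ?thesis
  proof (rule summable_comparison_test'[OF summable_exp[of "CARD('n) * b * cmod \<zeta>"]])
    fix m
    have "cmod (matpow A m $ i $ j / fact m * \<zeta> ^ m) = cmod (matpow A m $ i $ j) * (inverse (fact m) * cmod \<zeta> ^ m)"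
      by (simp add: norm_mult norm_divide norm_power divide_inverse norm_inverse)
    also have "\<dots> \<le> (CARD('n) * b) ^ m * (inverse (fact m) * cmod \<zeta> ^ m)"
      by (intro mult_right_mono matpow_bound b) auto
    finally show "norm (matpow A m $ i $ j / fact m * \<zeta> ^ m) \<le> inverse (fact m) * (CARD('n) * b * cmod \<zeta>) ^ m"
      by (simp add: power_mult_distrib mult_ac)
  qed
qed

text \<open>Termwise differentiation turns the coefficient A^(m+1) / (m+1)! into A A^m / m!.\<close>

lemma mexp_derivative:
  "((\<lambda>\<zeta>. mexp A \<zeta> $ i $ j) has_field_derivative (A ** mexp A \<zeta>) $ i $ j) (at \<zeta>)"
proof -
  let ?c = "\<lambda>i m. matpow A m $ i $ j / fact m"
  have "((\<lambda>\<zeta>. \<Sum>m. ?c i m * \<zeta> ^ m) has_field_derivative (\<Sum>m. diffs (?c i) m * \<zeta> ^ m)) (at \<zeta>)"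
    by (rule termdiffs_strong_converges_everywhere) (rule matpow_summable)
  also have "(\<lambda>m. diffs (?c i) m * \<zeta> ^ m) = (\<lambda>m. \<Sum>k\<in>UNIV. A $ i $ k * (?c k m * \<zeta> ^ m))"
  proof
    fix m
    have "diffs (?c i) m = matpow A (Suc m) $ i $ j / fact m"
      by (simp add: diffs_def field_simps del: of_nat_Suc)
    then show "diffs (?c i) m * \<zeta> ^ m = (\<Sum>k\<in>UNIV. A $ i $ k * (?c k m * \<zeta> ^ m))"
      by (simp add: matrix_matrix_mult_def sum_divide_distrib sum_distrib_right mult.assoc)
  qed
  also have "(\<Sum>m. \<Sum>k\<in>UNIV. A $ i $ k * (?c k m * \<zeta> ^ m)) = (\<Sum>k\<in>UNIV. A $ i $ k * (\<Sum>m. ?c k m * \<zeta> ^ m))"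
    by (subst suminf_sum) (simp_all only: suminf_mult[OF matpow_summable] summable_mult[OF matpow_summable])
  finally show ?thesis by (simp add: mexp_def matrix_matrix_mult_def)
qed

lemma mexp_zero: "mexp A 0 = mat 1"
  unfolding mexp_def powser_zero by (simp add: vec_eq_iff)

text \<open>Restricted to the line t \<zeta> + \<eta> with real t, the exponential solves the linear
  system scaled by \<zeta>; the offset \<eta> serves the addition law.\<close>

lemma mexp_vector_derivative:
  "((\<lambda>t. (mexp A (complex_of_real t * \<zeta> + \<eta>) *v x) $ i) has_vector_derivative
     \<zeta> * (A *v (mexp A (complex_of_real t * \<zeta> + \<eta>) *v x)) $ i) (at t)"
proof -
  have l: "((\<lambda>t. complex_of_real t * \<zeta> + \<eta>) has_vector_derivative \<zeta>) (at t)"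
    by (auto intro!: derivative_eq_intros)
  have "((\<lambda>t. mexp A (complex_of_real t * \<zeta> + \<eta>) $ i $ j) has_vector_derivative
     \<zeta> * (A ** mexp A (complex_of_real t * \<zeta> + \<eta>)) $ i $ j) (at t)" for j
    using field_vector_diff_chain_at[OF l mexp_derivative] by (simp add: o_def)
  then have "((\<lambda>t. \<Sum>j\<in>UNIV. mexp A (complex_of_real t * \<zeta> + \<eta>) $ i $ j * x $ j) has_vector_derivative
     (\<Sum>j\<in>UNIV. \<zeta> * (A ** mexp A (complex_of_real t * \<zeta> + \<eta>)) $ i $ j * x $ j)) (at t)"
    by (intro has_vector_derivative_sum has_vector_derivative_mult_left) auto
  then show ?thesis
    by (simp add: matrix_vector_mul_assoc) (simp add: matrix_vector_mult_def sum_distrib_left mult.assoc)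
qed

definition modes_matrix :: "real \<Rightarrow> real \<Rightarrow> real \<Rightarrow> real \<Rightarrow> complex ^ 4 ^ 4" where
  "modes_matrix P Q R D = vector [vector [0, 0, of_real P, 0], vector [0, 0, 0, of_real Q],
     vector [- of_real P, 0, 0, - of_real R], vector [0, - of_real Q, of_real R, - of_real D]]"

lemma vector_4:
  "(vector [x, y, z, w] :: ('a::zero) ^ 4) $ 1 = x" "(vector [x, y, z, w] :: ('a::zero) ^ 4) $ 2 = y"
  "(vector [x, y, z, w] :: ('a::zero) ^ 4) $ 3 = z" "(vector [x, y, z, w] :: ('a::zero) ^ 4) $ 4 = w"
  by (simp_all add: vector_def)

lemma modes_matrix_apply:
  "(modes_matrix P Q R D *v x) $ 1 = P *\<^sub>R x $ 3"
  "(modes_matrix P Q R D *v x) $ 2 = Q *\<^sub>R x $ 4"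
  "(modes_matrix P Q R D *v x) $ 3 = - (P *\<^sub>R x $ 1) - R *\<^sub>R x $ 4"
  "(modes_matrix P Q R D *v x) $ 4 = - (Q *\<^sub>R x $ 2) + R *\<^sub>R x $ 3 - D *\<^sub>R x $ 4"
  by (simp_all add: modes_matrix_def matrix_vector_mult_def sum_4 vector_4 scaleR_conv_of_real)

lemma norm_vec4: "norm (x :: complex ^ 4) = sqrt ((cmod (x $ 1))\<^sup>2 + (cmod (x $ 2))\<^sup>2 + (cmod (x $ 3))\<^sup>2 + (cmod (x $ 4))\<^sup>2)"
  by (simp add: norm_vec_def L2_set_def sum_4)

lemma norm_matrix_le:
  fixes A :: "complex ^ 4 ^ 4"
  assumes "\<And>i j. cmod (A $ i $ j) \<le> b"
  shows "norm A \<le> 16 * b"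
proof -
  have "norm A \<le> (\<Sum>i\<in>UNIV. norm (A $ i))" unfolding norm_vec_def[of A] by (intro L2_set_le_sum) auto
  also have "\<dots> \<le> (\<Sum>i\<in>UNIV. \<Sum>j\<in>UNIV. cmod (A $ i $ j))"
    unfolding norm_vec_def[of "A $ _"] by (intro sum_mono L2_set_le_sum) auto
  also have "\<dots> \<le> (\<Sum>i\<in>(UNIV::4 set). \<Sum>j\<in>(UNIV::4 set). b)" by (intro sum_mono assms)
  finally show ?thesis by simp
qed

context coupled_modes
begin

abbreviation "M \<equiv> modes_matrix P Q R D"

text \<open>Linearity gives this estimate two uses: on an exponential it is a bound, on the
  difference of two solutions it is uniqueness.\<close>

lemma solution_bound:
  assumes "\<zeta> \<in> cone k K"
    and y: "\<And>t i. ((\<lambda>t. y t $ i) has_vector_derivative \<zeta> * (M *v y t) $ i) (at t)"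
  shows "norm (y 1) \<le> 2 * norm (y 0)"
proof -
  have "energy (y 1 $ 1) (y 1 $ 2) (y 1 $ 3) (y 1 $ 4) \<le> 4 * energy (y 0 $ 1) (y 0 $ 2) (y 0 $ 3) (y 0 $ 4)"
    by (rule energy_along_solution[OF assms(1)])
      (use y[of 1] y[of 2] y[of 3] y[of 4] in \<open>auto simp: modes_matrix_apply\<close>)
  moreover have "(norm x)\<^sup>2 = energy (x $ 1) (x $ 2) (x $ 3) (x $ 4)" for x :: "complex ^ 4"
    by (simp add: norm_vec4 energy_def)
  ultimately have "(norm (y 1))\<^sup>2 \<le> (2 * norm (y 0))\<^sup>2" by (simp add: power_mult_distrib)
  then show ?thesis by (rule power2_le_imp_le) simp
qed

lemma mexp_apply_bound:
  assumes "\<zeta> \<in> cone k K"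
  shows "norm (mexp M \<zeta> *v x) \<le> 2 * norm x"
  using solution_bound[OF assms mexp_vector_derivative[where \<eta>=0]] by (simp add: mexp_zero)

lemma mexp_entry_bound:
  assumes "\<zeta> \<in> cone k K"
  shows "cmod (mexp M \<zeta> $ i $ j) \<le> 2"
proof -
  have "(mexp M \<zeta> *v axis j 1) $ i = mexp M \<zeta> $ i $ j"
    by (simp add: matrix_vector_mult_def axis_def if_distrib cong: if_cong)
  then have "cmod (mexp M \<zeta> $ i $ j) \<le> norm (mexp M \<zeta> *v axis j 1)"
    using Finite_Cartesian_Product.norm_nth_le[where x="mexp M \<zeta> *v axis j 1" and i=i] by simp
  also have "\<dots> \<le> 2 * norm (axis j (1::complex))" by (rule mexp_apply_bound[OF assms])
  finally show ?thesis by simp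
qed

text \<open>With t \<zeta> in place of \<zeta>, both sides solve the same linear equation from the
  same initial value; their difference starts at 0 and vanishes by
  \<open>solution_bound\<close>.\<close>

lemma mexp_add:
  assumes "\<zeta> \<in> cone k K"
  shows "mexp M (\<zeta> + \<eta>) = mexp M \<zeta> ** mexp M \<eta>"
proof -
  have "mexp M (\<zeta> + \<eta>) *v x = (mexp M \<zeta> ** mexp M \<eta>) *v x" for x
  proof -
    let ?y = "\<lambda>t. mexp M (complex_of_real t * \<zeta> + \<eta>) *v x - mexp M (complex_of_real t * \<zeta> + 0) *v (mexp M \<eta> *v x)"
    have "norm (?y 1) \<le> 2 * norm (?y 0)"
    proof (rule solution_bound[OF assms])
      show "((\<lambda>t. ?y t $ i) has_vector_derivative \<zeta> * (M *v ?y t) $ i) (at t)" for t i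
        using has_vector_derivative_diff[OF mexp_vector_derivative[where A=M and \<zeta>=\<zeta> and \<eta>=\<eta> and x=x]
            mexp_vector_derivative[where A=M and \<zeta>=\<zeta> and \<eta>=0 and x="mexp M \<eta> *v x"]]
        by (simp add: matrix_vector_mult_diff_distrib right_diff_distrib)
    qed
    then show ?thesis by (simp add: mexp_zero matrix_vector_mul_assoc)
  qed
  then show ?thesis by (simp add: matrix_eq)
qed

end

lemma cone_scale: "\<zeta> \<in> cone k K \<Longrightarrow> s \<ge> 0 \<Longrightarrow> complex_of_real s * \<zeta> \<in> cone k K"
  by (simp add: cone_def abs_mult mult_left_mono mult.left_commute)

section \<open>Cauchy estimates and sectors\<close>

lemma Cauchy_first:
  assumes "f holomorphic_on UNIV" "r > 0" "\<And>w. w \<in> ball z (2 * r) \<Longrightarrow> cmod (f w) \<le> B"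
  shows "cmod (deriv f z) \<le> B / r"
proof -
  have "cmod ((deriv ^^ 1) f z) \<le> fact 1 * B / r ^ 1"
  proof (rule Cauchy_inequality)
    show "cmod (f x) \<le> B" if "cmod (z - x) = r" for x using assms that by (intro assms(3)) (simp add: dist_norm)
  qed (use assms in \<open>auto intro: holomorphic_on_subset holomorphic_on_imp_continuous_on\<close>)
  then show ?thesis by simp
qed

text \<open>First-order Taylor expansion, with the second derivative estimated by Cauchy on circles
  of radius r/2: 2 B / (r/2)^2 = 8 B / r^2. The bound sees f only through B, hence is uniform over a
  family.\<close>

lemma Cauchy_difference_quotient:
  assumes f: "f holomorphic_on UNIV" and r: "r > 0" and B: "\<And>w. w \<in> ball z (2 * r) \<Longrightarrow> cmod (f w) \<le> B"
    and w: "w \<in> ball z r" "w \<noteq> z"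
  shows "cmod (inverse (w - z) * (f w - f z) - deriv f z) \<le> 8 * B / r\<^sup>2 * cmod (w - z)"
proof -
  have hol: "(deriv ^^ i) f holomorphic_on UNIV" for i by (intro holomorphic_higher_deriv f) auto
  have der: "((deriv ^^ i) f has_field_derivative (deriv ^^ Suc i) f x) (at x within S)" for i x S
    using holomorphic_derivI[OF hol open_UNIV UNIV_I] by simp
  have B2: "cmod ((deriv ^^ Suc 1) f x) \<le> 8 * B / r\<^sup>2" if x: "x \<in> ball z r" for x
  proof -
    have "cmod ((deriv ^^ 2) f x) \<le> fact 2 * B / (r/2) ^ 2"
    proof (rule Cauchy_inequality)
      show "cmod (f u) \<le> B" if "cmod (x - u) = r/2" for u
      proof (rule B)
        have "dist z u \<le> dist z x + dist x u" by (rule dist_triangle)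
        then show "u \<in> ball z (2 * r)" using x that r by (simp add: dist_norm)
      qed
    qed (use f r in \<open>auto intro: holomorphic_on_subset holomorphic_on_imp_continuous_on\<close>)
    then show ?thesis by (simp add: numeral_2_eq_2 power_divide field_simps)
  qed
  have "cmod ((deriv ^^ 0) f w - (\<Sum>i\<le>1. (deriv ^^ i) f z * (w - z) ^ i / fact i)) \<le> 8 * B / r\<^sup>2 * cmod (w - z) ^ Suc 1 / fact 1"
    by (rule complex_Taylor[of "ball z r" 1 "\<lambda>i. (deriv ^^ i) f"]) (use der B2 w r in auto)
  then have T: "cmod (f w - f z - deriv f z * (w - z)) \<le> 8 * B / r\<^sup>2 * cmod (w - z) * cmod (w - z)"
    by (simp add: diff_diff_eq power2_eq_square mult.assoc)
  have "inverse (w - z) * (f w - f z) - deriv f z = inverse (w - z) * (f w - f z - deriv f z * (w - z))"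
    using w by (simp add: field_simps)
  then have "cmod (inverse (w - z) * (f w - f z) - deriv f z) = inverse (cmod (w - z)) * cmod (f w - f z - deriv f z * (w - z))"
    by (simp add: norm_mult norm_inverse)
  also have "\<dots> \<le> inverse (cmod (w - z)) * (8 * B / r\<^sup>2 * cmod (w - z) * cmod (w - z))"
    by (intro mult_left_mono T) auto
  also have "\<dots> = 8 * B / r\<^sup>2 * cmod (w - z)" using w by simp
  finally show ?thesis .
qed

lemma sector_arctan:
  assumes "\<zeta> \<in> sector (arctan \<epsilon>)" "\<epsilon> > 0"
  shows "\<bar>Im \<zeta>\<bar> < \<epsilon> * Re \<zeta>"
proof -
  let ?A = "Arg \<zeta>"
  have z: "\<zeta> \<noteq> 0" "\<bar>?A\<bar> < arctan \<epsilon>" using assms by (auto simp: sector_def)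
  have lt: "\<bar>?A\<bar> < pi / 2" using z(2) arctan_ubound[of \<epsilon>] by linarith
  then have c: "cos ?A > 0" by (intro cos_gt_zero_pi) auto
  have "tan \<bar>?A\<bar> < tan (arctan \<epsilon>)" using z(2) lt arctan_ubound[of \<epsilon>] by (intro tan_monotone) auto
  then have "sin \<bar>?A\<bar> < \<epsilon> * cos ?A"
    using c by (simp only: tan_arctan) (simp add: tan_def divide_less_eq)
  moreover have "sin \<bar>?A\<bar> \<ge> 0" using lt by (intro sin_ge_zero) auto
  then have "\<bar>sin ?A\<bar> = sin \<bar>?A\<bar>" by (simp add: abs_if split: if_splits)
  ultimately have "\<bar>sin ?A\<bar> < \<epsilon> * cos ?A" by simp
  moreover have "Re \<zeta> = cmod \<zeta> * cos ?A" "Im \<zeta> = cmod \<zeta> * sin ?A"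
    using z(1) by (simp_all add: cos_Arg sin_Arg)
  ultimately show ?thesis using z(1) by (simp add: abs_mult mult.left_commute)
qed

lemma open_cone: "open {\<zeta>. \<bar>Im \<zeta>\<bar> < \<epsilon> * Re \<zeta>}"
  by (intro open_Collect_less continuous_intros)

section \<open>The phase space as a sum of modes\<close>

text \<open>A scalar matrix mixes the members of a quadruple and acts trivially inside the
  eigenspace, so eigenspaces of any dimension are treated without choosing a basis.\<close>

definition mact :: "complex ^ 4 ^ 4 \<Rightarrow> ('a::euclidean_space L2) ^ 4 \<Rightarrow> 'a L2 ^ 4" where
  "mact A y = (\<chi> i. \<Sum>j\<in>UNIV. A $ i $ j *\<^sub>C y $ j)"

lemma mact_nth: "mact A y $ i = (\<Sum>j\<in>UNIV. A $ i $ j *\<^sub>C y $ j)"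
  by (simp add: mact_def)

lemma scaleC_sum_left: "(\<Sum>i\<in>I. c i) *\<^sub>C (x :: 'b::complex_vec) = (\<Sum>i\<in>I. c i *\<^sub>C x)"
  by (induction I rule: infinite_finite_induct) (auto simp: scaleC_zero_left scaleC_add_left)

lemma mact_mact: "mact A (mact B y) = mact (A ** B) y"
proof -
  have "(\<Sum>j\<in>UNIV. A $ i $ j *\<^sub>C (\<Sum>k\<in>UNIV. B $ j $ k *\<^sub>C y $ k)) = (\<Sum>k\<in>UNIV. (\<Sum>j\<in>UNIV. A $ i $ j * B $ j $ k) *\<^sub>C y $ k)" for i
    unfolding scaleC_sum_right scaleC_sum_left scaleC_scaleC by (rule sum.swap)
  then show ?thesis by (simp add: mact_def vec_eq_iff matrix_matrix_mult_def)
qed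

lemma mact_add_right: "mact A (x + y) = mact A x + mact A y"
  by (simp add: mact_def vec_eq_iff scaleC_add_right sum.distrib)

lemma mact_diff_right: "mact A (x - y) = mact A x - mact A y"
  by (simp add: mact_def vec_eq_iff scaleC_diff_right sum_subtractf)

lemma mact_diff_left: "mact (A - B) x = mact A x - mact B x"
  by (simp add: mact_def vec_eq_iff scaleC_diff_left sum_subtractf)

lemma mat_mult_nth: "(mat c ** A) $ i $ j = c * A $ i $ j" for A :: "complex ^ 4 ^ 4"
proof -
  have "(\<Sum>k\<in>UNIV. (if i = k then c else 0) * A $ k $ j) = (\<Sum>k\<in>UNIV. if i = k then c * A $ k $ j else 0)"
    by (rule sum.cong) auto
  then show ?thesis by (simp add: matrix_matrix_mult_def mat_def)
qed

text \<open>Scalar multiples of quadruples are written \<open>mact (mat c)\<close>, which places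
  them under the composition law \<open>mact_mact\<close>.\<close>

lemma mact_mat_nth: "mact (mat c) y $ i = c *\<^sub>C y $ i"
proof -
  have "(\<Sum>j\<in>UNIV. (if i = j then c else 0) *\<^sub>C y $ j) = (\<Sum>j\<in>UNIV. if i = j then c *\<^sub>C y $ j else 0)"
    by (intro sum.cong) (auto simp: scaleC_zero_left)
  then show ?thesis by (simp add: mact_nth mat_def)
qed

lemma mact_mat_1: "mact (mat 1) y = y"
  by (simp add: vec_eq_iff mact_mat_nth scaleC_one)

lemma mact_zero: "mact A 0 = 0"
  by (simp add: vec_eq_iff mact_nth scaleC_zero_right)

lemma norm_mact: "norm (mact A y) \<le> norm A * norm y"
proof -
  have "norm (mact A y $ i) \<le> norm (A $ i) * norm y" for i
  proof -
    have "norm (mact A y $ i) \<le> (\<Sum>j\<in>UNIV. \<bar>cmod (A $ i $ j)\<bar> * \<bar>norm (y $ j)\<bar>)"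
      by (auto simp: mact_nth norm_scaleC intro!: order_trans[OF norm_sum])
    also have "\<dots> \<le> norm (A $ i) * norm y"
      unfolding norm_vec_def by (rule L2_set_mult_ineq)
    finally show ?thesis .
  qed
  then have "L2_set (\<lambda>i. norm (mact A y $ i)) UNIV \<le> L2_set (\<lambda>i. norm (A $ i) * norm y) UNIV"
    by (intro L2_set_mono) auto
  also have "\<dots> = L2_set (\<lambda>i. norm (A $ i)) UNIV * norm y"
    by (rule L2_set_left_distrib[symmetric]) simp
  finally show ?thesis by (simp add: norm_vec_def)
qed

section \<open>Coordinates on the phase space\<close>

definition coord :: "'a::euclidean_space phase \<Rightarrow> 'a L2 ^ 4" where
  "coord U = (case U of (u, v, w, z) \<Rightarrow> vector [u, v, w, z])"

definition of_coord :: "'a::euclidean_space L2 ^ 4 \<Rightarrow> 'a phase" where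
  "of_coord y = (y $ 1, y $ 2, y $ 3, y $ 4)"

lemma coord_of_coord: "coord (of_coord y) = y"
  by (simp add: coord_def of_coord_def vec_eq_iff forall_4 vector_4)

lemma of_coord_coord: "of_coord (coord U) = U"
  by (simp add: coord_def of_coord_def vector_4 split: prod.split)

lemma coord_add: "coord (U + V) = coord U + coord V"
  by (simp add: coord_def vec_eq_iff forall_4 vector_4 split: prod.split)

lemma coord_scaleC: "coord (c *\<^sub>C U) $ i = c *\<^sub>C coord U $ i"
proof -
  have "\<forall>i. coord (c *\<^sub>C U) $ i = c *\<^sub>C coord U $ i"
    by (simp add: coord_def forall_4 vector_4 scaleC_prod_def split: prod.split)
  then show ?thesis by blast
qed

locale plate = dirichlet_domain \<Omega> for \<Omega> :: "'a::euclidean_space set" +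
  fixes \<alpha> \<kappa> \<gamma> \<delta> :: real
  assumes alpha: "\<alpha> > 0" and kappa: "\<kappa> > 0" and gamma: "\<gamma> > 0" and delta: "\<delta> > 0"
begin

abbreviation "\<Lambda> \<equiv> eigenvalues \<Omega>"
abbreviation "X \<equiv> phase_space \<Omega> 1"
abbreviation "N \<equiv> phase_norm \<Omega> \<alpha> \<kappa> 1"

text \<open>The exponents s of the four factors D(A^s) of the phase space for \<beta> = 1.\<close>

definition expo :: "real ^ 4" where "expo = vector [1, 1/2, 1/2, 0]"

text \<open>The weights for which the phase norm is the $\ell^2$-norm of the weighted spectral
  components.\<close>

definition wt :: "real \<Rightarrow> real ^ 4" where
  "wt \<mu> = vector [sqrt \<alpha> * \<mu>, sqrt (\<alpha> * \<mu>), sqrt (1 + \<kappa> * \<mu>), 1]"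

lemma X_iff: "U \<in> X \<longleftrightarrow> (\<forall>i. coord U $ i \<in> dom_pow \<Omega> (expo $ i))"
  by (cases U) (auto simp: phase_space_def coord_def expo_def forall_4 vector_4)

lemma expo_nonneg: "expo $ i \<ge> 0"
proof -
  have "\<forall>i. expo $ i \<ge> 0" by (simp add: expo_def forall_4 vector_4)
  then show ?thesis by blast
qed

lemma wt_pos:
  assumes "\<mu> > 0"
  shows "wt \<mu> $ i > 0"
proof -
  have "\<forall>i. wt \<mu> $ i > 0"
    using assms alpha kappa by (simp add: wt_def forall_4 vector_4 add_pos_pos)
  then show ?thesis by blast
qed

lemma wt_eigenvalue_pos: "\<mu> \<in> \<Lambda> \<Longrightarrow> wt \<mu> $ i > 0"
  by (rule wt_pos[OF eigenvalue_pos])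

text \<open>The constants are \<alpha>, \<alpha>, \<kappa> and 1, uniformly over the spectrum. They
  turn square-summability of energy coordinates into membership in the domains of the fractional
  powers.\<close>

lemma wt_lower: "\<exists>p>0. \<forall>\<mu>\<in>\<Lambda>. p * (\<mu> powr (expo $ i))\<^sup>2 \<le> (wt \<mu> $ i)\<^sup>2"
proof -
  have "\<forall>i. \<exists>p>0. \<forall>\<mu>\<in>\<Lambda>. p * (\<mu> powr (expo $ i))\<^sup>2 \<le> (wt \<mu> $ i)\<^sup>2"
    unfolding forall_4
  proof (intro conjI)
    show "\<exists>p>0. \<forall>\<mu>\<in>\<Lambda>. p * (\<mu> powr (expo $ 1))\<^sup>2 \<le> (wt \<mu> $ 1)\<^sup>2"
      by (rule exI[of _ \<alpha>]) (use alpha in \<open>auto simp: expo_def wt_def vector_4 power_mult_distrib dest: eigenvalue_pos\<close>)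
    show "\<exists>p>0. \<forall>\<mu>\<in>\<Lambda>. p * (\<mu> powr (expo $ 2))\<^sup>2 \<le> (wt \<mu> $ 2)\<^sup>2"
      by (rule exI[of _ \<alpha>]) (use alpha in \<open>auto simp: expo_def wt_def vector_4 powr_half_sqrt dest!: eigenvalue_pos\<close>)
    show "\<exists>p>0. \<forall>\<mu>\<in>\<Lambda>. p * (\<mu> powr (expo $ 3))\<^sup>2 \<le> (wt \<mu> $ 3)\<^sup>2"
      by (rule exI[of _ \<kappa>]) (use kappa in \<open>auto simp: expo_def wt_def vector_4 powr_half_sqrt dest!: eigenvalue_pos\<close>)
    show "\<exists>p>0. \<forall>\<mu>\<in>\<Lambda>. p * (\<mu> powr (expo $ 4))\<^sup>2 \<le> (wt \<mu> $ 4)\<^sup>2"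
      by (rule exI[of _ 1]) (auto simp: expo_def wt_def vector_4 dest!: eigenvalue_pos)
  qed
  then show ?thesis by blast
qed

text \<open>Energy coordinates of the spectral component at \<mu>. By \<open>N_has_sum\<close> this
  is an isometry of the phase space onto the families described by \<open>good\<close>, with inverse
  \<open>synth\<close>.\<close>

definition analysis :: "'a phase \<Rightarrow> real \<Rightarrow> 'a L2 ^ 4" where
  "analysis U \<mu> = (\<chi> i. wt \<mu> $ i *\<^sub>R components \<Omega> (coord U $ i) \<mu>)"

definition synth :: "(real \<Rightarrow> 'a L2 ^ 4) \<Rightarrow> 'a phase" where
  "synth Y = of_coord (\<chi> i. synthesis \<Omega> (\<lambda>\<mu>. inverse (wt \<mu> $ i) *\<^sub>R Y \<mu> $ i))"

definition good :: "(real \<Rightarrow> 'a L2 ^ 4) \<Rightarrow> bool" where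
  "good Y \<longleftrightarrow> (\<forall>\<mu> i. Y \<mu> $ i \<in> eigenspace \<Omega> \<mu>) \<and> (\<lambda>\<mu>. (norm (Y \<mu>))\<^sup>2) summable_on \<Lambda>"

lemma X_expansion: "U \<in> X \<Longrightarrow> is_expansion \<Omega> (coord U $ i) (components \<Omega> (coord U $ i))"
  using dom_pow_expansion by (auto simp: X_iff)

lemma X_components: "U \<in> X \<Longrightarrow> components \<Omega> (coord U $ i) \<mu> \<in> eigenspace \<Omega> \<mu>"
  using components_eigenspace by (auto simp: X_iff)

lemma analysis_eigenspace: "U \<in> X \<Longrightarrow> analysis U \<mu> $ i \<in> eigenspace \<Omega> \<mu>"
  by (simp add: analysis_def eigenspace_scaleR X_components)

lemma eigenfamily_outside: "(\<And>i. y $ i \<in> eigenspace \<Omega> \<mu>) \<Longrightarrow> \<mu> \<notin> \<Lambda> \<Longrightarrow> y = 0" for y :: "'a L2 ^ 4"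
  using eigenspace_trivial by (simp add: vec_eq_iff)

lemma analysis_synth:
  assumes "good Y"
  shows "synth Y \<in> X" "analysis (synth Y) = Y"
proof -
  have Y: "\<And>\<mu> i. Y \<mu> $ i \<in> eigenspace \<Omega> \<mu>" "(\<lambda>\<mu>. (norm (Y \<mu>))\<^sup>2) summable_on \<Lambda>"
    using assms by (auto simp: good_def)
  let ?x = "\<lambda>i \<mu>. inverse (wt \<mu> $ i) *\<^sub>R Y \<mu> $ i"
  have c: "coord (synth Y) $ i = synthesis \<Omega> (?x i)" for i
    by (simp add: synth_def coord_of_coord)
  have s: "(\<lambda>\<mu>. (\<mu> powr (expo $ i) * norm (?x i \<mu>))\<^sup>2) summable_on \<Lambda>" for i
  proof -
    obtain p where p: "p > 0" "\<forall>\<mu>\<in>\<Lambda>. p * (\<mu> powr (expo $ i))\<^sup>2 \<le> (wt \<mu> $ i)\<^sup>2" using wt_lower by blast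
    have "(\<lambda>\<mu>. inverse p * (norm (Y \<mu>))\<^sup>2) summable_on \<Lambda>"
      by (rule summable_on_cmult_right[OF Y(2)])
    then show ?thesis
    proof (rule summable_on_comparison_test)
      fix \<mu> assume m: "\<mu> \<in> \<Lambda>"
      have w: "wt \<mu> $ i > 0" by (rule wt_eigenvalue_pos[OF m])
      have "(\<mu> powr (expo $ i) * norm (?x i \<mu>))\<^sup>2 = (\<mu> powr (expo $ i))\<^sup>2 * inverse ((wt \<mu> $ i)\<^sup>2) * (norm (Y \<mu> $ i))\<^sup>2"
        by (simp add: power_mult_distrib power_inverse)
      also have "\<dots> \<le> inverse p * (norm (Y \<mu>))\<^sup>2"
      proof (intro mult_mono)
        show "(\<mu> powr (expo $ i))\<^sup>2 * inverse ((wt \<mu> $ i)\<^sup>2) \<le> inverse p"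
          using p m w by (auto simp: field_simps)
        show "(norm (Y \<mu> $ i))\<^sup>2 \<le> (norm (Y \<mu>))\<^sup>2"
          by (intro power_mono Finite_Cartesian_Product.norm_nth_le) auto
      qed (use p in auto)
      finally show "(\<mu> powr (expo $ i) * norm (?x i \<mu>))\<^sup>2 \<le> inverse p * (norm (Y \<mu>))\<^sup>2" .
    qed auto
  qed
  have e: "eigenfamily (?x i)" for i using Y(1) by (auto intro: eigenspace_scaleR)
  note d = dom_pow_synthesis[OF e expo_nonneg s]
  show "synth Y \<in> X" unfolding X_iff c using d(1) by blast
  show "analysis (synth Y) = Y"
  proof
    show "analysis (synth Y) \<mu> = Y \<mu>" for \<mu>
    proof (cases "\<mu> \<in> \<Lambda>")
      case True
      then have "wt \<mu> $ i \<noteq> 0" for i using wt_eigenvalue_pos[of \<mu> i] by simp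
      then show ?thesis unfolding analysis_def c d(2) by (simp add: vec_eq_iff)
    next
      \<comment> \<open>Off the spectrum a weight may vanish, but so does the family.\<close>
      case False
      then have "Y \<mu> = 0" using Y(1) by (intro eigenfamily_outside) auto
      then show ?thesis unfolding analysis_def c d(2) by (simp add: vec_eq_iff)
    qed
  qed
qed

lemma X_eqI:
  assumes "U \<in> X" "V \<in> X" "\<And>\<mu>. \<mu> \<in> \<Lambda> \<Longrightarrow> analysis U \<mu> = analysis V \<mu>"
  shows "U = V"
proof -
  have "components \<Omega> (coord U $ i) \<mu> = components \<Omega> (coord V $ i) \<mu>" for i \<mu>
  proof (cases "\<mu> \<in> \<Lambda>")
    case True
    then have "wt \<mu> $ i *\<^sub>R components \<Omega> (coord U $ i) \<mu> = wt \<mu> $ i *\<^sub>R components \<Omega> (coord V $ i) \<mu>"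
      using assms(3)[OF True] by (simp add: analysis_def vec_eq_iff)
    then show ?thesis using wt_eigenvalue_pos[OF True, of i] by simp
  next
    case False
    then show ?thesis using X_components assms(1,2) eigenspace_trivial by metis
  qed
  then have "components \<Omega> (coord U $ i) = components \<Omega> (coord V $ i)" for i by blast
  then have "coord U $ i = coord V $ i" for i
    using expansion_eq X_expansion[OF assms(1)] X_expansion[OF assms(2)] by metis
  then have "coord U = coord V" by (simp add: vec_eq_iff)
  then show ?thesis by (metis of_coord_coord)
qed

lemma X_add: "U \<in> X \<Longrightarrow> V \<in> X \<Longrightarrow> U + V \<in> X"
  by (simp add: X_iff coord_add dom_pow_add)

lemma X_scaleC: "U \<in> X \<Longrightarrow> c *\<^sub>C U \<in> X"
  by (simp add: X_iff coord_scaleC dom_pow_scaleC)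

lemma X_diff: "U \<in> X \<Longrightarrow> V \<in> X \<Longrightarrow> U - V \<in> X"
  using X_add[of U "(-1) *\<^sub>C V"] X_scaleC[of V "-1"] by (simp add: scaleC_minus_one)

lemma analysis_add:
  assumes "U \<in> X" "V \<in> X"
  shows "analysis (U + V) \<mu> = analysis U \<mu> + analysis V \<mu>"
proof -
  have "components \<Omega> (coord U $ i + coord V $ i) = (\<lambda>\<mu>. components \<Omega> (coord U $ i) \<mu> + components \<Omega> (coord V $ i) \<mu>)" for i
    using assms unfolding X_iff by (intro components_add) auto
  then show ?thesis by (simp add: analysis_def coord_add vec_eq_iff scaleR_add_right)
qed

lemma analysis_scaleC:
  assumes "U \<in> X"
  shows "analysis (c *\<^sub>C U) \<mu> = mact (mat c) (analysis U \<mu>)"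
proof -
  have "components \<Omega> (c *\<^sub>C coord U $ i) = (\<lambda>\<mu>. c *\<^sub>C components \<Omega> (coord U $ i) \<mu>)" for i
    using assms unfolding X_iff by (intro components_scaleC) auto
  then show ?thesis
    by (simp add: analysis_def coord_scaleC vec_eq_iff mact_mat_nth scaleC_of_real[symmetric] scaleC_scaleC mult.commute)
qed

lemma analysis_diff:
  assumes "U \<in> X" "V \<in> X"
  shows "analysis (U - V) \<mu> = analysis U \<mu> - analysis V \<mu>"
proof -
  have "analysis (U + (-1) *\<^sub>C V) \<mu> = analysis U \<mu> + mact (mat (-1)) (analysis V \<mu>)"
    using assms by (simp add: analysis_add X_scaleC analysis_scaleC)
  moreover have "mact (mat (-1)) (analysis V \<mu>) = - analysis V \<mu>"
    by (simp add: vec_eq_iff mact_mat_nth scaleC_minus_one)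
  ultimately show ?thesis by (simp add: scaleC_minus_one)
qed

lemma norm_analysis: "(norm (analysis U \<mu>))\<^sup>2 = (\<Sum>i\<in>UNIV. (wt \<mu> $ i * norm (components \<Omega> (coord U $ i) \<mu>))\<^sup>2)"
  by (simp add: norm_vec_def L2_set_def analysis_def sum_nonneg power_mult_distrib)

text \<open>Parseval's identity for each of the five terms of the phase norm; the two terms in w
  combine to the weight 1 + \<kappa>\<mu>.\<close>

lemma N_has_sum:
  assumes "U \<in> X"
  shows "((\<lambda>\<mu>. (norm (analysis U \<mu>))\<^sup>2) has_sum (N U)\<^sup>2) \<Lambda>"
proof -
  obtain u v w z where U: "U = (u, v, w, z)" by (cases U) auto
  have d: "u \<in> dom_pow \<Omega> 1" "v \<in> dom_pow \<Omega> (1/2)" "w \<in> dom_pow \<Omega> (1/2)" "z \<in> dom_pow \<Omega> 0"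
    using assms by (auto simp: U phase_space_def)
  let ?n = "\<lambda>u \<mu>. norm (components \<Omega> u \<mu>)"
  have "((\<lambda>\<mu>. \<alpha> * (\<mu> powr 1 * ?n u \<mu>)\<^sup>2 + \<alpha> * (\<mu> powr (1/2) * ?n v \<mu>)\<^sup>2 + (?n w \<mu>)\<^sup>2
      + \<kappa> * (\<mu> powr (1/2) * ?n w \<mu>)\<^sup>2 + (?n z \<mu>)\<^sup>2) has_sum
    (\<alpha> * (norm (pow_A \<Omega> 1 u))\<^sup>2 + \<alpha> * (norm (pow_A \<Omega> (1/2) v))\<^sup>2
           + (norm w)\<^sup>2 + \<kappa> * (norm (pow_A \<Omega> (1/2) w))\<^sup>2 + (norm z)\<^sup>2)) \<Lambda>"
    by (intro has_sum_add has_sum_cmult_right pow_A_norm d dom_pow_norm[OF d(3)] dom_pow_norm[OF d(4)])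
  also have "(\<alpha> * (norm (pow_A \<Omega> 1 u))\<^sup>2 + \<alpha> * (norm (pow_A \<Omega> (1/2) v))\<^sup>2
           + (norm w)\<^sup>2 + \<kappa> * (norm (pow_A \<Omega> (1/2) w))\<^sup>2 + (norm z)\<^sup>2) = (N U)\<^sup>2"
    using alpha kappa by (simp add: U phase_norm_def add_nonneg_nonneg)
  finally show ?thesis
  proof (rule has_sum_cong[THEN iffD1, rotated])
    fix \<mu> assume "\<mu> \<in> \<Lambda>"
    then have "\<mu> > 0" by (rule eigenvalue_pos)
    then show "\<alpha> * (\<mu> powr 1 * ?n u \<mu>)\<^sup>2 + \<alpha> * (\<mu> powr (1/2) * ?n v \<mu>)\<^sup>2 + (?n w \<mu>)\<^sup>2
      + \<kappa> * (\<mu> powr (1/2) * ?n w \<mu>)\<^sup>2 + (?n z \<mu>)\<^sup>2 = (norm (analysis U \<mu>))\<^sup>2"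
      using alpha kappa by (simp add: norm_analysis sum_4 U coord_def wt_def vector_4 power_mult_distrib powr_half_sqrt distrib_right)
  qed
qed

lemma N_nonneg: "N U \<ge> 0"
  using alpha kappa by (auto simp: phase_norm_def split: prod.split intro!: add_nonneg_nonneg)

text \<open>Operator bounds are checked mode by mode with a constant independent of \<mu>; this
  carries them over to the phase space.\<close>

lemma N_le:
  assumes "U \<in> X" "V \<in> X" "C \<ge> 0" "\<And>\<mu>. \<mu> \<in> \<Lambda> \<Longrightarrow> norm (analysis V \<mu>) \<le> C * norm (analysis U \<mu>)"
  shows "N V \<le> C * N U"
proof (rule power2_le_imp_le)
  have "(N V)\<^sup>2 \<le> C\<^sup>2 * (N U)\<^sup>2"
  proof (rule has_sum_mono[OF N_has_sum[OF assms(2)] has_sum_cmult_right[OF N_has_sum[OF assms(1)]]])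
    show "(norm (analysis V \<mu>))\<^sup>2 \<le> C\<^sup>2 * (norm (analysis U \<mu>))\<^sup>2" if "\<mu> \<in> \<Lambda>" for \<mu>
      unfolding power_mult_distrib[symmetric] using assms(4)[OF that] by (rule power_mono) simp
  qed
  then show "(N V)\<^sup>2 \<le> (C * N U)\<^sup>2" by (simp add: power_mult_distrib)
  show "0 \<le> C * N U" using assms(3) N_nonneg by simp
qed

lemma N_zero_imp:
  assumes "U \<in> X" "N U = 0"
  shows "U = 0"
proof -
  have z: "0 \<in> X" using X_diff[OF assms(1) assms(1)] by simp
  have h: "((\<lambda>\<mu>. (norm (analysis U \<mu>))\<^sup>2) has_sum 0) \<Lambda>" using N_has_sum[OF assms(1)] assms(2) by simp
  have "analysis U \<mu> = 0" if "\<mu> \<in> \<Lambda>" for \<mu>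
  proof -
    have "((\<lambda>\<mu>. (norm (analysis U \<mu>))\<^sup>2) has_sum (norm (analysis U \<mu>))\<^sup>2) {\<mu>}"
      using has_sum_finite[of "{\<mu>}" "\<lambda>\<mu>. (norm (analysis U \<mu>))\<^sup>2"] by simp
    then have "(norm (analysis U \<mu>))\<^sup>2 \<le> 0"
      by (rule has_sum_mono2[OF _ h]) (use that in auto)
    then show ?thesis by simp
  qed
  moreover have "analysis 0 \<mu> = 0" for \<mu> using analysis_diff[OF assms(1) assms(1)] by simp
  ultimately show ?thesis using assms(1) z by (intro X_eqI) auto
qed

lemma pow_A_add:
  assumes "u \<in> dom_pow \<Omega> s" "v \<in> dom_pow \<Omega> s"
  shows "pow_A \<Omega> s (u + v) = pow_A \<Omega> s u + pow_A \<Omega> s v"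
  using pow_A_expansion[OF dom_pow_add[OF assms]] expansion_add[OF pow_A_expansion[OF assms(1)] pow_A_expansion[OF assms(2)]]
  by (intro expansion_eq) (auto simp: components_add[OF assms] scaleR_add_right)

text \<open>The phase norm is the product norm of an additive image in five copies of L2, from which
  it inherits the triangle inequality.\<close>

lemma N_triangle:
  assumes "U \<in> X" "V \<in> X"
  shows "N (U + V) \<le> N U + N V"
proof -
  let ?\<Phi> = "\<lambda>(u, v, w, z). (sqrt \<alpha> *\<^sub>R pow_A \<Omega> 1 u, sqrt \<alpha> *\<^sub>R pow_A \<Omega> (1/2) v, w, sqrt \<kappa> *\<^sub>R pow_A \<Omega> (1/2) w, z)"
  have n: "N U = norm (?\<Phi> U)" for U
    using alpha kappa by (simp add: phase_norm_def norm_Pair power_mult_distrib add.assoc add_nonneg_nonneg split: prod.split)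
  have "?\<Phi> (U + V) = ?\<Phi> U + ?\<Phi> V"
    using assms by (cases U; cases V) (simp add: phase_space_def pow_A_add scaleR_add_right)
  then show ?thesis by (simp only: n norm_triangle_ineq)
qed

lemma N_scaleC:
  assumes "U \<in> X"
  shows "N (c *\<^sub>C U) = cmod c * N U"
proof -
  have "norm (analysis (c *\<^sub>C U) \<mu>) = cmod c * norm (analysis U \<mu>)" for \<mu>
    unfolding analysis_scaleC[OF assms] norm_vec_def mact_mat_nth norm_scaleC
    by (rule L2_set_right_distrib[symmetric]) simp
  then have "((\<lambda>\<mu>. (norm (analysis (c *\<^sub>C U) \<mu>))\<^sup>2) has_sum (cmod c * N U)\<^sup>2) \<Lambda>"
    unfolding power_mult_distrib by (simp only: power_mult_distrib has_sum_cmult_right[OF N_has_sum[OF assms]])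
  then have "(N (c *\<^sub>C U))\<^sup>2 = (cmod c * N U)\<^sup>2"
    using has_sum_unique[OF N_has_sum[OF X_scaleC[OF assms]]] by blast
  then show ?thesis by (rule power2_eq_imp_eq) (auto simp: N_nonneg)
qed

section \<open>Block-diagonal multipliers\<close>

definition Mult :: "(real \<Rightarrow> complex ^ 4 ^ 4) \<Rightarrow> 'a phase \<Rightarrow> 'a phase" where
  "Mult m U = synth (\<lambda>\<mu>. mact (m \<mu>) (analysis U \<mu>))"

lemma eigenspace_mact: "(\<And>j. y $ j \<in> eigenspace \<Omega> \<mu>) \<Longrightarrow> mact A y $ i \<in> eigenspace \<Omega> \<mu>"
  by (simp add: mact_nth eigenspace_sum eigenspace_scaleC)

text \<open>Uniform boundedness of the matrices over the spectrum keeps the image family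
  square-summable, so \<open>synth\<close> gives it a meaning.\<close>

lemma Mult_props:
  assumes "\<And>\<mu>. \<mu> \<in> \<Lambda> \<Longrightarrow> norm (m \<mu>) \<le> C" "U \<in> X"
  shows "Mult m U \<in> X" "analysis (Mult m U) \<mu> = mact (m \<mu>) (analysis U \<mu>)"
proof -
  have "good (\<lambda>\<mu>. mact (m \<mu>) (analysis U \<mu>))"
    unfolding good_def
  proof (intro conjI allI)
    show "mact (m \<mu>) (analysis U \<mu>) $ i \<in> eigenspace \<Omega> \<mu>" for \<mu> i
      by (intro eigenspace_mact analysis_eigenspace assms)
    have "(\<lambda>\<mu>. C\<^sup>2 * (norm (analysis U \<mu>))\<^sup>2) summable_on \<Lambda>"
      by (intro summable_on_cmult_right has_sum_imp_summable[OF N_has_sum] assms)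
    then show "(\<lambda>\<mu>. (norm (mact (m \<mu>) (analysis U \<mu>)))\<^sup>2) summable_on \<Lambda>"
    proof (rule summable_on_comparison_test)
      fix \<mu> assume "\<mu> \<in> \<Lambda>"
      then have "norm (mact (m \<mu>) (analysis U \<mu>)) \<le> C * norm (analysis U \<mu>)"
        by (intro order_trans[OF norm_mact] mult_right_mono assms) auto
      then show "(norm (mact (m \<mu>) (analysis U \<mu>)))\<^sup>2 \<le> C\<^sup>2 * (norm (analysis U \<mu>))\<^sup>2"
        unfolding power_mult_distrib[symmetric] by (rule power_mono) simp
    qed auto
  qed
  note * = analysis_synth[OF this, folded Mult_def]
  show "Mult m U \<in> X" "analysis (Mult m U) \<mu> = mact (m \<mu>) (analysis U \<mu>)" using * by simp_all
qed

lemma N_Mult_le: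
  assumes "\<And>\<mu>. \<mu> \<in> \<Lambda> \<Longrightarrow> norm (m \<mu>) \<le> C" "C \<ge> 0" "U \<in> X"
  shows "N (Mult m U) \<le> C * N U"
proof (rule N_le[OF assms(3) Mult_props(1)[where m=m, OF assms(1,3)] assms(2)])
  fix \<mu> assume "\<mu> \<in> \<Lambda>"
  then have "norm (mact (m \<mu>) (analysis U \<mu>)) \<le> C * norm (analysis U \<mu>)"
    by (intro order_trans[OF norm_mact] mult_right_mono assms) auto
  then show "norm (analysis (Mult m U) \<mu>) \<le> C * norm (analysis U \<mu>)"
    using Mult_props(2)[where m=m, OF assms(1,3)] by metis
qed

lemma mat_commute: "mat c ** A = A ** mat c" for A :: "complex ^ 4 ^ 4"
proof -
  have "(\<Sum>k\<in>UNIV. A $ i $ k * (if k = j then c else 0)) = (\<Sum>k\<in>UNIV. if k = j then A $ i $ k * c else 0)" for i j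
    by (rule sum.cong) auto
  then have "(A ** mat c) $ i $ j = c * A $ i $ j" for i j
    by (simp add: matrix_matrix_mult_def mat_def mult.commute)
  then show ?thesis by (simp add: vec_eq_iff mat_mult_nth)
qed

lemma Mult_bounded_operator:
  assumes "\<And>\<mu>. \<mu> \<in> \<Lambda> \<Longrightarrow> norm (m \<mu>) \<le> C" "C \<ge> 0"
  shows "bounded_operator X N (Mult m)"
proof -
  note M = Mult_props[where m=m, OF assms(1)]
  show ?thesis
    unfolding bounded_operator_def
  proof (intro conjI ballI allI exI)
    fix U assume U: "U \<in> X"
    show "Mult m U \<in> X" by (rule M(1)[OF _ U])
    show "N (Mult m U) \<le> C * N U" by (rule N_Mult_le[where m=m, OF assms(1) assms(2) U])
    show "Mult m (c *\<^sub>C U) = c *\<^sub>C Mult m U" for c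
    proof (rule X_eqI)
      show "Mult m (c *\<^sub>C U) \<in> X" "c *\<^sub>C Mult m U \<in> X" by (rule M(1)[OF _ X_scaleC[OF U]], assumption) (rule X_scaleC[OF M(1)[OF _ U]], assumption)
      show "analysis (Mult m (c *\<^sub>C U)) \<mu> = analysis (c *\<^sub>C Mult m U) \<mu>" for \<mu>
        by (simp only: M X_scaleC analysis_scaleC U mact_mact mat_commute[of c "m \<mu>"])
    qed
    fix V assume V: "V \<in> X"
    show "Mult m (U + V) = Mult m U + Mult m V"
    proof (rule X_eqI)
      show "Mult m (U + V) \<in> X" "Mult m U + Mult m V \<in> X" by (rule M(1)[OF _ X_add[OF U V]], assumption) (rule X_add[OF M(1)[OF _ U] M(1)[OF _ V]], assumption+)
      show "analysis (Mult m (U + V)) \<mu> = analysis (Mult m U + Mult m V) \<mu>" for \<mu>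
        by (simp only: M X_add analysis_add U V mact_add_right)
    qed
  qed
qed

end

section \<open>The modes of the plate\<close>

lemma mact_modes_matrix:
  "mact (modes_matrix P Q R D) y $ 1 = P *\<^sub>R y $ 3"
  "mact (modes_matrix P Q R D) y $ 2 = Q *\<^sub>R y $ 4"
  "mact (modes_matrix P Q R D) y $ 3 = - (P *\<^sub>R y $ 1) - R *\<^sub>R y $ 4"
  "mact (modes_matrix P Q R D) y $ 4 = - (Q *\<^sub>R y $ 2) + R *\<^sub>R y $ 3 - D *\<^sub>R y $ 4"
  by (simp_all add: modes_matrix_def mact_nth sum_4 vector_4 scaleC_of_real scaleC_zero_left scaleC_minus_left)

context plate
begin

text \<open>The parameter h of the modes: \<mu>^(1/2) divided by the weight of the third
  coordinate.\<close>

definition coupling :: "real \<Rightarrow> real" where "coupling \<mu> = sqrt (\<mu> / (1 + \<kappa> * \<mu>))"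

definition mode_matrix :: "real \<Rightarrow> complex ^ 4 ^ 4" where
  "mode_matrix \<mu> = modes_matrix (sqrt \<alpha> * coupling \<mu>) (sqrt \<alpha>) (\<gamma> * coupling \<mu>) \<delta>"

definition G :: "real \<Rightarrow> complex \<Rightarrow> complex ^ 4 ^ 4" where
  "G \<mu> \<zeta> = mexp (mode_matrix \<mu>) (complex_of_real (sqrt \<mu>) * \<zeta>)"

text \<open>All that the sequel uses of the Lyapunov analysis, for one opening valid at every
  eigenvalue. Only \<zeta> is confined to the closed cone; the increment \<eta> is
  arbitrary.\<close>

definition stable :: "real \<Rightarrow> bool" where
  "stable \<epsilon> \<longleftrightarrow> \<epsilon> > 0 \<and> (\<forall>\<mu>\<in>\<Lambda>. \<forall>\<zeta>. \<bar>Im \<zeta>\<bar> \<le> \<epsilon> * Re \<zeta> \<longrightarrow>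
     (\<forall>i j. cmod (G \<mu> \<zeta> $ i $ j) \<le> 2) \<and> (\<forall>\<eta>. G \<mu> (\<zeta> + \<eta>) = G \<mu> \<zeta> ** G \<mu> \<eta>))"

lemma stable_exists: "\<exists>\<epsilon>. stable \<epsilon>"
proof -
  obtain c where c: "c > 0" "\<And>\<mu>. \<mu> \<in> \<Lambda> \<Longrightarrow> c \<le> \<mu>" by (rule eigenvalues_bounded_below) blast
  \<comment> \<open>The function t / (1 + \<kappa> t) increases towards 1/\<kappa>, so h lies
    between its value at the spectral bound c and h1.\<close>
  define h0 where "h0 = sqrt (c / (1 + \<kappa> * c))"
  define h1 where "h1 = sqrt (1 / \<kappa>)"
  have h0: "h0 > 0" using c kappa by (auto simp: h0_def intro!: divide_pos_pos add_pos_pos)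
  define k where "k = min (min (sqrt \<alpha> * h0) (sqrt \<alpha>)) (min (\<gamma> * h0) \<delta>)"
  define K where "K = Max {1, sqrt \<alpha> * h1, sqrt \<alpha>, \<gamma> * h1, \<delta>}"
  have k: "k > 0" "k \<le> sqrt \<alpha> * h0" "k \<le> sqrt \<alpha>" "k \<le> \<gamma> * h0" "k \<le> \<delta>"
    using h0 alpha gamma delta by (auto simp: k_def)
  have K: "1 \<le> K" "sqrt \<alpha> * h1 \<le> K" "sqrt \<alpha> \<le> K" "\<gamma> * h1 \<le> K" "\<delta> \<le> K"
    by (auto simp: K_def)
  have modes: "coupled_modes k K (sqrt \<alpha> * coupling \<mu>) (sqrt \<alpha>) (\<gamma> * coupling \<mu>) \<delta>" if "\<mu> \<in> \<Lambda>" for \<mu>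
  proof -
    have mu: "c \<le> \<mu>" "\<mu> > 0" using c(2)[OF that] eigenvalue_pos[OF that] by auto
    have "c / (1 + \<kappa> * c) \<le> \<mu> / (1 + \<kappa> * \<mu>)"
    proof (rule mult_imp_le_div_pos)
      have p: "1 + \<kappa> * c > 0" using c kappa by (simp add: add_pos_pos)
      show "1 + \<kappa> * \<mu> > 0" using mu kappa by (simp add: add_pos_pos)
      have "c * (1 + \<kappa> * \<mu>) \<le> \<mu> * (1 + \<kappa> * c)" using mu by (simp add: algebra_simps)
      then show "c / (1 + \<kappa> * c) * (1 + \<kappa> * \<mu>) \<le> \<mu>" using p by (simp add: pos_divide_le_eq)
    qed
    then have l: "h0 \<le> coupling \<mu>" by (simp add: h0_def coupling_def)
    have "\<mu> / (1 + \<kappa> * \<mu>) \<le> 1 / \<kappa>" using mu kappa by (simp add: field_simps add_pos_pos)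
    then have u: "coupling \<mu> \<le> h1" unfolding h1_def coupling_def by (rule real_sqrt_le_mono)
    have "sqrt \<alpha> * h0 \<le> sqrt \<alpha> * coupling \<mu>" "sqrt \<alpha> * coupling \<mu> \<le> sqrt \<alpha> * h1"
      "\<gamma> * h0 \<le> \<gamma> * coupling \<mu>" "\<gamma> * coupling \<mu> \<le> \<gamma> * h1"
      using l u alpha gamma by (auto intro!: mult_left_mono)
    then show ?thesis using k K by unfold_locales linarith+
  qed
  have "cone_const k K > 0"
  proof -
    \<comment> \<open>The constant depends on k and K only; equal parameters make its positivity
      available even over an empty spectrum.\<close>
    interpret coupled_modes k K k k k k by unfold_locales (use k K in linarith)+
    show ?thesis by (rule cone_const_pos)
  qed
  moreover have "(\<forall>i j. cmod (G \<mu> \<zeta> $ i $ j) \<le> 2) \<and> (\<forall>\<eta>. G \<mu> (\<zeta> + \<eta>) = G \<mu> \<zeta> ** G \<mu> \<eta>)"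
    if "\<mu> \<in> \<Lambda>" "\<bar>Im \<zeta>\<bar> \<le> cone_const k K * Re \<zeta>" for \<mu> \<zeta>
  proof -
    interpret coupled_modes k K "sqrt \<alpha> * coupling \<mu>" "sqrt \<alpha>" "\<gamma> * coupling \<mu>" \<delta> by (rule modes[OF that(1)])
    have "\<zeta> \<in> cone k K" using that by (simp add: cone_def)
    then have z: "complex_of_real (sqrt \<mu>) * \<zeta> \<in> cone k K" using eigenvalue_pos[OF that(1)] by (intro cone_scale) auto
    show ?thesis using mexp_entry_bound[OF z] mexp_add[OF z] by (simp add: G_def mode_matrix_def distrib_left)
  qed
  ultimately show ?thesis unfolding stable_def by blast
qed

lemma G_zero: "G \<mu> 0 = mat 1"
  by (simp add: G_def mexp_zero)

lemma G_derivative: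
  "((\<lambda>\<zeta>. G \<mu> \<zeta> $ i $ j) has_field_derivative (mat (complex_of_real (sqrt \<mu>)) ** (mode_matrix \<mu> ** G \<mu> \<zeta>)) $ i $ j) (at \<zeta>)"
proof -
  let ?s = "complex_of_real (sqrt \<mu>)"
  have "((\<lambda>\<zeta>. ?s * \<zeta>) has_field_derivative ?s) (at \<zeta>)" by (auto intro!: derivative_eq_intros)
  from DERIV_chain2[OF mexp_derivative this]
  have "((\<lambda>\<zeta>. G \<mu> \<zeta> $ i $ j) has_field_derivative (mode_matrix \<mu> ** G \<mu> \<zeta>) $ i $ j * ?s) (at \<zeta>)"
    by (simp add: G_def)
  also have "(mode_matrix \<mu> ** G \<mu> \<zeta>) $ i $ j * ?s = (mat ?s ** (mode_matrix \<mu> ** G \<mu> \<zeta>)) $ i $ j"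
    by (simp add: mat_mult_nth mult.commute)
  finally show ?thesis .
qed

text \<open>Sixteen entries of modulus at most 2.\<close>

lemma stable_norm:
  assumes "stable \<epsilon>" "\<mu> \<in> \<Lambda>" "\<bar>Im \<zeta>\<bar> \<le> \<epsilon> * Re \<zeta>"
  shows "norm (G \<mu> \<zeta>) \<le> 32"
  using norm_matrix_le[of "G \<mu> \<zeta>" 2] assms by (simp add: stable_def)

lemma stable_add:
  assumes "stable \<epsilon>" "\<mu> \<in> \<Lambda>" "\<bar>Im \<zeta>\<bar> \<le> \<epsilon> * Re \<zeta>"
  shows "G \<mu> (\<zeta> + \<eta>) = G \<mu> \<zeta> ** G \<mu> \<eta>"
  using assms by (simp add: stable_def)

definition modal :: "real \<Rightarrow> 'a L2 ^ 4 \<Rightarrow> bool" where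
  "modal \<mu> y \<longleftrightarrow> (\<forall>i. y $ i \<in> eigenspace \<Omega> \<mu>)"

definition single :: "real \<Rightarrow> 'a L2 ^ 4 \<Rightarrow> 'a phase" where
  "single \<mu> y = of_coord (\<chi> i. inverse (wt \<mu> $ i) *\<^sub>R y $ i)"

lemma modal_mact: "modal \<mu> y \<Longrightarrow> modal \<mu> (mact A y)"
  by (simp add: modal_def eigenspace_mact)

lemma modal_axis: "modal \<mu> y \<Longrightarrow> modal \<mu> (axis i (y $ j))"
  by (simp add: modal_def axis_def eigenspace_zero)

lemma modal_analysis: "U \<in> X \<Longrightarrow> modal \<mu> (analysis U \<mu>)"
  by (simp add: modal_def analysis_eigenspace)

lemma single_props:
  assumes "\<mu> \<in> \<Lambda>" "modal \<mu> y"
  shows "single \<mu> y \<in> X" "analysis (single \<mu> y) \<nu> = (if \<nu> = \<mu> then y else 0)" "N (single \<mu> y) = norm y"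
proof -
  let ?Y = "\<lambda>\<nu>. if \<nu> = \<mu> then y else 0"
  have "good ?Y"
    unfolding good_def using assms(2)
    by (auto simp: modal_def eigenspace_zero intro!: supported_summable[of \<mu>])
  note a = analysis_synth[OF this]
  have "synthesis \<Omega> (\<lambda>\<nu>. inverse (wt \<nu> $ i) *\<^sub>R ?Y \<nu> $ i) = inverse (wt \<mu> $ i) *\<^sub>R y $ i" for i
  proof -
    have "(\<lambda>\<nu>. inverse (wt \<nu> $ i) *\<^sub>R ?Y \<nu> $ i) = (\<lambda>\<nu>. if \<nu> = \<mu> then inverse (wt \<mu> $ i) *\<^sub>R y $ i else 0)" by auto
    then show ?thesis
      using assms(2) synthesis_eqI[OF eigenvector_expansion[OF eigenspace_scaleR]] by (simp add: modal_def)
  qed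
  then have s: "synth ?Y = single \<mu> y" by (simp add: synth_def single_def)
  show X: "single \<mu> y \<in> X" and an: "analysis (single \<mu> y) \<nu> = (if \<nu> = \<mu> then y else 0)" for \<nu>
    using a unfolding s by simp_all
  have "((\<lambda>\<nu>. (norm (analysis (single \<mu> y) \<nu>))\<^sup>2) has_sum (\<Sum>\<nu>\<in>{\<mu>}. (norm (analysis (single \<mu> y) \<nu>))\<^sup>2)) \<Lambda>"
    by (rule has_sum_finite_neutralI[where B="{\<mu>}"]) (use assms in \<open>auto simp: an\<close>)
  from has_sum_unique[OF this N_has_sum[OF X]] have "(norm y)\<^sup>2 = (N (single \<mu> y))\<^sup>2" by (simp add: an)
  then show "N (single \<mu> y) = norm y" by (rule power2_eq_imp_eq[symmetric]) (auto simp: N_nonneg)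
qed

lemma single_add: "single \<mu> (x + y) = single \<mu> x + single \<mu> y"
  by (simp add: single_def of_coord_def scaleR_add_right)

lemma single_diff: "single \<mu> (x - y) = single \<mu> x - single \<mu> y"
  by (simp add: single_def of_coord_def scaleR_diff_right)

lemma single_scaleC: "single \<mu> (mact (mat c) y) = c *\<^sub>C single \<mu> y"
  by (simp add: single_def of_coord_def mact_mat_nth scaleC_prod_def scaleC_of_real[symmetric] scaleC_scaleC mult.commute)

section \<open>The generator on an eigenspace\<close>

lemma pow_A_scale_eigenvector:
  "x \<in> eigenspace \<Omega> \<mu> \<Longrightarrow> pow_A_scale \<Omega> s x = (\<lambda>\<nu>. if \<nu> = \<mu> then \<mu> powr s *\<^sub>R x else 0)"
  by (auto simp: pow_A_scale_def eigenvector_components)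

lemma duality_eigenvector:
  assumes "\<mu> \<in> \<Lambda>"
  shows "duality \<Omega> (\<lambda>\<nu>. if \<nu> = \<mu> then e else 0) z = cinner e (components \<Omega> z \<mu>)"
proof -
  have "((\<lambda>\<nu>. cinner (if \<nu> = \<mu> then e else 0) (components \<Omega> z \<nu>)) has_sum
      (\<Sum>\<nu>\<in>{\<mu>}. cinner (if \<nu> = \<mu> then e else 0) (components \<Omega> z \<nu>))) \<Lambda>"
    by (rule has_sum_finite_neutralI[where B="{\<mu>}"]) (use assms in \<open>auto simp: cinner_zero_left\<close>)
  then show ?thesis unfolding duality_def by (auto dest: infsumI)
qed

lemma expansion_cinner_right:
  assumes "is_expansion \<Omega> u x" "e \<in> eigenspace \<Omega> \<mu>"
  shows "cinner e u = cinner e (x \<mu>)"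
  using expansion_cinner[OF assms] cinner_commute[of e u] cinner_commute[of e "x \<mu>"] by simp

text \<open>Testing the variational equation with eigenvectors for \<nu> multiplies the
  \<nu>-component of w by the positive number 1 + \<kappa>\<nu>. This determines every component of
  a solution, which gives the uniqueness required by the definite description.\<close>

lemma inv_I_kA_eigenvector:
  assumes mu: "\<mu> \<in> \<Lambda>" and e: "e \<in> eigenspace \<Omega> \<mu>"
  shows "inv_I_kA \<Omega> \<kappa> 1 (\<lambda>\<nu>. if \<nu> = \<mu> then e else 0) = inverse (1 + \<kappa> * \<mu>) *\<^sub>R e"
proof -
  let ?f = "\<lambda>\<nu>. if \<nu> = \<mu> then e else 0"
  let ?w = "inverse (1 + \<kappa> * \<mu>) *\<^sub>R e"
  let ?P = "\<lambda>w. w \<in> dom_pow \<Omega> (1/2) \<and> (\<forall>z\<in>dom_pow \<Omega> (1/2).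
      cinner w z + complex_of_real \<kappa> * cinner (pow_A \<Omega> (1/2) w) (pow_A \<Omega> (1/2) z) = duality \<Omega> ?f z)"
  have w: "?w \<in> eigenspace \<Omega> \<mu>" by (rule eigenspace_scaleR[OF e])
  have half: "\<nu> powr (1/2) * \<nu> powr (1/2) = \<nu>" if "\<nu> \<in> \<Lambda>" for \<nu>
    using eigenvalue_pos[OF that] by (simp flip: powr_add)
  have pos: "1 + \<kappa> * \<nu> > 0" if "\<nu> \<in> \<Lambda>" for \<nu> using eigenvalue_pos[OF that] kappa by (simp add: add_pos_pos)
  have form: "cinner w z + complex_of_real \<kappa> * cinner (pow_A \<Omega> (1/2) w) (pow_A \<Omega> (1/2) z)
    = complex_of_real (1 + \<kappa> * \<nu>) * cinner (components \<Omega> w \<nu>) z"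
    if "\<nu> \<in> \<Lambda>" "w \<in> dom_pow \<Omega> (1/2)" "z \<in> eigenspace \<Omega> \<nu>" for w z \<nu>
  proof -
    have "cinner (pow_A \<Omega> (1/2) w) (pow_A \<Omega> (1/2) z) = \<nu> powr (1/2) * (\<nu> powr (1/2) * cinner (components \<Omega> w \<nu>) z)"
      unfolding pow_A_eigenvector[OF that(3)] cinner_scaleR_right
      by (simp add: expansion_cinner[OF pow_A_expansion[OF that(2)] that(3)] cinner_scaleR_left)
    also have "\<dots> = \<nu> * cinner (components \<Omega> w \<nu>) z"
      using half[OF that(1)] by (metis mult.assoc of_real_mult)
    finally show ?thesis
      using expansion_cinner[OF dom_pow_expansion[OF that(2)] that(3)] by (simp add: distrib_right mult.assoc)
  qed
  have form': "cinner w z + complex_of_real \<kappa> * cinner (pow_A \<Omega> (1/2) w) (pow_A \<Omega> (1/2) z)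
    = complex_of_real (1 + \<kappa> * \<mu>) * cinner w (components \<Omega> z \<mu>)"
    if "w \<in> eigenspace \<Omega> \<mu>" "z \<in> dom_pow \<Omega> (1/2)" for w z
  proof -
    have "cinner (pow_A \<Omega> (1/2) w) (pow_A \<Omega> (1/2) z) = \<mu> powr (1/2) * (\<mu> powr (1/2) * cinner w (components \<Omega> z \<mu>))"
      unfolding pow_A_eigenvector[OF that(1)] cinner_scaleR_left
      by (simp add: expansion_cinner_right[OF pow_A_expansion[OF that(2)] that(1)] cinner_scaleR_right)
    also have "\<dots> = \<mu> * cinner w (components \<Omega> z \<mu>)"
      using half[OF mu] by (metis mult.assoc of_real_mult)
    finally show ?thesis
      using expansion_cinner_right[OF dom_pow_expansion[OF that(2)] that(1)] by (simp add: distrib_right mult.assoc)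
  qed
  have Pw: "?P ?w"
  proof (intro conjI ballI)
    show "?w \<in> dom_pow \<Omega> (1/2)" by (rule eigenvector_dom_pow[OF w])
    fix z assume z: "z \<in> dom_pow \<Omega> (1/2)"
    have "complex_of_real (1 + \<kappa> * \<mu>) * cinner ?w (components \<Omega> z \<mu>) = cinner e (components \<Omega> z \<mu>)"
      using pos[OF mu] unfolding cinner_scaleR_left
      by (metis (no_types, lifting) less_irrefl mult.assoc mult.left_neutral of_real_1 of_real_mult right_inverse)
    then show "cinner ?w z + complex_of_real \<kappa> * cinner (pow_A \<Omega> (1/2) ?w) (pow_A \<Omega> (1/2) z) = duality \<Omega> ?f z"
      unfolding form'[OF w z] duality_eigenvector[OF mu] .
  qed
  have unique: "w = ?w" if P: "?P w" for w
  proof (rule expansion_eq)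
    have d: "w \<in> dom_pow \<Omega> (1/2)" "?w \<in> dom_pow \<Omega> (1/2)" using P Pw by auto
    show "is_expansion \<Omega> w (components \<Omega> w)" by (rule dom_pow_expansion[OF d(1)])
    have "components \<Omega> w \<nu> = components \<Omega> ?w \<nu>" for \<nu>
    proof (cases "\<nu> \<in> \<Lambda>")
      case True
      show ?thesis
      proof (rule eigenspace_eqI)
        fix z assume z: "z \<in> eigenspace \<Omega> \<nu>"
        have zd: "z \<in> dom_pow \<Omega> (1/2)" by (rule eigenvector_dom_pow[OF z])
        have "complex_of_real (1 + \<kappa> * \<nu>) * cinner (components \<Omega> w \<nu>) z = complex_of_real (1 + \<kappa> * \<nu>) * cinner (components \<Omega> ?w \<nu>) z"
          using P Pw zd form[OF True d(1) z] form[OF True d(2) z] by metis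
        then show "cinner (components \<Omega> w \<nu>) z = cinner (components \<Omega> ?w \<nu>) z"
          using pos[OF True] by (simp del: of_real_add of_real_mult)
      qed (use components_eigenspace d in blast)+
    next
      case False
      then show ?thesis using components_eigenspace d eigenspace_trivial by metis
    qed
    then have "components \<Omega> w = components \<Omega> ?w" by blast
    then show "is_expansion \<Omega> ?w (components \<Omega> w)" using dom_pow_expansion[OF d(2)] by simp
  qed
  show ?thesis
    unfolding inv_I_kA_def by (rule the_equality[where P="?P" and a="?w", OF Pw unique])
qed

text \<open>On one eigenspace every family in the scale has a single term, so the domain conditions
  hold and the operator becomes a matrix; conjugation with the weights \<open>wt\<close> extracts
  the factor \<mu>^(1/2).\<close>

lemma generator_single:
  assumes mu: "\<mu> \<in> \<Lambda>" and y: "modal \<mu> y"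
  shows "single \<mu> y \<in> dom_B \<Omega> \<alpha> \<gamma> \<delta> (1/2) 1"
    "op_B \<Omega> \<alpha> \<kappa> \<gamma> \<delta> (1/2) 1 (single \<mu> y) = single \<mu> (mact (mat (complex_of_real (sqrt \<mu>)) ** mode_matrix \<mu>) y)"
proof -
  let ?u = "inverse (wt \<mu> $ 1) *\<^sub>R y $ 1" and ?v = "inverse (wt \<mu> $ 2) *\<^sub>R y $ 2"
    and ?w = "inverse (wt \<mu> $ 3) *\<^sub>R y $ 3" and ?z = "inverse (wt \<mu> $ 4) *\<^sub>R y $ 4"
  have U: "single \<mu> y = (?u, ?v, ?w, ?z)" by (simp add: single_def of_coord_def)
  have E: "?u \<in> eigenspace \<Omega> \<mu>" "?v \<in> eigenspace \<Omega> \<mu>" "?w \<in> eigenspace \<Omega> \<mu>" "?z \<in> eigenspace \<Omega> \<mu>"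
    using y by (auto simp: modal_def intro: eigenspace_scaleR)
  have f: "(\<lambda>\<nu>. \<alpha> *\<^sub>R pow_A_scale \<Omega> 2 ?u \<nu> + \<gamma> *\<^sub>R pow_A_scale \<Omega> 1 ?z \<nu>)
    = (\<lambda>\<nu>. if \<nu> = \<mu> then \<alpha> *\<^sub>R \<mu> powr 2 *\<^sub>R ?u + \<gamma> *\<^sub>R \<mu> powr 1 *\<^sub>R ?z else 0)"
    unfolding pow_A_scale_eigenvector[OF E(1)] pow_A_scale_eigenvector[OF E(4)] by auto
  have f': "(\<lambda>\<nu>. - (\<alpha> *\<^sub>R pow_A_scale \<Omega> 2 ?u \<nu>) - \<gamma> *\<^sub>R pow_A_scale \<Omega> 1 ?z \<nu>)
    = (\<lambda>\<nu>. if \<nu> = \<mu> then - (\<alpha> *\<^sub>R \<mu> powr 2 *\<^sub>R ?u) - \<gamma> *\<^sub>R \<mu> powr 1 *\<^sub>R ?z else 0)"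
    unfolding pow_A_scale_eigenvector[OF E(1)] pow_A_scale_eigenvector[OF E(4)] by auto
  have g: "(\<lambda>\<nu>. - (\<alpha> *\<^sub>R pow_A_scale \<Omega> 1 ?v \<nu>) + \<gamma> *\<^sub>R pow_A_scale \<Omega> 1 ?w \<nu> - \<delta> *\<^sub>R pow_A_scale \<Omega> (1/2) ?z \<nu>)
    = (\<lambda>\<nu>. if \<nu> = \<mu> then - (\<alpha> *\<^sub>R \<mu> powr 1 *\<^sub>R ?v) + \<gamma> *\<^sub>R \<mu> powr 1 *\<^sub>R ?w - \<delta> *\<^sub>R \<mu> powr (1/2) *\<^sub>R ?z else 0)"
    unfolding pow_A_scale_eigenvector[OF E(2)] pow_A_scale_eigenvector[OF E(3)] pow_A_scale_eigenvector[OF E(4)] by auto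
  note cl = eigenspace_add eigenspace_diff eigenspace_scaleR eigenspace_uminus E
  show "single \<mu> y \<in> dom_B \<Omega> \<alpha> \<gamma> \<delta> (1/2) 1"
  proof -
    have 1: "- (\<alpha> *\<^sub>R \<mu> powr 2 *\<^sub>R ?u) - \<gamma> *\<^sub>R \<mu> powr 1 *\<^sub>R ?z \<in> eigenspace \<Omega> \<mu>" by (intro cl)
    have "(\<lambda>\<nu>. if \<nu> = \<mu> then - (\<alpha> *\<^sub>R \<mu> powr 2 *\<^sub>R ?u) - \<gamma> *\<^sub>R \<mu> powr 1 *\<^sub>R ?z else 0) \<in> scale_space \<Omega> (-1/2)"
      using 1 by (auto simp: scale_space_def eigenspace_zero intro!: supported_summable[of \<mu>])
    moreover have "- (\<alpha> *\<^sub>R ?v) - \<delta> *\<^sub>R pow_A \<Omega> (1/2 - 1) ?z \<in> dom_pow \<Omega> 1"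
      unfolding pow_A_eigenvector[OF E(4)] by (rule eigenvector_dom_pow[of _ \<mu>]) (intro cl)
    ultimately show ?thesis
      using single_props(1)[OF mu y] E(3,4) f'
      by (simp add: dom_B_def U eigenvector_dom_pow[of _ \<mu>])
  qed
  have e3: "\<alpha> *\<^sub>R \<mu> powr 2 *\<^sub>R ?u + \<gamma> *\<^sub>R \<mu> powr 1 *\<^sub>R ?z \<in> eigenspace \<Omega> \<mu>" by (intro cl)
  have e4: "- (\<alpha> *\<^sub>R \<mu> powr 1 *\<^sub>R ?v) + \<gamma> *\<^sub>R \<mu> powr 1 *\<^sub>R ?w - \<delta> *\<^sub>R \<mu> powr (1/2) *\<^sub>R ?z \<in> eigenspace \<Omega> \<mu>" by (intro cl)
  have opB: "op_B \<Omega> \<alpha> \<kappa> \<gamma> \<delta> (1/2) 1 (single \<mu> y) = (?w, ?z,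
      - (inverse (1 + \<kappa> * \<mu>) *\<^sub>R (\<alpha> *\<^sub>R \<mu> powr 2 *\<^sub>R ?u + \<gamma> *\<^sub>R \<mu> powr 1 *\<^sub>R ?z)),
      - (\<alpha> *\<^sub>R \<mu> powr 1 *\<^sub>R ?v) + \<gamma> *\<^sub>R \<mu> powr 1 *\<^sub>R ?w - \<delta> *\<^sub>R \<mu> powr (1/2) *\<^sub>R ?z)"
    unfolding U op_B_def prod.case f g inv_I_kA_eigenvector[OF mu e3] synthesis_eqI[OF eigenvector_expansion[OF e4]] ..
  have m0: "\<mu> > 0" by (rule eigenvalue_pos[OF mu])
  \<comment> \<open>Naming the square roots makes the weights and the powers of \<mu> monomials, so
    the four rows become identities between rational expressions.\<close>
  define s where "s = sqrt \<mu>"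
  define A where "A = sqrt \<alpha>"
  define r where "r = sqrt (1 + \<kappa> * \<mu>)"
  have pos: "s > 0" "A > 0" "r > 0" using m0 alpha kappa by (auto simp: s_def A_def r_def add_pos_pos)
  have sq: "\<mu> = s * s" "\<alpha> = A * A" "1 + \<kappa> * \<mu> = r * r"
    using m0 alpha kappa by (auto simp: s_def A_def r_def add_nonneg_nonneg)
  have W: "wt \<mu> $ 1 = A * (s * s)" "wt \<mu> $ 2 = A * s" "wt \<mu> $ 3 = r" "wt \<mu> $ 4 = 1" "coupling \<mu> = s / r"
    "\<mu> powr 2 = s * s * (s * s)" "\<mu> powr 1 = s * s" "\<mu> powr (1/2) = s"
  proof -
    show "wt \<mu> $ 1 = A * (s * s)" using sq(1) by (simp add: wt_def vector_4 A_def)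
    show "wt \<mu> $ 2 = A * s" "wt \<mu> $ 3 = r" "wt \<mu> $ 4 = 1" by (simp_all add: wt_def vector_4 A_def s_def r_def real_sqrt_mult)
    show "coupling \<mu> = s / r" by (simp add: coupling_def s_def r_def real_sqrt_divide)
    have "\<mu> powr 2 = \<mu> * \<mu>" using m0 by (simp add: power2_eq_square)
    then show "\<mu> powr 2 = s * s * (s * s)" using sq(1) by simp
    show "\<mu> powr 1 = s * s" using m0 sq(1) by simp
    show "\<mu> powr (1/2) = s" using m0 by (simp add: s_def powr_half_sqrt)
  qed
  have cs: "complex_of_real (sqrt \<mu>) *\<^sub>C x = s *\<^sub>R x" for x :: "'a L2" by (simp add: scaleC_of_real s_def)
  show "op_B \<Omega> \<alpha> \<kappa> \<gamma> \<delta> (1/2) 1 (single \<mu> y) = single \<mu> (mact (mat (complex_of_real (sqrt \<mu>)) ** mode_matrix \<mu>) y)"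
  proof -
    have S: "single \<mu> (mact (mat (complex_of_real (sqrt \<mu>)) ** mode_matrix \<mu>) y) =
      (inverse (A * (s * s)) *\<^sub>R s *\<^sub>R (A * (s / r)) *\<^sub>R y $ 3, inverse (A * s) *\<^sub>R s *\<^sub>R A *\<^sub>R y $ 4,
       inverse r *\<^sub>R s *\<^sub>R (- ((A * (s / r)) *\<^sub>R y $ 1) - (\<gamma> * (s / r)) *\<^sub>R y $ 4),
       inverse 1 *\<^sub>R s *\<^sub>R (- (A *\<^sub>R y $ 2) + (\<gamma> * (s / r)) *\<^sub>R y $ 3 - \<delta> *\<^sub>R y $ 4))"
      unfolding single_def of_coord_def mact_mact[symmetric] vec_lambda_beta mact_mat_nth cs mode_matrix_def mact_modes_matrix
        W A_def[symmetric] ..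
    have 1: "inverse r *\<^sub>R y $ 3 = inverse (A * (s * s)) *\<^sub>R s *\<^sub>R (A * (s / r)) *\<^sub>R y $ 3"
      using pos by (simp add: field_simps)
    have 2: "inverse 1 *\<^sub>R y $ 4 = inverse (A * s) *\<^sub>R s *\<^sub>R A *\<^sub>R y $ 4"
      using pos by (simp add: field_simps)
    have 3: "- (inverse (r * r) *\<^sub>R ((A * A) *\<^sub>R (s * s * (s * s)) *\<^sub>R inverse (A * (s * s)) *\<^sub>R y $ 1 + \<gamma> *\<^sub>R (s * s) *\<^sub>R inverse 1 *\<^sub>R y $ 4))
      = inverse r *\<^sub>R s *\<^sub>R (- ((A * (s / r)) *\<^sub>R y $ 1) - (\<gamma> * (s / r)) *\<^sub>R y $ 4)"
    proof -
      have "inverse (r * r) * ((A * A) * ((s * s * (s * s)) * inverse (A * (s * s)))) = inverse r * (s * (A * (s / r)))"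
        "inverse (r * r) * (\<gamma> * ((s * s) * inverse 1)) = inverse r * (s * (\<gamma> * (s / r)))"
        using pos by (simp_all add: field_simps)
      then show ?thesis by (simp only: scaleR_add_right scaleR_diff_right scaleR_minus_right scaleR_scaleR) simp
    qed
    have 4: "- ((A * A) *\<^sub>R (s * s) *\<^sub>R inverse (A * s) *\<^sub>R y $ 2) + \<gamma> *\<^sub>R (s * s) *\<^sub>R inverse r *\<^sub>R y $ 3 - \<delta> *\<^sub>R s *\<^sub>R inverse 1 *\<^sub>R y $ 4
      = inverse 1 *\<^sub>R s *\<^sub>R (- (A *\<^sub>R y $ 2) + (\<gamma> * (s / r)) *\<^sub>R y $ 3 - \<delta> *\<^sub>R y $ 4)"
    proof -
      have "A * A * ((s * s) * inverse (A * s)) = inverse 1 * (s * A)" "\<gamma> * ((s * s) * inverse r) = inverse 1 * (s * (\<gamma> * (s / r)))"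
        "\<delta> * (s * inverse 1) = inverse 1 * (s * \<delta>)"
        using pos by (simp_all add: field_simps)
      then show ?thesis by (simp only: scaleR_add_right scaleR_diff_right scaleR_minus_right scaleR_scaleR)
    qed
    show ?thesis unfolding opB S W sq(3) prod.inject
      using 1 2 3[folded sq(2)] 4[folded sq(2)] by (intro conjI) assumption+
  qed
qed

end

section \<open>The semigroup is the multiplier\<close>

text \<open>Resolving A into its entries writes the image as a combination of sixteen vectors that
  depend on y only.\<close>

lemma mact_axis_expansion: "mact A y = (\<Sum>i\<in>UNIV. \<Sum>j\<in>UNIV. mact (mat (A $ i $ j)) (axis i (y $ j)))"
proof -
  have "(\<Sum>i\<in>UNIV. \<Sum>j\<in>UNIV. mact (mat (A $ i $ j)) (axis i (y $ j))) $ k = mact A y $ k" for k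
  proof -
    have "(\<Sum>i\<in>UNIV. \<Sum>j\<in>UNIV. mact (mat (A $ i $ j)) (axis i (y $ j))) $ k
      = (\<Sum>i\<in>UNIV. \<Sum>j\<in>UNIV. if k = i then A $ i $ j *\<^sub>C y $ j else 0)"
      by (auto simp: mact_mat_nth axis_def scaleC_zero_right intro!: sum.cong)
    also have "\<dots> = (\<Sum>i\<in>UNIV. if k = i then \<Sum>j\<in>UNIV. A $ i $ j *\<^sub>C y $ j else 0)"
      by (intro sum.cong) auto
    also have "\<dots> = mact A y $ k" by (simp add: mact_nth)
    finally show ?thesis .
  qed
  then show ?thesis by (simp add: vec_eq_iff)
qed

lemma mact_scaleR: "mact (r *\<^sub>R A) y = mact (mat (complex_of_real r)) (mact A y)"
  by (simp add: vec_eq_iff mact_mat_nth) (simp add: mact_nth scaleC_sum_right scaleC_scaleC scaleR_conv_of_real[where 'a=complex])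

locale plate_semigroup = plate +
  fixes S :: "real \<Rightarrow> 'a phase \<Rightarrow> 'a phase" and \<epsilon> :: real
  assumes semigroup: "C0_contraction_semigroup X N S"
    and generator: "is_generator X N S (dom_B \<Omega> \<alpha> \<gamma> \<delta> (1/2) 1) (op_B \<Omega> \<alpha> \<kappa> \<gamma> \<delta> (1/2) 1)"
    and stable: "stable \<epsilon>"
begin

lemma S_X: "t \<ge> 0 \<Longrightarrow> U \<in> X \<Longrightarrow> S t U \<in> X"
  and S_add: "t \<ge> 0 \<Longrightarrow> U \<in> X \<Longrightarrow> V \<in> X \<Longrightarrow> S t (U + V) = S t U + S t V"
  and S_scaleC: "t \<ge> 0 \<Longrightarrow> U \<in> X \<Longrightarrow> S t (c *\<^sub>C U) = c *\<^sub>C S t U"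
  and S_contraction: "t \<ge> 0 \<Longrightarrow> U \<in> X \<Longrightarrow> N (S t U) \<le> N U"
  and S_zero: "U \<in> X \<Longrightarrow> S 0 U = U"
  and S_semigroup: "s \<ge> 0 \<Longrightarrow> t \<ge> 0 \<Longrightarrow> U \<in> X \<Longrightarrow> S (s + t) U = S s (S t U)"
  using semigroup unfolding C0_contraction_semigroup_def bounded_operator_def by blast+

lemma S_diff: "t \<ge> 0 \<Longrightarrow> U \<in> X \<Longrightarrow> V \<in> X \<Longrightarrow> S t (U - V) = S t U - S t V"
  using S_add[of t U "(-1) *\<^sub>C V"] S_scaleC[of t V "-1"] X_scaleC[of V "-1"] by (simp add: scaleC_minus_one)

lemma X_zero: "0 \<in> X" if "U \<in> X"
  using X_diff[OF that that] by simp

lemma N_minus: "U \<in> X \<Longrightarrow> N (- U) = N U"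
  using N_scaleC[of U "-1"] by (simp add: scaleC_minus_one)

lemma N_diff_triangle: "U \<in> X \<Longrightarrow> V \<in> X \<Longrightarrow> N (U - V) \<le> N U + N V"
  using N_triangle[of U "- V"] X_scaleC[of V "-1"] N_minus[of V] by (simp add: scaleC_minus_one)

lemma N_scaleR: "U \<in> X \<Longrightarrow> N (r *\<^sub>R U) = \<bar>r\<bar> * N U"
  using N_scaleC[of U "complex_of_real r"] by (simp add: scaleC_of_real)

lemma X_scaleR: "U \<in> X \<Longrightarrow> r *\<^sub>R U \<in> X"
  using X_scaleC[of U "complex_of_real r"] by (simp add: scaleC_of_real)

text \<open>The defect is $o(h)$ because both evolutions have the same derivative at $0$; telescoping
  $S(h)^n - G(h)^n$ with $h = t/n$ then identifies them on a mode.\<close>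

definition defect :: "real \<Rightarrow> real \<Rightarrow> 'a L2 ^ 4 \<Rightarrow> 'a phase" where
  "defect \<mu> h y = S h (single \<mu> y) - single \<mu> (mact (G \<mu> (complex_of_real h)) y)"

context
  fixes \<mu> :: real
  assumes mu: "\<mu> \<in> \<Lambda>"
begin

lemma single_X: "modal \<mu> y \<Longrightarrow> single \<mu> y \<in> X"
  by (rule single_props(1)[OF mu])

lemma modal_sum: "(\<And>i. i \<in> I \<Longrightarrow> modal \<mu> (f i)) \<Longrightarrow> modal \<mu> (\<Sum>i\<in>I. f i)"
  by (simp add: modal_def eigenspace_sum)

lemma modal_zero: "modal \<mu> 0"
  by (simp add: modal_def eigenspace_zero)

lemma defect_X: "h \<ge> 0 \<Longrightarrow> modal \<mu> y \<Longrightarrow> defect \<mu> h y \<in> X"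
  unfolding defect_def by (intro X_diff S_X single_X modal_mact)

lemma defect_add: "h \<ge> 0 \<Longrightarrow> modal \<mu> x \<Longrightarrow> modal \<mu> y \<Longrightarrow> defect \<mu> h (x + y) = defect \<mu> h x + defect \<mu> h y"
  by (simp add: defect_def single_add mact_add_right S_add single_X)

lemma defect_scaleC: "h \<ge> 0 \<Longrightarrow> modal \<mu> y \<Longrightarrow> defect \<mu> h (mact (mat c) y) = c *\<^sub>C defect \<mu> h y"
proof -
  assume h: "h \<ge> 0" "modal \<mu> y"
  have "mact (G \<mu> (complex_of_real h)) (mact (mat c) y) = mact (mat c) (mact (G \<mu> (complex_of_real h)) y)"
    by (simp only: mact_mact mat_commute[of c "G \<mu> (complex_of_real h)"])
  then show ?thesis using h by (simp add: defect_def single_scaleC S_scaleC single_X scaleC_diff_right)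
qed

lemma N_defect_sum:
  assumes "finite I" "h \<ge> 0" "\<And>i. i \<in> I \<Longrightarrow> modal \<mu> (f i)"
  shows "N (defect \<mu> h (\<Sum>i\<in>I. f i)) \<le> (\<Sum>i\<in>I. N (defect \<mu> h (f i)))"
  using assms
proof (induction I rule: finite_induct)
  case empty
  have "N (defect \<mu> h (mact (mat 0) 0)) = cmod 0 * N (defect \<mu> h 0)"
    by (simp only: defect_scaleC[OF assms(2) modal_zero] N_scaleC[OF defect_X[OF assms(2) modal_zero]])
  then show ?case by (simp add: mact_zero)
next
  case (insert i I)
  have m: "modal \<mu> (f i)" "modal \<mu> (\<Sum>i\<in>I. f i)" using insert.prems by (auto intro: modal_sum)
  have "N (defect \<mu> h (f i + (\<Sum>i\<in>I. f i))) \<le> N (defect \<mu> h (f i)) + N (defect \<mu> h (\<Sum>i\<in>I. f i))"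
    unfolding defect_add[OF assms(2) m] using m assms(2) by (intro N_triangle defect_X)
  also have "\<dots> \<le> N (defect \<mu> h (f i)) + (\<Sum>i\<in>I. N (defect \<mu> h (f i)))"
    using insert by (intro add_left_mono) auto
  finally show ?case using insert.hyps by simp
qed

text \<open>The defect is known to be small only for each fixed vector. During the telescoping the
  vector changes with h and with the step, but the entries of its matrix stay bounded by 2; sixteen
  fixed vectors then control all of them.\<close>

lemma N_defect_mact:
  fixes A :: "complex ^ 4 ^ 4"
  assumes "h \<ge> 0" "modal \<mu> y" "\<And>i j. cmod (A $ i $ j) \<le> 2"
  shows "N (defect \<mu> h (mact A y)) \<le> 2 * (\<Sum>i\<in>UNIV. \<Sum>j\<in>UNIV. N (defect \<mu> h (axis i (y $ j))))"
proof -
  have m: "modal \<mu> (mact (mat (A $ i $ j)) (axis i (y $ j)))" for i j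
    by (intro modal_mact modal_axis assms)
  have "N (defect \<mu> h (mact A y)) \<le> (\<Sum>i\<in>UNIV. N (defect \<mu> h (\<Sum>j\<in>UNIV. mact (mat (A $ i $ j)) (axis i (y $ j)))))"
    unfolding mact_axis_expansion[of A] by (intro N_defect_sum assms modal_sum m) auto
  also have "\<dots> \<le> (\<Sum>i\<in>UNIV. \<Sum>j\<in>UNIV. N (defect \<mu> h (mact (mat (A $ i $ j)) (axis i (y $ j)))))"
    by (intro sum_mono N_defect_sum assms m) auto
  also have "\<dots> \<le> (\<Sum>i\<in>UNIV. \<Sum>j\<in>UNIV. 2 * N (defect \<mu> h (axis i (y $ j))))"
  proof (intro sum_mono)
    fix i j
    have "N (defect \<mu> h (mact (mat (A $ i $ j)) (axis i (y $ j)))) = cmod (A $ i $ j) * N (defect \<mu> h (axis i (y $ j)))"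
      by (simp only: defect_scaleC[OF assms(1) modal_axis[OF assms(2)]] N_scaleC[OF defect_X[OF assms(1) modal_axis[OF assms(2)]]])
    also have "\<dots> \<le> 2 * N (defect \<mu> h (axis i (y $ j)))" by (intro mult_right_mono assms N_nonneg)
    finally show "N (defect \<mu> h (mact (mat (A $ i $ j)) (axis i (y $ j)))) \<le> 2 * N (defect \<mu> h (axis i (y $ j)))" .
  qed
  finally show ?thesis by (simp add: sum_distrib_left)
qed

lemma G_difference_quotient:
  "((\<lambda>h. (1 / h) *\<^sub>R (G \<mu> (complex_of_real h) - mat 1) - mat (complex_of_real (sqrt \<mu>)) ** mode_matrix \<mu>) \<longlongrightarrow> 0) (at_right 0)"
proof (rule vec_tendstoI)
  fix i
  show "((\<lambda>h. ((1 / h) *\<^sub>R (G \<mu> (complex_of_real h) - mat 1) - mat (complex_of_real (sqrt \<mu>)) ** mode_matrix \<mu>) $ i) \<longlongrightarrow> 0 $ i) (at_right 0)"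
  proof (rule vec_tendstoI)
    fix j
    let ?B = "mat (complex_of_real (sqrt \<mu>)) ** mode_matrix \<mu>"
    have "((\<lambda>\<zeta>. G \<mu> \<zeta> $ i $ j) has_field_derivative ?B $ i $ j) (at 0)"
      using G_derivative[of \<mu> i j 0] by (simp add: G_zero)
    then have lim: "((\<lambda>\<zeta>. (G \<mu> \<zeta> $ i $ j - G \<mu> 0 $ i $ j) / (\<zeta> - 0)) \<longlongrightarrow> ?B $ i $ j) (at 0)"
      by (simp only: has_field_derivative_iff)
    have "((\<lambda>h. complex_of_real h) \<longlongrightarrow> complex_of_real 0) (at_right 0)"
      by (intro tendsto_intros)
    then have f: "filterlim complex_of_real (at 0) (at_right 0)"
      by (intro filterlim_atI) (auto intro: eventually_mono[OF eventually_at_right_less])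
    have "((\<lambda>h. (1 / h) *\<^sub>R (G \<mu> (complex_of_real h) $ i $ j - G \<mu> 0 $ i $ j)) \<longlongrightarrow> ?B $ i $ j) (at_right 0)"
      using filterlim_compose[OF lim f] by (simp add: scaleR_conv_of_real divide_inverse mult.commute)
    then show "((\<lambda>h. ((1 / h) *\<^sub>R (G \<mu> (complex_of_real h) - mat 1) - ?B) $ i $ j) \<longlongrightarrow> 0 $ i $ j) (at_right 0)"
      by (simp add: G_zero LIM_zero)
  qed
qed

lemma defect_small:
  assumes "modal \<mu> y"
  shows "((\<lambda>h. N (defect \<mu> h y) / h) \<longlongrightarrow> 0) (at_right 0)"
proof -
  let ?B = "mat (complex_of_real (sqrt \<mu>)) ** mode_matrix \<mu>"
  let ?U = "single \<mu> y" and ?V = "single \<mu> (mact ?B y)"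
  have V: "?V \<in> X" by (intro single_X modal_mact assms)
  have U: "?U \<in> X" by (intro single_X assms)
  have 1: "((\<lambda>t. N ((1 / t) *\<^sub>R (S t ?U - ?U) - ?V)) \<longlongrightarrow> 0) (at_right 0)"
  proof -
    have "\<forall>U V. U \<in> dom_B \<Omega> \<alpha> \<gamma> \<delta> (1/2) 1 \<and> V = op_B \<Omega> \<alpha> \<kappa> \<gamma> \<delta> (1/2) 1 U \<longrightarrow>
        ((\<lambda>t. N ((1 / t) *\<^sub>R (S t U - U) - V)) \<longlongrightarrow> 0) (at_right 0)"
      using generator unfolding is_generator_def by blast
    from this[rule_format, of ?U ?V] show ?thesis using generator_single[OF mu assms] by metis
  qed
  have 2: "((\<lambda>t. norm ((1 / t) *\<^sub>R (G \<mu> (complex_of_real t) - mat 1) - ?B) * norm y) \<longlongrightarrow> 0) (at_right 0)"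
    using tendsto_mult_right[OF tendsto_norm[OF G_difference_quotient], of "norm y"] by simp
  have "((\<lambda>t. N ((1 / t) *\<^sub>R (S t ?U - ?U) - ?V) + norm ((1 / t) *\<^sub>R (G \<mu> (complex_of_real t) - mat 1) - ?B) * norm y) \<longlongrightarrow> 0) (at_right 0)"
    using tendsto_add[OF 1 2] by simp
  then show ?thesis
  proof (rule tendsto_sandwich[OF _ _ tendsto_const, rotated 2])
    show "\<forall>\<^sub>F h in at_right 0. 0 \<le> N (defect \<mu> h y) / h"
      using eventually_at_right_less[of "0::real"] by eventually_elim (simp add: N_nonneg)
    show "\<forall>\<^sub>F t in at_right 0. N (defect \<mu> t y) / t \<le> N ((1 / t) *\<^sub>R (S t ?U - ?U) - ?V) + norm ((1 / t) *\<^sub>R (G \<mu> (complex_of_real t) - mat 1) - ?B) * norm y"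
      using eventually_at_right_less[of "0::real"]
    proof eventually_elim
      case (elim t)
      let ?A = "(1 / t) *\<^sub>R (G \<mu> (complex_of_real t) - mat 1) - ?B"
      let ?P = "(1 / t) *\<^sub>R (S t ?U - ?U) - ?V" and ?Q = "single \<mu> (mact ?A y)"
      have P: "?P \<in> X" using elim U V by (intro X_diff X_scaleR S_X) auto
      have Q: "?Q \<in> X" by (intro single_X modal_mact assms)
      have "mact ?A y = mact (mat (complex_of_real (1 / t))) (mact (G \<mu> (complex_of_real t)) y - y) - mact ?B y"
        by (simp only: mact_diff_left mact_scaleR mact_mat_1)
      then have "?Q = (1 / t) *\<^sub>R (single \<mu> (mact (G \<mu> (complex_of_real t)) y) - ?U) - ?V"
        by (simp only: single_diff single_scaleC scaleC_of_real)
      \<comment> \<open>The value of the generator occurs in both quotients and cancels.\<close>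
      then have "?P - ?Q = (1 / t) *\<^sub>R defect \<mu> t y"
        by (simp add: defect_def algebra_simps)
      then have "N (defect \<mu> t y) / t = N (?P - ?Q)"
        using elim defect_X[of t y] assms by (simp add: N_scaleR)
      also have "\<dots> \<le> N ?P + N ?Q" by (rule N_diff_triangle[OF P Q])
      also have "N ?Q = norm (mact ?A y)" by (rule single_props(3)[OF mu modal_mact[OF assms]])
      also have "\<dots> \<le> norm ?A * norm y" by (rule norm_mact)
      finally show ?case by simp
    qed
  qed
qed

lemma S_single:
  assumes y: "modal \<mu> y" and t: "t \<ge> 0"
  shows "S t (single \<mu> y) = single \<mu> (mact (G \<mu> (complex_of_real t)) y)"
proof (cases "t = 0")
  case True
  then show ?thesis using y by (simp add: S_zero single_X G_zero mact_mat_1)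
next
  case False
  then have t0: "t > 0" using t by simp
  define \<rho> where "\<rho> h = (\<Sum>i\<in>UNIV. \<Sum>j\<in>UNIV. N (defect \<mu> h (axis i (y $ j))))" for h
  have real_cone: "\<bar>Im (complex_of_real s)\<bar> \<le> \<epsilon> * Re (complex_of_real s)" if "s \<ge> 0" for s
    using that stable by (simp add: stable_def)
  \<comment> \<open>One more step propagates the old error, which contraction does not amplify, and
    adds one new defect at a vector covered by \<open>N_defect_mact\<close>.\<close>
  have step: "N (defect \<mu> (real k * h) y) \<le> real k * (2 * \<rho> h)" if h: "h \<ge> 0" for k h
  proof (induction k)
    case 0
    have "N 0 = 0" using N_scaleC[OF single_X[OF y], of 0] by (simp add: scaleC_zero_left)
    then show ?case using y by (simp add: defect_def S_zero single_X G_zero mact_mat_1)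
  next
    case (Suc k)
    let ?g = "mact (G \<mu> (complex_of_real (real k * h))) y"
    have kh: "real k * h \<ge> 0" using h by simp
    have g: "modal \<mu> ?g" by (rule modal_mact[OF y])
    have "S (real (Suc k) * h) (single \<mu> y) = S h (S (real k * h) (single \<mu> y))"
      using S_semigroup[OF h kh single_X[OF y]] by (simp add: distrib_right)
    moreover have "mact (G \<mu> (complex_of_real (real (Suc k) * h))) y = mact (G \<mu> (complex_of_real h)) ?g"
      using stable_add[OF stable mu real_cone[OF h], of "complex_of_real (real k * h)"]
      by (simp add: mact_mact distrib_right)
    ultimately have "defect \<mu> (real (Suc k) * h) y = S h (defect \<mu> (real k * h) y) + defect \<mu> h ?g"
      using h kh y g by (simp only: defect_def) (simp add: S_diff S_X single_X)
    also have "N \<dots> \<le> N (S h (defect \<mu> (real k * h) y)) + N (defect \<mu> h ?g)"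
      using h kh y g by (intro N_triangle S_X defect_X)
    also have "\<dots> \<le> N (defect \<mu> (real k * h) y) + 2 * \<rho> h"
    proof (rule add_mono)
      show "N (S h (defect \<mu> (real k * h) y)) \<le> N (defect \<mu> (real k * h) y)"
        using h kh y by (intro S_contraction defect_X)
      show "N (defect \<mu> h ?g) \<le> 2 * \<rho> h"
        unfolding \<rho>_def using stable real_cone[OF kh] mu by (intro N_defect_mact h y) (auto simp: stable_def)
    qed
    finally show ?case using Suc by (simp add: distrib_right)
  qed
  have rho: "((\<lambda>h. 2 * t * (\<rho> h / h)) \<longlongrightarrow> 0) (at_right 0)"
  proof -
    have "((\<lambda>h. 2 * t * (\<Sum>i\<in>UNIV. \<Sum>j\<in>UNIV. N (defect \<mu> h (axis i (y $ j))) / h)) \<longlongrightarrow> 2 * t * (\<Sum>i\<in>(UNIV::4 set). \<Sum>j\<in>(UNIV::4 set). 0)) (at_right 0)"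
      by (intro tendsto_intros defect_small modal_axis y)
    then show ?thesis by (simp add: \<rho>_def sum_divide_distrib)
  qed
  have f: "filterlim (\<lambda>n. t / real (Suc n)) (at_right 0) sequentially"
  proof -
    have "(\<lambda>n. t * inverse (real (Suc n))) \<longlonglongrightarrow> t * 0"
      by (intro tendsto_intros LIMSEQ_inverse_real_of_nat)
    then show ?thesis using t0 by (intro tendsto_imp_filterlim_at_right) (auto simp: divide_inverse)
  qed
  \<comment> \<open>With h = t / (n + 1), the n + 1 defects add up to at most 2 t \<rho>(h) / h,
    which tends to 0, while the quantity being bounded does not depend on n.\<close>
  have "(\<lambda>n. 2 * t * (\<rho> (t / real (Suc n)) / (t / real (Suc n)))) \<longlonglongrightarrow> 0"
    using filterlim_compose[OF rho f] .
  moreover have "N (defect \<mu> t y) \<le> 2 * t * (\<rho> (t / real (Suc n)) / (t / real (Suc n)))" for n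
  proof -
    have "real (Suc n) * (t / real (Suc n)) = t" by simp
    moreover have "2 * t * (r / (t / real (Suc n))) = real (Suc n) * (2 * r)" for r
      using t0 by (simp add: field_simps del: of_nat_Suc)
    moreover have "t / real (Suc n) \<ge> 0" using t0 by simp
    ultimately show ?thesis using step[of "t / real (Suc n)" "Suc n"] by (simp only:)
  qed
  ultimately have "N (defect \<mu> t y) \<le> 0" by (intro LIMSEQ_le_const) auto
  then have "defect \<mu> t y = 0" using N_nonneg[of "defect \<mu> t y"] defect_X[OF t y] by (intro N_zero_imp) auto
  then show ?thesis by (simp add: defect_def)
qed

end

section \<open>Extension of the semigroup to the cone\<close>

definition T :: "complex \<Rightarrow> 'a phase \<Rightarrow> 'a phase" where
  "T \<zeta> = Mult (\<lambda>\<mu>. G \<mu> \<zeta>)"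

definition trunc :: "real set \<Rightarrow> 'a phase \<Rightarrow> 'a phase" where
  "trunc F = Mult (\<lambda>\<mu>. if \<mu> \<in> F then mat 1 else 0)"

lemma trunc_bound: "norm (if \<mu> \<in> F then mat 1 else 0 :: complex ^ 4 ^ 4) \<le> 16"
  using norm_matrix_le[of "mat 1 :: complex ^ 4 ^ 4" 1] by (auto simp: mat_def)

lemma trunc_X: "U \<in> X \<Longrightarrow> trunc F U \<in> X"
  unfolding trunc_def by (rule Mult_props(1)[where C=16, OF trunc_bound])

lemma mact_zero_left: "mact 0 y = 0"
  by (simp add: vec_eq_iff mact_nth scaleC_zero_left)

lemma trunc_analysis: "U \<in> X \<Longrightarrow> analysis (trunc F U) \<mu> = (if \<mu> \<in> F then analysis U \<mu> else 0)"
  unfolding trunc_def by (subst Mult_props(2)[where C=16, OF trunc_bound]) (auto simp: mact_mat_1 mact_zero_left)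

text \<open>Truncation removes the terms at F from Parseval's sum, so the squared error is its tail.
  The bound e^2/2 leaves room for a strict inequality.\<close>

lemma trunc_approximates:
  assumes U: "U \<in> X" and e: "e > 0"
  obtains F where "finite F" "F \<subseteq> \<Lambda>" "N (U - trunc F U) < e"
proof -
  have "e\<^sup>2 / 2 > 0" using e by simp
  then obtain F where F: "finite F" "F \<subseteq> \<Lambda>" "dist (\<Sum>\<mu>\<in>F. (norm (analysis U \<mu>))\<^sup>2) ((N U)\<^sup>2) \<le> e\<^sup>2 / 2"
    using has_sum_finite_approximation[OF N_has_sum[OF U]] by metis
  let ?f = "\<lambda>\<mu>. (norm (analysis U \<mu>))\<^sup>2"
  have "((\<lambda>\<mu>. if \<mu> \<in> F then ?f \<mu> else 0) has_sum (\<Sum>\<mu>\<in>F. ?f \<mu>)) \<Lambda>"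
    by (rule has_sum_finite_neutralI[OF F(1,2)]) auto
  from has_sum_add[OF N_has_sum[OF U] has_sum_cmult_right[OF this, of "-1"]]
  have "((\<lambda>\<mu>. ?f \<mu> - (if \<mu> \<in> F then ?f \<mu> else 0)) has_sum ((N U)\<^sup>2 - (\<Sum>\<mu>\<in>F. ?f \<mu>))) \<Lambda>" by simp
  also have "(\<lambda>\<mu>. ?f \<mu> - (if \<mu> \<in> F then ?f \<mu> else 0)) = (\<lambda>\<mu>. (norm (analysis (U - trunc F U) \<mu>))\<^sup>2)"
    by (auto simp: analysis_diff[OF U trunc_X[OF U]] trunc_analysis[OF U])
  finally have "(N (U - trunc F U))\<^sup>2 = (N U)\<^sup>2 - (\<Sum>\<mu>\<in>F. ?f \<mu>)"
    using has_sum_unique[OF N_has_sum[OF X_diff[OF U trunc_X[OF U]]]] by metis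
  also have "\<dots> \<le> e\<^sup>2 / 2" using F(3) unfolding dist_real_def by linarith
  also have "\<dots> < e\<^sup>2" using e by simp
  finally have "N (U - trunc F U) < e" by (rule power_less_imp_less_base) (use e in simp)
  then show ?thesis using that F by blast
qed

lemma cone_norm: "\<bar>Im \<zeta>\<bar> \<le> \<epsilon> * Re \<zeta> \<Longrightarrow> \<mu> \<in> \<Lambda> \<Longrightarrow> norm (G \<mu> \<zeta>) \<le> 32"
  by (rule stable_norm[OF stable])

lemma T_X: "\<bar>Im \<zeta>\<bar> \<le> \<epsilon> * Re \<zeta> \<Longrightarrow> U \<in> X \<Longrightarrow> T \<zeta> U \<in> X"
  unfolding T_def by (rule Mult_props(1)[where C=32]) (auto intro: cone_norm)

lemma T_analysis: "\<bar>Im \<zeta>\<bar> \<le> \<epsilon> * Re \<zeta> \<Longrightarrow> U \<in> X \<Longrightarrow> analysis (T \<zeta> U) \<mu> = mact (G \<mu> \<zeta>) (analysis U \<mu>)"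
  unfolding T_def by (rule Mult_props(2)[where C=32]) (auto intro: cone_norm)

lemma T_bounded: "\<bar>Im \<zeta>\<bar> \<le> \<epsilon> * Re \<zeta> \<Longrightarrow> bounded_operator X N (T \<zeta>)"
  unfolding T_def by (rule Mult_bounded_operator[where C=32]) (auto intro: cone_norm)

lemma T_norm: "\<bar>Im \<zeta>\<bar> \<le> \<epsilon> * Re \<zeta> \<Longrightarrow> U \<in> X \<Longrightarrow> N (T \<zeta> U) \<le> 32 * N U"
  unfolding T_def by (rule N_Mult_le) (auto intro: cone_norm)

lemma T_diff: "\<bar>Im \<zeta>\<bar> \<le> \<epsilon> * Re \<zeta> \<Longrightarrow> U \<in> X \<Longrightarrow> V \<in> X \<Longrightarrow> T \<zeta> (U - V) = T \<zeta> U - T \<zeta> V"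
  by (rule X_eqI) (simp_all add: T_X X_diff T_analysis analysis_diff mact_diff_right)

lemma T_semigroup:
  assumes "\<bar>Im \<zeta>\<bar> \<le> \<epsilon> * Re \<zeta>" "\<bar>Im \<eta>\<bar> \<le> \<epsilon> * Re \<eta>" "U \<in> X"
  shows "T (\<zeta> + \<eta>) U = T \<zeta> (T \<eta> U)"
proof (rule X_eqI)
  have s: "\<bar>Im (\<zeta> + \<eta>)\<bar> \<le> \<epsilon> * Re (\<zeta> + \<eta>)" using assms(1,2) by (simp add: distrib_left)
  show "T (\<zeta> + \<eta>) U \<in> X" "T \<zeta> (T \<eta> U) \<in> X" by (intro T_X s assms)+
  show "analysis (T (\<zeta> + \<eta>) U) \<mu> = analysis (T \<zeta> (T \<eta> U)) \<mu>" if "\<mu> \<in> \<Lambda>" for \<mu>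
    by (simp only: T_analysis[OF s assms(3)] T_analysis[OF assms(1) T_X[OF assms(2,3)]] T_analysis[OF assms(2,3)]
        mact_mact stable_add[OF stable that assms(1)])
qed

lemma real_cone: "t \<ge> 0 \<Longrightarrow> \<bar>Im (complex_of_real t)\<bar> \<le> \<epsilon> * Re (complex_of_real t)"
  using stable by (simp add: stable_def)

text \<open>Finite sums of modes are built by adding one mode at a time; \<open>S_single\<close>
  settles the added mode and additivity of both operators does the rest.\<close>

lemma T_real_trunc:
  assumes U: "U \<in> X" and t: "t \<ge> 0" and F: "finite F" "F \<subseteq> \<Lambda>"
  shows "T (complex_of_real t) (trunc F U) = S t (trunc F U)"
  using F
proof (induction F rule: finite_induct)
  case empty
  have z: "0 \<in> X" by (rule X_zero[OF U])
  have "trunc {} U = 0"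
    using analysis_diff[OF U U] by (intro X_eqI) (simp_all add: trunc_X U z trunc_analysis)
  moreover have "S t 0 = 0" using S_diff[OF t U U] by simp
  moreover have "T (complex_of_real t) 0 = 0" using T_diff[OF real_cone[OF t] U U] by simp
  ultimately show ?case by simp
next
  case (insert \<mu> F)
  have mu: "\<mu> \<in> \<Lambda>" using insert.prems by simp
  let ?y = "analysis U \<mu>"
  have y: "modal \<mu> ?y" by (rule modal_analysis[OF U])
  note sX = single_X[OF mu y]
  have "trunc (insert \<mu> F) U = trunc F U + single \<mu> ?y"
    using insert.hyps
    by (intro X_eqI) (auto simp: trunc_X U sX X_add trunc_analysis analysis_add single_props(2)[OF mu y])
  moreover have "T (complex_of_real t) (trunc F U + single \<mu> ?y) = T (complex_of_real t) (trunc F U) + T (complex_of_real t) (single \<mu> ?y)"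
    using T_bounded[OF real_cone[OF t]] trunc_X[OF U] sX unfolding bounded_operator_def by blast
  moreover have "T (complex_of_real t) (single \<mu> ?y) = S t (single \<mu> ?y)"
    unfolding S_single[OF mu y t]
  proof (rule X_eqI)
    show "T (complex_of_real t) (single \<mu> ?y) \<in> X" by (rule T_X[OF real_cone[OF t] sX])
    show "single \<mu> (mact (G \<mu> (complex_of_real t)) ?y) \<in> X" by (rule single_X[OF mu modal_mact[OF y]])
    show "analysis (T (complex_of_real t) (single \<mu> ?y)) \<nu> = analysis (single \<mu> (mact (G \<mu> (complex_of_real t)) ?y)) \<nu>" for \<nu>
      by (simp add: T_analysis[OF real_cone[OF t] sX] single_props(2)[OF mu y] single_props(2)[OF mu modal_mact[OF y]] mact_zero)
  qed
  ultimately show ?case using insert S_add[OF t trunc_X[OF U] sX] by simp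
qed

lemma T_real:
  assumes U: "U \<in> X" and t: "t \<ge> 0"
  shows "T (complex_of_real t) U = S t U"
proof -
  let ?T = "T (complex_of_real t)"
  have TX: "?T V \<in> X" if "V \<in> X" for V by (rule T_X[OF real_cone[OF t] that])
  have "N (?T U - S t U) \<le> 0 + e" if e: "e > 0" for e
  proof -
    \<comment> \<open>The truncation error passes through T with factor 32 and through the
      contraction S with factor 1.\<close>
    from e have "e / 33 > 0" by simp
    then obtain F where F: "finite F" "F \<subseteq> \<Lambda>" "N (U - trunc F U) < e / 33"
      by (rule trunc_approximates[OF U])
    let ?V = "trunc F U"
    have V: "?V \<in> X" by (rule trunc_X[OF U])
    have d: "U - ?V \<in> X" by (rule X_diff[OF U V])
    have "?T U - S t U = ?T (U - ?V) - S t (U - ?V)"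
      using T_real_trunc[OF U t F(1,2)] by (simp add: T_diff[OF real_cone[OF t] U V] S_diff[OF t U V])
    also have "N \<dots> \<le> N (?T (U - ?V)) + N (S t (U - ?V))" by (rule N_diff_triangle[OF TX[OF d] S_X[OF t d]])
    also have "\<dots> \<le> 32 * N (U - ?V) + N (U - ?V)"
      by (intro add_mono T_norm real_cone t d S_contraction)
    also have "\<dots> \<le> e" using F(3) by simp
    finally show ?thesis by simp
  qed
  then have "N (?T U - S t U) \<le> 0" by (rule field_le_epsilon)
  moreover have X: "?T U - S t U \<in> X" by (intro X_diff TX S_X t U)
  ultimately have "?T U - S t U = 0" using N_nonneg[of "?T U - S t U"] by (intro N_zero_imp) auto
  then show ?thesis by simp
qed

end

section \<open>Analyticity\<close>

context plate_semigroup
begin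

lemma G_holomorphic: "(\<lambda>\<zeta>. G \<mu> \<zeta> $ i $ j) holomorphic_on UNIV"
  unfolding holomorphic_on_open[OF open_UNIV] using G_derivative by blast

text \<open>The derivative is the multiplier with the entrywise derivatives. Its boundedness and the
  convergence in operator norm follow from Cauchy bounds on one disc, on which the entries are at
  most 2 for all eigenvalues.\<close>

lemma T_operator_derivative:
  assumes "\<bar>Im \<zeta>\<bar> < \<epsilon> * Re \<zeta>"
  shows "\<exists>T'. bounded_operator X N T' \<and> (\<forall>e>0. \<forall>\<^sub>F \<eta> in at \<zeta>. \<forall>U\<in>X.
    N (inverse (\<eta> - \<zeta>) *\<^sub>C (T \<eta> U - T \<zeta> U) - T' U) \<le> e * N U)"
proof -
  let ?O = "{\<zeta>. \<bar>Im \<zeta>\<bar> < \<epsilon> * Re \<zeta>}"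
  obtain R where R: "R > 0" "ball \<zeta> R \<subseteq> ?O"
    using open_cone[of \<epsilon>] assms unfolding open_contains_ball by blast
  \<comment> \<open>The Cauchy estimates with radius r use a bound on the disc of radius 2
    r.\<close>
  define r where "r = R / 2"
  have r: "r > 0" "ball \<zeta> (2 * r) \<subseteq> ?O" using R by (auto simp: r_def)
  have bound: "cmod (G \<mu> w $ i $ j) \<le> 2" if "\<mu> \<in> \<Lambda>" "w \<in> ball \<zeta> (2 * r)" for \<mu> w i j
  proof -
    have "\<bar>Im w\<bar> \<le> \<epsilon> * Re w" using that(2) r(2) by auto
    then show ?thesis using stable that(1) by (simp add: stable_def)
  qed
  define D where "D \<mu> = (\<chi> i j. deriv (\<lambda>\<zeta>. G \<mu> \<zeta> $ i $ j) \<zeta>)" for \<mu>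
  have D: "norm (D \<mu>) \<le> 16 * (2 / r)" if "\<mu> \<in> \<Lambda>" for \<mu>
    by (rule norm_matrix_le)
      (use Cauchy_first[OF G_holomorphic r(1) bound[OF that]] in \<open>simp add: D_def\<close>)
  have z: "\<bar>Im \<zeta>\<bar> \<le> \<epsilon> * Re \<zeta>" using assms by simp
  note M = Mult_props[where m=D and C="16 * (2 / r)", OF D]
  show ?thesis
  proof (intro exI[of _ "Mult D"] conjI allI impI)
    show "bounded_operator X N (Mult D)"
      by (rule Mult_bounded_operator[where C="16 * (2 / r)"]) (use D r in auto)
    fix e :: real assume e: "e > 0"
    \<comment> \<open>256 = 16 * 8 * 2: the number of entries, the constant of the difference
      quotient, the bound of the entries.\<close>
    define d where "d = min r (e * r\<^sup>2 / 256)"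
    have d: "d > 0" using r e by (simp add: d_def)
    have main: "N (inverse (\<eta> - \<zeta>) *\<^sub>C (T \<eta> U - T \<zeta> U) - Mult D U) \<le> e * N U"
      if eta: "\<eta> \<noteq> \<zeta>" "dist \<eta> \<zeta> < d" and U: "U \<in> X" for \<eta> U
    proof -
      have br: "\<eta> \<in> ball \<zeta> r" using eta(2) by (simp add: d_def dist_commute)
      then have "\<eta> \<in> ball \<zeta> (2 * r)" using r(1) by simp
      then have h: "\<bar>Im \<eta>\<bar> \<le> \<epsilon> * Re \<eta>" using r(2) by auto
      let ?k = "inverse (\<eta> - \<zeta>)"
      let ?W = "?k *\<^sub>C (T \<eta> U - T \<zeta> U) - Mult D U"
      have 1: "T \<eta> U - T \<zeta> U \<in> X" by (intro X_diff T_X h z U)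
      show ?thesis
      proof (rule N_le[OF U])
        show "?W \<in> X" by (intro X_diff X_scaleC 1 M(1) U)
        show "e \<ge> 0" using e by simp
        fix \<mu> assume mu: "\<mu> \<in> \<Lambda>"
        let ?A = "mat ?k ** (G \<mu> \<eta> - G \<mu> \<zeta>) - D \<mu>"
        have "analysis ?W \<mu> = mact ?A (analysis U \<mu>)"
          by (simp only: analysis_diff[OF X_scaleC[OF 1] M(1)[OF _ U]] analysis_scaleC[OF 1]
              analysis_diff[OF T_X[OF h U] T_X[OF z U]] T_analysis[OF h U] T_analysis[OF z U] M(2)[OF _ U]
              mact_diff_left mact_mact[symmetric])
        also have "norm \<dots> \<le> norm ?A * norm (analysis U \<mu>)" by (rule norm_mact)
        also have "\<dots> \<le> e * norm (analysis U \<mu>)"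
        proof (rule mult_right_mono)
          have "cmod (?A $ i $ j) \<le> 8 * 2 / r\<^sup>2 * cmod (\<eta> - \<zeta>)" for i j
            using Cauchy_difference_quotient[OF G_holomorphic r(1) bound[OF mu] br eta(1), of i j]
            by (simp add: mat_mult_nth D_def)
          then have "norm ?A \<le> 16 * (8 * 2 / r\<^sup>2 * cmod (\<eta> - \<zeta>))" by (rule norm_matrix_le)
          also have "\<dots> \<le> 16 * (8 * 2 / r\<^sup>2 * (e * r\<^sup>2 / 256))"
            using eta(2) by (intro mult_left_mono) (auto simp: d_def dist_norm)
          also have "\<dots> = e" using r(1) by simp
          finally show "norm ?A \<le> e" .
        qed simp
        finally show "norm (analysis ?W \<mu>) \<le> e * norm (analysis U \<mu>)" .
      qed
    qed
    show "\<forall>\<^sub>F \<eta> in at \<zeta>. \<forall>U\<in>X. N (inverse (\<eta> - \<zeta>) *\<^sub>C (T \<eta> U - T \<zeta> U) - Mult D U) \<le> e * N U"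
      unfolding eventually_at using d main by blast
  qed
qed

lemma G_tendsto: "(G \<mu> \<longlongrightarrow> mat 1) (at 0 within A)"
proof (rule vec_tendstoI, rule vec_tendstoI)
  fix i j
  have "isCont (\<lambda>\<zeta>. G \<mu> \<zeta> $ i $ j) 0" by (rule DERIV_isCont[OF G_derivative])
  then have "((\<lambda>\<zeta>. G \<mu> \<zeta> $ i $ j) \<longlongrightarrow> G \<mu> 0 $ i $ j) (at 0)" by (simp add: isCont_def)
  then show "((\<lambda>\<zeta>. G \<mu> \<zeta> $ i $ j) \<longlongrightarrow> mat 1 $ i $ j) (at 0 within A)"
    unfolding G_zero by (rule tendsto_within_subset) simp
qed

text \<open>Each matrix tends to the identity, at a speed that may depend on \<mu>; this limit is
  therefore used on finitely many modes, and the remainder is small by the uniform bound for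
  T.\<close>

lemma T_strongly_continuous:
  assumes sub: "\<And>\<zeta>. \<zeta> \<in> A \<Longrightarrow> \<bar>Im \<zeta>\<bar> \<le> \<epsilon> * Re \<zeta>" and U: "U \<in> X"
  shows "((\<lambda>\<zeta>. N (T \<zeta> U - U)) \<longlongrightarrow> 0) (at 0 within A)"
proof (rule tendstoI)
  fix e :: real assume e: "e > 0"
  \<comment> \<open>The remainder contributes at most (32 + 1) e / 66 = e/2; the other half of e is
    left for the truncated part.\<close>
  then have "e / 66 > 0" by simp
  then obtain F where F: "finite F" "F \<subseteq> \<Lambda>" "N (U - trunc F U) < e / 66"
    by (rule trunc_approximates[OF U])
  let ?V = "trunc F U"
  have V: "?V \<in> X" by (rule trunc_X[OF U])
  have d: "U - ?V \<in> X" by (rule X_diff[OF U V])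
  \<comment> \<open>The summand 1 avoids division by zero and makes \<open>c * N U\<close> strictly
    smaller than e/2.\<close>
  define c where "c = e / (2 * (N U + 1))"
  have c: "c > 0" using e N_nonneg[of U] by (auto simp: c_def intro!: divide_pos_pos)
  have cN: "c * N U < e / 2"
  proof -
    have "c * (N U + 1) = e / 2" using N_nonneg[of U] by (simp add: c_def field_simps)
    then show ?thesis using c by (simp add: distrib_left)
  qed
  have "\<forall>\<^sub>F \<zeta> in at 0 within A. \<forall>\<mu>\<in>F. dist (G \<mu> \<zeta>) (mat 1) < c"
    using F(1) tendstoD[OF G_tendsto c] by (simp add: eventually_ball_finite)
  moreover have "\<forall>\<^sub>F \<zeta> in at 0 within A. \<zeta> \<in> A" by (simp add: eventually_at_filter)
  ultimately show "\<forall>\<^sub>F \<zeta> in at 0 within A. dist (N (T \<zeta> U - U)) 0 < e"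
  proof eventually_elim
    case (elim \<zeta>)
    have z: "\<bar>Im \<zeta>\<bar> \<le> \<epsilon> * Re \<zeta>" by (rule sub[OF elim(2)])
    have TV: "T \<zeta> ?V - ?V \<in> X" by (intro X_diff T_X z V)
    have Td: "T \<zeta> (U - ?V) \<in> X" by (rule T_X[OF z d])
    have "T \<zeta> U - U = (T \<zeta> (U - ?V) + (T \<zeta> ?V - ?V)) - (U - ?V)"
      by (simp add: T_diff[OF z U V])
    then have "N (T \<zeta> U - U) \<le> N (T \<zeta> (U - ?V)) + N (T \<zeta> ?V - ?V) + N (U - ?V)"
      using N_diff_triangle[OF X_add[OF Td TV] d] N_triangle[OF Td TV] by simp
    moreover have "N (T \<zeta> (U - ?V)) \<le> 32 * N (U - ?V)" by (rule T_norm[OF z d])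
    moreover have "N (T \<zeta> ?V - ?V) \<le> c * N U"
    proof (rule N_le[OF U TV])
      show "c \<ge> 0" using c by simp
      fix \<mu> assume "\<mu> \<in> \<Lambda>"
      have "analysis (T \<zeta> ?V - ?V) \<mu> = mact (G \<mu> \<zeta> - mat 1) (analysis ?V \<mu>)"
        by (simp only: analysis_diff[OF T_X[OF z V] V] T_analysis[OF z V] mact_diff_left mact_mat_1)
      also have "norm \<dots> \<le> c * norm (analysis U \<mu>)"
      proof (cases "\<mu> \<in> F")
        case True
        then have "norm (G \<mu> \<zeta> - mat 1) \<le> c" using elim(1) by (auto simp: dist_norm less_imp_le)
        then show ?thesis
          using True by (auto simp: trunc_analysis[OF U] intro!: order_trans[OF norm_mact] mult_right_mono)
      next
        case False
        then show ?thesis using c by (simp add: trunc_analysis[OF U] mact_zero)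
      qed
      finally show "norm (analysis (T \<zeta> ?V - ?V) \<mu>) \<le> c * norm (analysis U \<mu>)" .
    qed
    ultimately have "N (T \<zeta> U - U) < e" using F(3) cN by linarith
    then show ?case using N_nonneg[of "T \<zeta> U - U"] by simp
  qed
qed

text \<open>The half-angle arctan \<epsilon> places the sector in the open cone, where a disc around
  each point is available for the Cauchy estimates.\<close>

lemma analytic: "analytic_semigroup X N S"
proof -
  have eps: "\<epsilon> > 0" using stable by (simp add: stable_def)
  have sec: "\<bar>Im \<zeta>\<bar> < \<epsilon> * Re \<zeta>" if "\<zeta> \<in> sector (arctan \<epsilon>)" for \<zeta>
    by (rule sector_arctan[OF that eps])
  show ?thesis
    unfolding analytic_semigroup_def
  proof (intro exI[of _ "arctan \<epsilon>"] exI[of _ T] conjI ballI allI impI)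
    show "0 < arctan \<epsilon>" "arctan \<epsilon> \<le> pi / 2" using eps arctan_ubound[of \<epsilon>] by simp_all
    show "T (complex_of_real t) U = S t U" if "t \<ge> 0" "U \<in> X" for t U by (rule T_real[OF that(2,1)])
    show "bounded_operator X N (T \<zeta>)" if "\<zeta> \<in> sector (arctan \<epsilon>)" for \<zeta>
      using sec[OF that] by (intro T_bounded) simp
    show "T (\<zeta> + \<eta>) U = T \<zeta> (T \<eta> U)" if "\<zeta> \<in> sector (arctan \<epsilon>)" "\<eta> \<in> sector (arctan \<epsilon>)" "U \<in> X" for \<zeta> \<eta> U
      using sec[OF that(1)] sec[OF that(2)] that(3) by (intro T_semigroup) auto
    show "\<exists>T'. bounded_operator X N T' \<and> (\<forall>e>0. \<forall>\<^sub>F \<eta> in at \<zeta>. \<forall>U\<in>X.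
        N (inverse (\<eta> - \<zeta>) *\<^sub>C (T \<eta> U - T \<zeta> U) - T' U) \<le> e * N U)" if "\<zeta> \<in> sector (arctan \<epsilon>)" for \<zeta>
      by (rule T_operator_derivative[OF sec[OF that]])
    show "((\<lambda>\<zeta>. N (T \<zeta> U - U)) \<longlongrightarrow> 0) (at 0 within sector (arctan \<epsilon>))" if "U \<in> X" for U
      by (rule T_strongly_continuous[OF _ that]) (use sec in force)
  qed
qed

end

theorem mainTheorem4:
  fixes \<Omega> :: "(real ^ 'n) set"
    and \<alpha> \<kappa> \<gamma> \<delta> \<theta> \<beta> :: real
    and S :: "real \<Rightarrow> (real ^ 'n) phase \<Rightarrow> (real ^ 'n) phase"
  assumes "open \<Omega>" and "bounded \<Omega>" and "smooth_boundary \<Omega>"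
    and "\<alpha> > 0" and "\<kappa> > 0" and "\<gamma> > 0" and "\<delta> > 0"
    and "(\<theta>, \<beta>) = (1/2, 1)"
    and "C0_contraction_semigroup (phase_space \<Omega> \<beta>) (phase_norm \<Omega> \<alpha> \<kappa> \<beta>) S"
    and "is_generator (phase_space \<Omega> \<beta>) (phase_norm \<Omega> \<alpha> \<kappa> \<beta>) S
           (dom_B \<Omega> \<alpha> \<gamma> \<delta> \<theta> \<beta>) (op_B \<Omega> \<alpha> \<kappa> \<gamma> \<delta> \<theta> \<beta>)"
  shows "analytic_semigroup (phase_space \<Omega> \<beta>) (phase_norm \<Omega> \<alpha> \<kappa> \<beta>) S"
proof -
  have eq: "\<theta> = 1/2" "\<beta> = 1" using assms(8) by simp_all
  interpret plate \<Omega> \<alpha> \<kappa> \<gamma> \<delta> by unfold_locales (use assms in auto)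
  obtain \<epsilon> where "stable \<epsilon>" using stable_exists by blast
  then interpret plate_semigroup \<Omega> \<alpha> \<kappa> \<gamma> \<delta> S \<epsilon>
    by unfold_locales (use assms(9,10) in \<open>auto simp: eq\<close>)
  show ?thesis unfolding eq by (rule analytic)
qed

end
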